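(* Let $n\ge3$, $s\in(0,n/2)$, and let $P_s=\frac{\Gamma(B+\frac12+s)}{\Gamma(B+\frac12-s)}$ with $B=\sqrt{-\Delta_{g_{\mathbb{S}^n}}+(\frac{n-1}{2})^2}$ on the round sphere $\mathbb{S}^n$, and $d_{n,s}=\frac{\Gamma(\frac n2+s)}{\Gamma(\frac n2-s)}$. Let $f_1,f_2:(0,+\infty)\times(0,+\infty)\to\mathbb{R}$ be continuous and consider $$P_su_1-d_{n,s}u_1=f_1(u_1,u_2),\quad P_su_2-d_{n,s}u_2=f_2(u_1,u_2),\quad u_1,u_2>0\ \text{ on }\mathbb{S}^n.\qquad(\ast)$$ For $i=1,2$ and $t_1,t_2>0$ let $h_{is}(t_1,t_2)=t_i^{-\frac{n+2s}{n-2s}}\big(f_i(t_1,t_2)+d_{n,s}t_i\big)$. Assume that for $i,j\in\{1,2\}$: - $h_{is}(t_1,t_2)$ is nondecreasing in $t_j>0$ when $i\ne j$; - $h_{is}(t_1,t_2)t_i^{\frac{n+2s}{n-2s}}$ is nondecreasing in $t_i>0$; - $t\mapsto h_{is}(a_1t,a_2t)$ is decreasing on $(0,+\infty)$ for any $a_1,a_2>0$. Then every pair $(u_1,u_2)$ of continuous solutions of $(\ast)$ consists of constant functions.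
   Context: $\Delta_{g_{\mathbb{S}^n}}$ is the Laplace–Beltrami operator of the round metric. *)

theory Defs
  imports "HOL-Analysis.Analysis"
begin

text \<open>The round sphere S^n is the unit sphere sphere 0 1 in a Euclidean space 'a
  of dimension n+1.\<close>

definition hom0_ext :: "('a::euclidean_space \<Rightarrow> real) \<Rightarrow> 'a \<Rightarrow> real" where
  "hom0_ext Y = (\<lambda>y. Y (y /\<^sub>R norm y))"

definition C1_on :: "'a::euclidean_space set \<Rightarrow> ('a \<Rightarrow> real) \<Rightarrow> bool" where
  "C1_on S g \<longleftrightarrow> (\<exists>g'. (\<forall>x\<in>S. (g has_derivative g' x) (at x)) \<and>
                       (\<forall>v. continuous_on S (\<lambda>x. g' x v)))"

definition C2_on :: "'a::euclidean_space set \<Rightarrow> ('a \<Rightarrow> real) \<Rightarrow> bool" where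
  "C2_on S g \<longleftrightarrow> (\<exists>g'. (\<forall>x\<in>S. (g has_derivative g' x) (at x)) \<and>
                       (\<forall>v. C1_on S (\<lambda>x. g' x v)))"

definition eucl_laplacian :: "('a::euclidean_space \<Rightarrow> real) \<Rightarrow> 'a \<Rightarrow> real" where
  "eucl_laplacian g x =
     (\<Sum>b\<in>Basis. deriv (\<lambda>t. deriv (\<lambda>r. g (x + r *\<^sub>R b)) t) 0)"

definition laplace_beltrami :: "('a::euclidean_space \<Rightarrow> real) \<Rightarrow> 'a \<Rightarrow> real" where
  "laplace_beltrami Y x = eucl_laplacian (hom0_ext Y) x"

definition sph_eigenfun :: "real \<Rightarrow> ('a::euclidean_space \<Rightarrow> real) \<Rightarrow> bool" where
  "sph_eigenfun lam Y \<longleftrightarrow> C2_on (- {0}) (hom0_ext Y) \<and>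
     (\<forall>x\<in>sphere 0 1. - laplace_beltrami Y x = lam * Y x)"

text \<open>Integral over S^n w.r.t. the standard surface measure, via
  int_{S^n} g = (n+1) int_{B^{n+1}} g(x/|x|) dx.\<close>
definition sphere_integral :: "('a::euclidean_space \<Rightarrow> real) \<Rightarrow> real" where
  "sphere_integral g = real DIM('a) * integral (ball 0 1) (\<lambda>x. g (x /\<^sub>R norm x))"

text \<open>Multiplier of P_s = Gamma(B+1/2+s)/Gamma(B+1/2-s), B = sqrt(-Delta + ((n-1)/2)^2),
  on an eigenfunction of -Delta with eigenvalue lam.\<close>
definition Ps_mult :: "real \<Rightarrow> real \<Rightarrow> real \<Rightarrow> real" where
  "Ps_mult n s lam = (let B = sqrt (lam + ((n - 1) / 2)\<^sup>2) in
                       Gamma (B + 1/2 + s) / Gamma (B + 1/2 - s))"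

definition d_const :: "real \<Rightarrow> real \<Rightarrow> real" where
  "d_const n s = Gamma (n / 2 + s) / Gamma (n / 2 - s)"

text \<open>u solves P_s u - d_{n,s} u = F on S^n in the (distributional / spectral) sense:
  tested against every eigenfunction Y of -Delta (P_s being self-adjoint).\<close>
definition weak_solution :: "real \<Rightarrow> real \<Rightarrow> ('a::euclidean_space \<Rightarrow> real) \<Rightarrow> ('a \<Rightarrow> real) \<Rightarrow> bool" where
  "weak_solution n s u F \<longleftrightarrow>
     (\<forall>lam Y. sph_eigenfun lam Y \<longrightarrow>
        sphere_integral (\<lambda>x. u x * ((Ps_mult n s lam - d_const n s) * Y x))
        = sphere_integral (\<lambda>x. F x * Y x))"

end

theory Submission
  imports Defs
begin

text \<open>
  Put \<open>\<alpha> = n/2 - s\<close>. The Poisson kernel expands in zonal eigenfunctions of the Laplacian, and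
  integrating it against \<open>r powr (\<alpha> - 1) * (1 - r) powr (2 * s - 1)\<close> over \<open>0 < r < 1\<close> multiplies the
  \<open>l\<close>-th eigenspace by \<open>Gamma (2 * s)\<close> divided by the eigenvalue of \<open>P_s\<close>; the same integral equals a
  constant times \<open>norm (x - y) powr (- 2 * \<alpha>)\<close>. Hence a weak solution satisfies
  \<open>u_i = \<kappa> \<integral> norm (x - y) powr (- 2 * \<alpha>) * F_i dy\<close> with \<open>F_i = f_i + d u_i\<close>.

  This equation is compared with its image under the conformal reflections of the sphere in the
  caps \<open>{x. c < x \<bullet> \<omega>}\<close>. The hypotheses on \<open>h_i\<close> say exactly that \<open>F_i\<close> is monotone and that
  \<open>r powr p * F_i t < F_i (r t)\<close> for \<open>0 < r < 1\<close>; this makes the reflected solution a strict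
  supersolution inside the cap and also replaces the missing Lipschitz bound in the narrow region
  principle. Lowering \<open>c\<close> from 1 to 0 gives \<open>u_i x \<le> u_i (reflection of x)\<close> for every hyperplane
  reflection, so each \<open>u_i\<close> is constant.
\<close>

section \<open>Surface measure on the sphere\<close>

text \<open>Three obstacles shape the proof. \<open>f1\<close> and \<open>f2\<close> are only
  continuous and the solutions only weak, so no pointwise maximum principle for \<open>P_s\<close>
  is at hand; in the integral equation the signs of kernels suffice. For the inversion, testing with
  zonal functions is enough: the Poisson kernel is an approximate identity, so Abel means recover
  \<open>u\<close> pointwise and completeness of spherical harmonics is never invoked. Conformal
  changes of variables on the sphere require a Jacobian; since the surface measure is defined
  through cones over subsets of the sphere, it comes from a map of the ambient space that moves
  points along one fixed direction. The reflected solution and the reflected source carry the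
  weights \<open>\<alpha>\<close> and \<open>n - \<alpha>\<close>, and
  \<open>\<alpha> * p = n - \<alpha>\<close> is the relation by which the power \<open>p\<close> in
  the hypothesis on rays matches them. Strictness of that hypothesis is what lets \<open>c\<close>
  move past every positive value. At \<open>c = 0\<close> the conformal factor is 1 and only the
  weak inequality remains; it is enough because both orientations of each hyperplane are
  available.\<close>

definition sphere_measure :: "'a::euclidean_space measure" where
  "sphere_measure = distr (restrict_space lborel (ball 0 1 - {0}))
     (restrict_space borel (sphere 0 1)) (\<lambda>x. x /\<^sub>R norm x)"

lemma space_sphere_measure [simp]: "space (sphere_measure :: 'a::euclidean_space measure) = sphere 0 1"
  by (simp add: sphere_measure_def space_restrict_space)

lemma sets_sphere_measure [simp, measurable_cong]:
  "sets (sphere_measure :: 'a::euclidean_space measure) = sets (restrict_space borel (sphere 0 1))"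
  by (simp add: sphere_measure_def)

lemma measurable_normalize:
  "(\<lambda>x::'a::euclidean_space. x /\<^sub>R norm x)
     \<in> restrict_space lborel (ball 0 1 - {0}) \<rightarrow>\<^sub>M restrict_space borel (sphere 0 1)"
  by (rule measurable_restrict_space3) (auto simp: Pi_def)

lemma borel_measurable_sphereI:
  fixes g :: "'a::euclidean_space \<Rightarrow> 'b::topological_space"
  assumes "continuous_on (sphere 0 1) g"
  shows "g \<in> borel_measurable sphere_measure"
  using borel_measurable_continuous_on_restrict[OF assms]
  by (simp cong: measurable_cong_sets)

lemma borel_measurable_sphere_restrictI:
  fixes g :: "'a::euclidean_space \<Rightarrow> 'b::topological_space"
  assumes "g \<in> borel_measurable borel"
  shows "g \<in> borel_measurable sphere_measure"
  using measurable_restrict_space1[OF assms, of "sphere 0 1"]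
  by (simp cong: measurable_cong_sets)

lemma nn_integral_sphere_measure:
  fixes f :: "'a::euclidean_space \<Rightarrow> ennreal"
  assumes "f \<in> borel_measurable sphere_measure"
  shows "(\<integral>\<^sup>+x. f x \<partial>sphere_measure)
       = (\<integral>\<^sup>+x. f (x /\<^sub>R norm x) * indicator (ball 0 1 - {0}) x \<partial>lborel)"
proof -
  have f: "f \<in> borel_measurable (restrict_space borel (sphere 0 1))"
    using assms by (simp cong: measurable_cong_sets)
  have "(\<integral>\<^sup>+x. f x \<partial>sphere_measure)
      = (\<integral>\<^sup>+x. f (x /\<^sub>R norm x) \<partial>restrict_space lborel (ball 0 1 - {0}))"
    unfolding sphere_measure_def
    by (intro nn_integral_distr[OF measurable_normalize]) (use f in simp)
  also have "\<dots> = (\<integral>\<^sup>+x. f (x /\<^sub>R norm x) * indicator (ball 0 1 - {0}) x \<partial>lborel)"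
    by (rule nn_integral_restrict_space) simp
  finally show ?thesis .
qed

lemma finite_measure_sphere_measure: "finite_measure (sphere_measure :: 'a::euclidean_space measure)"
proof
  have "emeasure (sphere_measure :: 'a measure) (space sphere_measure)
      = (\<integral>\<^sup>+x. 1 \<partial>(sphere_measure :: 'a measure))" by simp
  also have "\<dots> = (\<integral>\<^sup>+x. indicator (ball 0 1 - {0::'a}) x \<partial>lborel)"
    by (subst nn_integral_sphere_measure) auto
  also have "\<dots> = emeasure lborel (ball 0 1 - {0::'a})" by (simp add: nn_integral_indicator)
  also have "\<dots> \<le> emeasure lborel (ball 0 1 :: 'a set)" by (intro emeasure_mono) auto
  also have "\<dots> < \<infinity>" using emeasure_lborel_ball_finite by auto
  finally show "emeasure (sphere_measure :: 'a measure) (space sphere_measure) \<noteq> \<infinity>" by auto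
qed

interpretation sphere_measure: finite_measure "sphere_measure :: 'a::euclidean_space measure"
  by (rule finite_measure_sphere_measure)

section \<open>Polar coordinates and substitution on the whole line\<close>

lemma nn_integral_lborel_scale:
  fixes f :: "'a::euclidean_space \<Rightarrow> ennreal"
  assumes [measurable]: "f \<in> borel_measurable borel" and "c > 0"
  shows "(\<integral>\<^sup>+x. f x \<partial>lborel) = ennreal (c ^ DIM('a)) * (\<integral>\<^sup>+x. f (c *\<^sub>R x) \<partial>lborel)"
  using assms(2)
  by (subst lborel_affine[of c 0])
     (simp_all add: nn_integral_density nn_integral_distr nn_integral_cmult)

lemma nn_integral_lborel_translate:
  fixes f :: "'a::euclidean_space \<Rightarrow> ennreal"
  assumes [measurable]: "f \<in> borel_measurable borel"
  shows "(\<integral>\<^sup>+x. f x \<partial>lborel) = (\<integral>\<^sup>+x. f (x + v) \<partial>lborel)"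
  by (subst lborel_distr_plus[of v, symmetric]) (simp_all add: nn_integral_distr add.commute)

text \<open>A probability density on the half-line from \<open>c\<close>, for every
  \<open>c\<close>. It serves as the inserted weight in \<open>nn_integral_polar\<close> and as the
  layer-cake formula for inverse powers in \<open>poisson_mass_bounded\<close>.\<close>

lemma nn_integral_power_tail:
  assumes "0 < (c::real)" "0 < N"
  shows "(\<integral>\<^sup>+t. ennreal (real N * c ^ N / t ^ (N + 1)) * indicator {c..} t \<partial>lborel) = 1"
proof -
  obtain M where N: "N = Suc M" using assms by (cases N) auto
  have "(\<integral>\<^sup>+t. ennreal (real N * c ^ N / t ^ (N + 1)) * indicator {c..} t \<partial>lborel)
      = ennreal (0 - (- ((c / c) ^ N)))"
  proof (rule nn_integral_FTC_atLeast[where F = "\<lambda>t. - ((c / t) ^ N)"])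
    show "((\<lambda>t. - ((c / t) ^ N)) has_real_derivative real N * c ^ N / t ^ (N + 1)) (at t)"
      if "c \<le> t" for t
    proof -
      have "((\<lambda>t. c / t) has_real_derivative - c / (t * t)) (at t)"
        using that assms by (auto intro!: derivative_eq_intros)
      from DERIV_minus[OF DERIV_power[OF this, of N]]
      have "((\<lambda>t. - ((c / t) ^ N)) has_real_derivative
              - (real N * ((c / t) ^ M * (- c / (t * t))))) (at t)"
        by (simp only: N diff_Suc_Suc diff_zero mult_ac)
      also have "- (real N * ((c / t) ^ M * (- c / (t * t)))) = real N * c ^ N / t ^ (N + 1)"
        using that assms by (simp add: N power_divide mult_ac)
      finally show ?thesis .
    qed
    show "((\<lambda>t. - ((c / t) ^ N)) \<longlongrightarrow> 0) at_top"
    proof -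
      have "((\<lambda>t. c / t) \<longlongrightarrow> 0) at_top"
        by (intro tendsto_divide_0[OF tendsto_const] filterlim_at_top_imp_at_infinity filterlim_ident)
      from tendsto_power[OF this, of N] assms show ?thesis
        using tendsto_minus by (fastforce simp: zero_power)
    qed
  qed (use assms in auto)
  also have "\<dots> = 1" using assms by simp
  finally show ?thesis .
qed


text \<open>The factor \<open>DIM('a)\<close> compensates the normalisation of
  \<open>sphere_measure\<close>, which gives a set the volume of the cone over it, that is, its area
  divided by the dimension.\<close>

lemma nn_integral_polar:
  fixes f :: "'a::euclidean_space \<Rightarrow> ennreal"
  assumes [measurable]: "f \<in> borel_measurable borel"
  shows "(\<integral>\<^sup>+x. f x \<partial>lborel) = of_nat DIM('a) *
     (\<integral>\<^sup>+z. (\<integral>\<^sup>+r. f (r *\<^sub>R z) * ennreal (r ^ (DIM('a) - 1)) * indicator {0<..} r \<partial>lborel) \<partial>sphere_measure)"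
proof -
  define N where "N = DIM('a)"
  have N: "0 < N" unfolding N_def by simp
  then have NS: "N = Suc (N - 1)" by simp
  \<comment> \<open>Inserting a weight with \<open>\<integral> W x t dt = 1\<close> and rescaling \<open>x\<close> by \<open>t\<close> turns radial integration into Tonelli.\<close>
  define W where "W x t = (if norm x \<le> t then ennreal (real N * norm x ^ N / t ^ (N + 1)) else 0)"
    for x :: 'a and t :: real
  have [measurable]: "case_prod W \<in> borel_measurable (lborel \<Otimes>\<^sub>M lborel)"
    unfolding W_def case_prod_beta by measurable
  have [measurable]: "cball (0::'a) 1 \<in> sets borel" "{0<..} \<in> sets (borel :: real measure)"
    by simp_all
  have W1: "(\<integral>\<^sup>+t. W x t \<partial>lborel) = 1" if "x \<noteq> 0" for x
    using nn_integral_power_tail[of "norm x" N] that N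
    by (simp add: W_def indicator_def of_bool_def if_distrib cong: if_cong)
  have "(\<integral>\<^sup>+x. f x \<partial>lborel) = (\<integral>\<^sup>+x. (\<integral>\<^sup>+t. f x * W x t \<partial>lborel) \<partial>lborel)"
  proof (rule nn_integral_cong_AE)
    show "AE x in lborel. f x = (\<integral>\<^sup>+t. f x * W x t \<partial>lborel)"
      using AE_lborel_singleton[of 0]
    proof eventually_elim
      case (elim x)
      have [measurable]: "(\<lambda>t. W x t) \<in> borel_measurable lborel" by measurable
      show ?case using W1[OF elim] by (simp add: nn_integral_cmult)
    qed
  qed
  also have "\<dots> = (\<integral>\<^sup>+t. (\<integral>\<^sup>+x. f x * W x t \<partial>lborel) \<partial>lborel)"
    by (rule lborel_pair.Fubini'[symmetric]) measurable
  also have "\<dots> = (\<integral>\<^sup>+t. (\<integral>\<^sup>+x. ennreal (t ^ N) * (f (t *\<^sub>R x) * W (t *\<^sub>R x) t) * indicator {0<..} t \<partial>lborel) \<partial>lborel)"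
  proof (rule nn_integral_cong_AE)
    show "AE t in lborel. (\<integral>\<^sup>+x. f x * W x t \<partial>lborel)
      = (\<integral>\<^sup>+x. ennreal (t ^ N) * (f (t *\<^sub>R x) * W (t *\<^sub>R x) t) * indicator {0<..} t \<partial>lborel)"
      using AE_lborel_singleton[of 0]
    proof eventually_elim
      case (elim t)
      have [measurable]: "(\<lambda>x. W x t) \<in> borel_measurable borel"
        unfolding W_def by measurable
      show ?case
      proof (cases "t > 0")
        case True
        then show ?thesis
          by (subst nn_integral_lborel_scale[OF _ True]) (simp_all add: nn_integral_cmult N_def)
      next
        case False
        then have "W x t = 0" for x
          using elim norm_ge_zero[of x] by (auto simp: W_def indicator_def simp del: norm_ge_zero)
        then show ?thesis using False by simp
      qed
    qed
  qed
  also have "\<dots> = (\<integral>\<^sup>+t. (\<integral>\<^sup>+x. ennreal (real N * norm x ^ N * t ^ (N - 1)) * f (t *\<^sub>R x)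
        * indicator (cball 0 1) x * indicator {0<..} t \<partial>lborel) \<partial>lborel)"
  proof (intro nn_integral_cong)
    fix t :: real and x :: 'a
    show "ennreal (t ^ N) * (f (t *\<^sub>R x) * W (t *\<^sub>R x) t) * indicator {0<..} t
        = ennreal (real N * norm x ^ N * t ^ (N - 1)) * f (t *\<^sub>R x)
        * indicator (cball 0 1) x * indicator {0<..} t"
    proof (cases "t > 0")
      case True
      have "t ^ N * (real N * (t * norm x) ^ N / t ^ (N + 1)) = real N * norm x ^ N * t ^ (N - 1)"
        using True by (subst (1) NS) (simp add: power_mult_distrib)
      then have "ennreal (t ^ N) * ennreal (real N * (t * norm x) ^ N / t ^ (N + 1))
          = ennreal (real N * norm x ^ N * t ^ (N - 1))"
        using True by (subst ennreal_mult'[symmetric]) auto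
      note eq = this
      have "ennreal (t ^ N) * (f (t *\<^sub>R x) * ennreal (real N * (t * norm x) ^ N / t ^ (N + 1)))
          = ennreal (real N * norm x ^ N * t ^ (N - 1)) * f (t *\<^sub>R x)"
        unfolding eq[symmetric] by (simp only: mult_ac)
      then show ?thesis using True
        by (cases "norm x \<le> 1") (simp_all add: W_def indicator_def)
    qed simp
  qed
  also have "\<dots> = (\<integral>\<^sup>+x. (\<integral>\<^sup>+t. ennreal (real N * norm x ^ N * t ^ (N - 1)) * f (t *\<^sub>R x)
        * indicator (cball 0 1) x * indicator {0<..} t \<partial>lborel) \<partial>lborel)"
    by (rule lborel_pair.Fubini') measurable
  \<comment> \<open>The variable \<open>x\<close> is now confined to the unit ball. Substituting
    \<open>r = norm x * t\<close> makes the inner integral depend on the direction of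
    \<open>x\<close> only; the sphere and the origin are null sets.\<close>
  also have "\<dots> = (\<integral>\<^sup>+x. of_nat N * (\<integral>\<^sup>+r. f (r *\<^sub>R (x /\<^sub>R norm x)) * ennreal (r ^ (N - 1)) * indicator {0<..} r \<partial>lborel)
        * indicator (ball 0 1 - {0}) x \<partial>lborel)"
  proof (rule nn_integral_cong_AE)
    have "AE x in lborel. x \<notin> sphere (0::'a) 1"
      by (rule AE_not_in) (metis negligible_sphere negligible_iff_null_sets null_sets_completion_iff
          sets_lborel borel_closed closed_sphere)
    then show "AE x in lborel. (\<integral>\<^sup>+t. ennreal (real N * norm x ^ N * t ^ (N - 1)) * f (t *\<^sub>R x)
        * indicator (cball 0 1) x * indicator {0<..} t \<partial>lborel)
        = of_nat N * (\<integral>\<^sup>+r. f (r *\<^sub>R (x /\<^sub>R norm x)) * ennreal (r ^ (N - 1)) * indicator {0<..} r \<partial>lborel)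
        * indicator (ball 0 1 - {0}) x"
      using AE_lborel_singleton[of 0]
    proof eventually_elim
      case (elim x)
      show ?case
      proof (cases "norm x < 1")
        case True
        have x0: "norm x > 0" using elim by simp
        have "(\<integral>\<^sup>+r. f (r *\<^sub>R (x /\<^sub>R norm x)) * ennreal (r ^ (N - 1)) * indicator {0<..} r \<partial>lborel)
          = ennreal (norm x) * (\<integral>\<^sup>+t. f (t *\<^sub>R x) * ennreal ((norm x * t) ^ (N - 1)) * indicator {0<..} t \<partial>lborel)"
          using x0 by (subst nn_integral_real_affine[where c = "norm x" and t = 0])
            (auto simp: indicator_def zero_less_mult_iff field_simps intro!: arg_cong2[where f="(*)"] nn_integral_cong)
        also have "\<dots> = (\<integral>\<^sup>+t. ennreal (norm x) * (f (t *\<^sub>R x) * ennreal ((norm x * t) ^ (N - 1)) * indicator {0<..} t) \<partial>lborel)"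
          by (rule nn_integral_cmult[symmetric]) measurable
        also have "of_nat N * \<dots> = (\<integral>\<^sup>+t. of_nat N * (ennreal (norm x) * (f (t *\<^sub>R x) * ennreal ((norm x * t) ^ (N - 1)) * indicator {0<..} t)) \<partial>lborel)"
          by (rule nn_integral_cmult[symmetric]) measurable
        also have "\<dots> = (\<integral>\<^sup>+t. ennreal (real N * norm x ^ N * t ^ (N - 1)) * f (t *\<^sub>R x)
           * indicator (cball 0 1) x * indicator {0<..} t \<partial>lborel)"
        proof (rule nn_integral_cong)
          fix t :: real
          show "of_nat N * (ennreal (norm x) * (f (t *\<^sub>R x) * ennreal ((norm x * t) ^ (N - 1)) * indicator {0<..} t))
             = ennreal (real N * norm x ^ N * t ^ (N - 1)) * f (t *\<^sub>R x)
           * indicator (cball 0 1) x * indicator {0<..} t"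
          proof (cases "t > 0")
            case True
            have "real N * norm x ^ N * t ^ (N - 1) = real N * norm x * (norm x * t) ^ (N - 1)"
              by (subst (2) NS) (simp add: power_mult_distrib)
            moreover have "ennreal (real N * norm x * (norm x * t) ^ (N - 1))
               = of_nat N * ennreal (norm x) * ennreal ((norm x * t) ^ (N - 1))"
              using True by (simp add: ennreal_mult ennreal_of_nat_eq_real_of_nat)
            ultimately have "ennreal (real N * norm x ^ N * t ^ (N - 1))
               = of_nat N * ennreal (norm x) * ennreal ((norm x * t) ^ (N - 1))"
              by (simp only:)
            then show ?thesis using True \<open>norm x < 1\<close>
              by (simp add: indicator_def mult_ac)
          qed simp
        qed
        finally show ?thesis using True elim by simp
      next
        case False
        then show ?thesis using elim by simp
      qed
    qed
  qed
  also have "\<dots> = (\<integral>\<^sup>+z. of_nat N * (\<integral>\<^sup>+r. f (r *\<^sub>R z) * ennreal (r ^ (N - 1)) * indicator {0<..} r \<partial>lborel) \<partial>sphere_measure)"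
    by (subst nn_integral_sphere_measure) (auto intro!: borel_measurable_sphere_restrictI)
  also have "\<dots> = of_nat N * (\<integral>\<^sup>+z. (\<integral>\<^sup>+r. f (r *\<^sub>R z) * ennreal (r ^ (N - 1)) * indicator {0<..} r \<partial>lborel) \<partial>sphere_measure)"
    by (rule nn_integral_cmult) (auto intro!: borel_measurable_sphere_restrictI)
  finally show ?thesis unfolding N_def .
qed

lemma SUP_eq_attained:
  fixes F :: "nat \<Rightarrow> ennreal"
  assumes "c = F k" "\<And>j. F j \<le> c"
  shows "(SUP j. F j) = c"
  using assms by (metis SUP_eqI UNIV_I)

text \<open>Substitution on the compact intervals from \<open>-k\<close> to \<open>k\<close>,
  followed by monotone convergence. The two limits of \<open>g\<close> ensure that the image
  intervals exhaust the line.\<close>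

lemma nn_integral_substitution_UNIV:
  fixes f g g' :: "real \<Rightarrow> real"
  assumes f [measurable]: "f \<in> borel_measurable borel"
    and deriv: "\<And>x. (g has_real_derivative g' x) (at x)"
    and cont: "continuous_on UNIV g'" and nonneg: "\<And>x. g' x \<ge> 0"
    and top: "filterlim g at_top at_top" and bot: "filterlim g at_bot at_bot"
  shows "(\<integral>\<^sup>+x. ennreal (f x) \<partial>lborel) = (\<integral>\<^sup>+x. ennreal (f (g x) * g' x) \<partial>lborel)"
proof -
  have gm: "g x \<le> g y" if "x \<le> y" for x y
    using DERIV_nonneg_imp_nondecreasing[OF that] deriv nonneg by blast
  have [measurable]: "g' \<in> borel_measurable borel"
    using cont by (rule borel_measurable_continuous_onI)
  have [measurable]: "g \<in> borel_measurable borel"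
    using deriv by (intro borel_measurable_continuous_onI DERIV_continuous_on) (auto intro: has_field_derivative_at_within)
  have A: "(\<integral>\<^sup>+x. ennreal (f x) \<partial>lborel) = (SUP k::nat. \<integral>\<^sup>+x. ennreal (f x * indicator {g (- real k)..g (real k)} x) \<partial>lborel)"
  proof (subst nn_integral_monotone_convergence_SUP[symmetric])
    show "incseq (\<lambda>k x. ennreal (f x * indicator {g (- real k)..g (real k)} x))"
    proof (intro incseq_SucI le_funI)
      fix k :: nat and x
      have "g (- real (Suc k)) \<le> g (- real k)" "g (real k) \<le> g (real (Suc k))" by (auto intro!: gm)
      then show "ennreal (f x * indicator {g (- real k)..g (real k)} x)
          \<le> ennreal (f x * indicator {g (- real (Suc k))..g (real (Suc k))} x)"
        by (auto simp: indicator_def)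
    qed
    show "(\<integral>\<^sup>+x. ennreal (f x) \<partial>lborel) = (\<integral>\<^sup>+x. (SUP k::nat. ennreal (f x * indicator {g (- real k)..g (real k)} x)) \<partial>lborel)"
    proof (rule nn_integral_cong)
      fix x
      from top obtain a where a: "\<And>y. y \<ge> a \<Longrightarrow> g y \<ge> x"
        unfolding filterlim_at_top eventually_at_top_linorder by blast
      from bot obtain b where b: "\<And>y. y \<le> b \<Longrightarrow> g y \<le> x"
        unfolding filterlim_at_bot eventually_at_bot_linorder by blast
      obtain k :: nat where k: "real k \<ge> max a (- b)" using real_arch_simple by blast
      have "x \<in> {g (- real k)..g (real k)}" using a[of "real k"] b[of "- real k"] k by auto
      then have "ennreal (f x) = ennreal (f x * indicator {g (- real k)..g (real k)} x)" by simp
      then show "ennreal (f x) = (SUP k::nat. ennreal (f x * indicator {g (- real k)..g (real k)} x))"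
        by (rule SUP_eq_attained[of _ _ k, symmetric]) (auto simp: indicator_def)
    qed
  qed auto
  have B: "(\<integral>\<^sup>+x. ennreal (f (g x) * g' x) \<partial>lborel) = (SUP k::nat. \<integral>\<^sup>+x. ennreal (f (g x) * g' x * indicator {- real k..real k} x) \<partial>lborel)"
  proof (subst nn_integral_monotone_convergence_SUP[symmetric])
    show "incseq (\<lambda>k x. ennreal (f (g x) * g' x * indicator {- real k..real k} x))"
      by (intro incseq_SucI le_funI) (auto simp: indicator_def)
    show "(\<integral>\<^sup>+x. ennreal (f (g x) * g' x) \<partial>lborel)
        = (\<integral>\<^sup>+x. (SUP k::nat. ennreal (f (g x) * g' x * indicator {- real k..real k} x)) \<partial>lborel)"
    proof (rule nn_integral_cong)
      fix x :: real
      obtain k :: nat where k: "real k \<ge> \<bar>x\<bar>" using real_arch_simple by blast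
      have "x \<in> {- real k..real k}" using k by auto
      then have "ennreal (f (g x) * g' x) = ennreal (f (g x) * g' x * indicator {- real k..real k} x)" by simp
      then show "ennreal (f (g x) * g' x) = (SUP k::nat. ennreal (f (g x) * g' x * indicator {- real k..real k} x))"
        by (rule SUP_eq_attained[of _ _ k, symmetric]) (auto simp: indicator_def)
    qed
  qed auto
  show ?thesis unfolding A B
  proof (intro SUP_cong refl)
    fix k :: nat
    show "(\<integral>\<^sup>+x. ennreal (f x * indicator {g (- real k)..g (real k)} x) \<partial>lborel)
       = (\<integral>\<^sup>+x. ennreal (f (g x) * g' x * indicator {- real k..real k} x) \<partial>lborel)"
      by (rule nn_integral_substitution)
         (auto intro!: deriv nonneg continuous_on_subset[OF cont] simp: set_borel_measurable_def)
  qed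
qed

section \<open>Conformal reflections\<close>

text \<open>Fubini along an arbitrary direction \<open>v\<close>, obtained from translation invariance alone: the indicator
  selects a window of length 1 on each line.\<close>

lemma nn_integral_lborel_along:
  fixes h :: "'a::euclidean_space \<Rightarrow> ennreal"
  assumes [measurable]: "h \<in> borel_measurable borel" and v: "v \<noteq> 0"
  shows "(\<integral>\<^sup>+x. h x \<partial>lborel) = (\<integral>\<^sup>+x. indicator {0..1} (x \<bullet> v / (v \<bullet> v)) * (\<integral>\<^sup>+t. h (x + t *\<^sub>R v) \<partial>lborel) \<partial>lborel)"
proof -
  have [measurable]: "{0..1} \<in> sets (borel :: real measure)" by simp
  have vv: "v \<bullet> v > 0" using v by simp
  have one: "(\<integral>\<^sup>+t. indicator {0..1} (c - t) \<partial>lborel) = 1" for c :: real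
  proof -
    have "(\<integral>\<^sup>+t. indicator {0..1} (c - t) \<partial>lborel) = (\<integral>\<^sup>+t. indicator {c - 1..c} t \<partial>lborel)"
      by (intro nn_integral_cong) (auto simp: indicator_def)
    also have "\<dots> = 1" by (subst nn_integral_indicator) auto
    finally show ?thesis .
  qed
  have "(\<integral>\<^sup>+x. h x \<partial>lborel) = (\<integral>\<^sup>+x. (\<integral>\<^sup>+t. h x * indicator {0..1} (x \<bullet> v / (v \<bullet> v) - t) \<partial>lborel) \<partial>lborel)"
    by (subst nn_integral_cmult) (simp_all add: one)
  also have "\<dots> = (\<integral>\<^sup>+t. (\<integral>\<^sup>+x. h x * indicator {0..1} (x \<bullet> v / (v \<bullet> v) - t) \<partial>lborel) \<partial>lborel)"
    by (rule lborel_pair.Fubini'[symmetric]) measurable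
  also have "\<dots> = (\<integral>\<^sup>+t. (\<integral>\<^sup>+x. h (x + t *\<^sub>R v) * indicator {0..1} (x \<bullet> v / (v \<bullet> v)) \<partial>lborel) \<partial>lborel)"
  proof (rule nn_integral_cong)
    fix t :: real
    have "(x + t *\<^sub>R v) \<bullet> v / (v \<bullet> v) - t = x \<bullet> v / (v \<bullet> v)" for x
      using vv by (simp add: inner_add_left field_simps)
    then show "(\<integral>\<^sup>+x. h x * indicator {0..1} (x \<bullet> v / (v \<bullet> v) - t) \<partial>lborel)
       = (\<integral>\<^sup>+x. h (x + t *\<^sub>R v) * indicator {0..1} (x \<bullet> v / (v \<bullet> v)) \<partial>lborel)"
      by (subst nn_integral_lborel_translate[where v = "t *\<^sub>R v"]) simp_all
  qed
  also have "\<dots> = (\<integral>\<^sup>+x. (\<integral>\<^sup>+t. h (x + t *\<^sub>R v) * indicator {0..1} (x \<bullet> v / (v \<bullet> v)) \<partial>lborel) \<partial>lborel)"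
    by (rule lborel_pair.Fubini') measurable
  also have "\<dots> = (\<integral>\<^sup>+x. indicator {0..1} (x \<bullet> v / (v \<bullet> v)) * (\<integral>\<^sup>+t. h (x + t *\<^sub>R v) \<partial>lborel) \<partial>lborel)"
    by (subst nn_integral_multc) (simp_all add: mult.commute)
  finally show ?thesis .
qed

text \<open>Identify \<open>x\<close> with the null vector \<open>(norm x, x)\<close> of Minkowski space. For \<open>v \<bullet> v = 1 + b\<^sup>2\<close> the map
  \<open>lorentz_refl b v\<close> is the reflection in the spacelike unit vector \<open>(b, v)\<close>, and \<open>conf_refl b v\<close> is the
  inversion it induces on the sphere, which exchanges the cap \<open>{x. b < x \<bullet> v}\<close> with its complement and
  stretches lengths by \<open>1 / conf_factor b v x\<close>.\<close>

definition lorentz_refl :: "real \<Rightarrow> 'a::euclidean_space \<Rightarrow> 'a \<Rightarrow> 'a" where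
  "lorentz_refl b v x = x - (2 * (x \<bullet> v - b * norm x)) *\<^sub>R v"

definition conf_factor :: "real \<Rightarrow> 'a::euclidean_space \<Rightarrow> 'a \<Rightarrow> real" where
  "conf_factor b v x = 1 + 2 * b\<^sup>2 - 2 * b * (v \<bullet> x)"

definition conf_refl :: "real \<Rightarrow> 'a::euclidean_space \<Rightarrow> 'a \<Rightarrow> 'a" where
  "conf_refl b v x = (x - (2 * (x \<bullet> v - b)) *\<^sub>R v) /\<^sub>R conf_factor b v x"

text \<open>The quantity is the square of \<open>sqrt (1 + b^2) - |b|\<close> and the minimum of
  \<open>conf_factor b v\<close> over the sphere when \<open>v \<bullet> v = 1 + b^2\<close>. Its
  positivity keeps the conformal factor positive and gives the line map in
  \<open>nn_integral_lorentz_refl\<close> a positive slope at both ends.\<close>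

lemma lorentz_gap_pos: "0 < 1 + 2 * b\<^sup>2 - 2 * \<bar>b\<bar> * sqrt (1 + b\<^sup>2)"
proof -
  have lt: "\<bar>b\<bar> < sqrt (1 + b\<^sup>2)" by (rule real_less_rsqrt) simp
  have "0 < (sqrt (1 + b\<^sup>2) - \<bar>b\<bar>)\<^sup>2" using lt by simp
  also have "\<dots> = 1 + 2 * b\<^sup>2 - 2 * \<bar>b\<bar> * sqrt (1 + b\<^sup>2)"
    by (simp add: power2_diff algebra_simps)
  finally show ?thesis .
qed

lemma lorentz_norm:
  fixes v :: "'a::euclidean_space"
  assumes "v \<bullet> v = 1 + b\<^sup>2"
  shows "norm v = sqrt (1 + b\<^sup>2)"
  using assms by (simp add: norm_eq_sqrt_inner)

lemma lorentz_cross_le: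
  fixes v x :: "'a::euclidean_space"
  assumes "v \<bullet> v = 1 + b\<^sup>2"
  shows "\<bar>b * (v \<bullet> x)\<bar> \<le> \<bar>b\<bar> * sqrt (1 + b\<^sup>2) * norm x"
  using mult_left_mono[OF Cauchy_Schwarz_ineq2[of v x], of "\<bar>b\<bar>"] lorentz_norm[OF assms]
  by (simp add: abs_mult mult_ac)

lemma conf_factor_pos:
  fixes v x :: "'a::euclidean_space"
  assumes "v \<bullet> v = 1 + b\<^sup>2" "norm x = 1"
  shows "0 < conf_factor b v x"
  using lorentz_cross_le[OF assms(1), of x] lorentz_gap_pos[of b] assms(2)
  unfolding conf_factor_def by (auto simp: abs_le_iff)

text \<open>A Lorentz reflection preserves the light cone, so the norm of the spatial part of the
  image equals its time component up to sign. The right side is that time component, and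
  \<open>lorentz_gap_pos\<close> settles the sign.\<close>

lemma norm_lorentz_refl:
  fixes v x :: "'a::euclidean_space"
  assumes "v \<bullet> v = 1 + b\<^sup>2"
  shows "norm (lorentz_refl b v x) = (1 + 2 * b\<^sup>2) * norm x - 2 * b * (v \<bullet> x)"
proof -
  define k where "k = x \<bullet> v - b * norm x"
  have "2 * (b * (v \<bullet> x)) \<le> 2 * \<bar>b\<bar> * sqrt (1 + b\<^sup>2) * norm x"
    using lorentz_cross_le[OF assms, of x] by (simp add: abs_le_iff)
  moreover have "0 \<le> (1 + 2 * b\<^sup>2 - 2 * \<bar>b\<bar> * sqrt (1 + b\<^sup>2)) * norm x"
    using lorentz_gap_pos[of b] by (intro mult_nonneg_nonneg) auto
  ultimately have nn: "0 \<le> (1 + 2 * b\<^sup>2) * norm x - 2 * b * (v \<bullet> x)"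
    by (simp add: algebra_simps)
  have "(norm (lorentz_refl b v x))\<^sup>2 = x \<bullet> x - 4 * k * (x \<bullet> v) + 4 * k\<^sup>2 * (v \<bullet> v)"
    unfolding power2_norm_eq_inner lorentz_refl_def k_def[symmetric]
    by (simp add: inner_diff_left inner_diff_right inner_commute power2_eq_square algebra_simps)
  also have "\<dots> = (norm x)\<^sup>2 - 4 * k * (x \<bullet> v - k) + 4 * b\<^sup>2 * k\<^sup>2"
    unfolding assms by (simp add: dot_square_norm algebra_simps power2_eq_square)
  also have "\<dots> = (norm x - 2 * b * k)\<^sup>2"
    by (simp add: k_def power2_eq_square algebra_simps)
  also have "norm x - 2 * b * k = (1 + 2 * b\<^sup>2) * norm x - 2 * b * (v \<bullet> x)"
    by (simp add: k_def inner_commute power2_eq_square algebra_simps)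
  finally show ?thesis using nn by (simp add: power2_eq_iff_nonneg)
qed

lemma lorentz_refl_scaleR:
  fixes v z :: "'a::euclidean_space"
  assumes "v \<bullet> v = 1 + b\<^sup>2" "norm z = 1" "0 < r"
  shows "lorentz_refl b v (r *\<^sub>R z) = (r * conf_factor b v z) *\<^sub>R conf_refl b v z"
  using conf_factor_pos[OF assms(1,2)] assms
  unfolding lorentz_refl_def conf_refl_def
  by (simp add: scaleR_diff_right mult_ac right_diff_distrib)

lemma norm_conf_refl:
  fixes v z :: "'a::euclidean_space"
  assumes "v \<bullet> v = 1 + b\<^sup>2" "norm z = 1"
  shows "norm (conf_refl b v z) = 1"
proof -
  have "conf_factor b v z * norm (conf_refl b v z) = norm (lorentz_refl b v (1 *\<^sub>R z))"
    using lorentz_refl_scaleR[OF assms, of 1] conf_factor_pos[OF assms] by simp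
  also have "\<dots> = conf_factor b v z"
    by (simp only: norm_lorentz_refl[OF assms(1)] conf_factor_def) (simp add: assms)
  finally show ?thesis using conf_factor_pos[OF assms] by simp
qed

text \<open>\<open>lorentz_refl\<close> moves points only along \<open>v\<close>, so its Jacobian is that of a one-dimensional substitution.\<close>

lemma nn_integral_lorentz_refl:
  fixes v :: "'a::euclidean_space" and f :: "'a \<Rightarrow> real"
  assumes vv: "v \<bullet> v = 1 + b\<^sup>2" and f [measurable]: "f \<in> borel_measurable borel"
    and dim: "2 \<le> DIM('a)"
  shows "(\<integral>\<^sup>+x. ennreal (f (lorentz_refl b v x) * conf_factor b v (x /\<^sub>R norm x)) \<partial>lborel)
       = (\<integral>\<^sup>+x. ennreal (f x) \<partial>lborel)"
proof -
  have v0: "v \<noteq> 0" using vv by (metis add_pos_nonneg inner_zero_left less_irrefl zero_le_power2 zero_less_one)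
  have [measurable]: "lorentz_refl b v \<in> borel_measurable borel"
    unfolding lorentz_refl_def by measurable
  have [measurable]: "(\<lambda>x. conf_factor b v (x /\<^sub>R norm x)) \<in> borel_measurable borel"
    unfolding conf_factor_def by measurable
  have [measurable]: "{0..1} \<in> sets (borel :: real measure)" by simp
  \<comment> \<open>Lines in direction \<open>v\<close> through the origin are discarded, because
    the norm is not differentiable there. In dimension at least 2 they form a null set.\<close>
  have null: "AE x in lborel. x \<notin> span {v}"
  proof (rule AE_not_in)
    have "dim (span {v}) < DIM('a)" using v0 dim by simp
    then show "span {v} \<in> null_sets lborel"
      by (metis negligible_lowdim negligible_iff_null_sets null_sets_completion_iff
          sets_lborel borel_closed closed_span)
  qed
  have line: "(\<integral>\<^sup>+t. ennreal (f (lorentz_refl b v (x + t *\<^sub>R v)) * conf_factor b v ((x + t *\<^sub>R v) /\<^sub>R norm (x + t *\<^sub>R v))) \<partial>lborel)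
      = (\<integral>\<^sup>+t. ennreal (f (x + t *\<^sub>R v)) \<partial>lborel)" if x: "x \<notin> span {v}" for x
  proof -
    \<comment> \<open>Along the line the reflection sends parameter \<open>t\<close> to
      \<open>- g t\<close>. The sign is split off so that \<open>g\<close> is increasing, with
      derivative the conformal factor at the normalised point.\<close>
    define g where "g t = 2 * (x \<bullet> v) + (1 + 2 * b\<^sup>2) * t - 2 * b * norm (x + t *\<^sub>R v)" for t
    define g' where "g' t = conf_factor b v ((x + t *\<^sub>R v) /\<^sub>R norm (x + t *\<^sub>R v))" for t
    define c where "c = 1 + 2 * b\<^sup>2 - 2 * \<bar>b\<bar> * sqrt (1 + b\<^sup>2)"
    have c: "c > 0" unfolding c_def by (rule lorentz_gap_pos)
    have nz: "x + t *\<^sub>R v \<noteq> 0" for t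
    proof
      assume "x + t *\<^sub>R v = 0"
      then have "x = (- t) *\<^sub>R v" by (simp add: add_eq_0_iff)
      then show False using x by (metis span_base span_scale insertI1)
    qed
    have refl: "lorentz_refl b v (x + t *\<^sub>R v) = x + (- g t) *\<^sub>R v" for t
    proof -
      have "lorentz_refl b v (x + t *\<^sub>R v) = x + (t - 2 * ((x + t *\<^sub>R v) \<bullet> v - b * norm (x + t *\<^sub>R v))) *\<^sub>R v"
        unfolding lorentz_refl_def by (simp only: scaleR_diff_left) simp
      also have "t - 2 * ((x + t *\<^sub>R v) \<bullet> v - b * norm (x + t *\<^sub>R v)) = - g t"
        by (simp add: g_def inner_add_left vv algebra_simps)
      finally show ?thesis .
    qed
    have dg: "(g has_real_derivative g' t) (at t)" for t
    proof -
      have "((\<lambda>t. x + t *\<^sub>R v) has_derivative (\<lambda>s. s *\<^sub>R v)) (at t)"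
        by (auto intro!: derivative_eq_intros)
      from has_derivative_compose[OF this has_derivative_norm[OF nz]]
      have "((\<lambda>t. norm (x + t *\<^sub>R v)) has_derivative (\<lambda>s. (s *\<^sub>R v) \<bullet> sgn (x + t *\<^sub>R v))) (at t)" .
      then have "((\<lambda>t. norm (x + t *\<^sub>R v)) has_real_derivative (v \<bullet> sgn (x + t *\<^sub>R v))) (at t)"
        unfolding has_field_derivative_def by (rule has_derivative_eq_rhs) (simp add: fun_eq_iff mult.commute)
      then have "(g has_real_derivative (1 + 2 * b\<^sup>2) * 1 - 2 * b * (v \<bullet> sgn (x + t *\<^sub>R v))) (at t)"
        unfolding g_def by (auto intro!: derivative_eq_intros)
      then show ?thesis unfolding g'_def conf_factor_def sgn_div_norm by simp
    qed
    have cont: "continuous_on UNIV g'"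
      unfolding g'_def conf_factor_def using nz by (intro continuous_intros) auto
    have pos: "g' t \<ge> 0" for t
      unfolding g'_def using nz by (intro less_imp_le conf_factor_pos[OF vv]) simp
    have nb: "norm (x + t *\<^sub>R v) \<le> norm x + \<bar>t\<bar> * sqrt (1 + b\<^sup>2)" for t
      using norm_triangle_ineq[of x "t *\<^sub>R v"] lorentz_norm[OF vv] by simp
    have bn: "\<bar>b * norm (x + t *\<^sub>R v)\<bar> \<le> \<bar>b\<bar> * norm x + \<bar>b\<bar> * \<bar>t\<bar> * sqrt (1 + b\<^sup>2)" for t
      using mult_left_mono[OF nb, of "\<bar>b\<bar>" t] by (simp add: abs_mult algebra_simps)
    define d where "d = 2 * (x \<bullet> v)"
    define e where "e = 2 * \<bar>b\<bar> * norm x"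
    \<comment> \<open>By \<open>bn\<close> the norm term takes at most
      \<open>2 * |b| * sqrt (1 + b^2)\<close> off the slope \<open>1 + 2 * b^2\<close>; what remains
      is \<open>c > 0\<close>.\<close>
    have top: "filterlim g at_top at_top"
    proof (rule filterlim_at_top_mono)
      show "filterlim (\<lambda>t. (d - e) + c * t) at_top at_top"
        using c by (intro filterlim_tendsto_add_at_top[OF tendsto_const]
            filterlim_tendsto_pos_mult_at_top[OF tendsto_const] filterlim_ident) auto
      show "\<forall>\<^sub>F t in at_top. d - e + c * t \<le> g t"
        using eventually_ge_at_top[of 0]
      proof eventually_elim
        case (elim t)
        then show ?case using bn[of t] unfolding g_def c_def d_def e_def
          by (simp add: abs_le_iff algebra_simps)
      qed
    qed
    have bot: "filterlim g at_bot at_bot"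
    proof (rule filterlim_at_bot_mono)
      show "filterlim (\<lambda>t. (d + e) + c * t) at_bot at_bot"
        unfolding filterlim_at_bot eventually_at_bot_linorder
      proof
        fix Z
        show "\<exists>N. \<forall>t\<le>N. d + e + c * t \<le> Z"
          using c by (intro exI[of _ "(Z - (d + e)) / c"]) (auto simp: field_simps)
      qed
      show "\<forall>\<^sub>F t in at_bot. g t \<le> d + e + c * t"
        using eventually_le_at_bot[of 0]
      proof eventually_elim
        case (elim t)
        then show ?case using bn[of t] unfolding g_def c_def d_def e_def
          by (simp add: abs_le_iff algebra_simps)
      qed
    qed
    have "(\<integral>\<^sup>+t. ennreal (f (x + t *\<^sub>R v)) \<partial>lborel) = (\<integral>\<^sup>+t. ennreal (f (x + (- t) *\<^sub>R v)) \<partial>lborel)"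
      by (subst nn_integral_real_affine[where c = "-1" and t = 0]) simp_all
    also have "\<dots> = (\<integral>\<^sup>+t. ennreal (f (x + (- g t) *\<^sub>R v) * g' t) \<partial>lborel)"
      by (rule nn_integral_substitution_UNIV[OF _ dg cont pos top bot]) measurable
    finally show ?thesis by (simp only: refl g'_def)
  qed
  have "(\<integral>\<^sup>+x. ennreal (f (lorentz_refl b v x) * conf_factor b v (x /\<^sub>R norm x)) \<partial>lborel)
      = (\<integral>\<^sup>+x. indicator {0..1} (x \<bullet> v / (v \<bullet> v)) * (\<integral>\<^sup>+t. ennreal (f (lorentz_refl b v (x + t *\<^sub>R v))
          * conf_factor b v ((x + t *\<^sub>R v) /\<^sub>R norm (x + t *\<^sub>R v))) \<partial>lborel) \<partial>lborel)"
    by (rule nn_integral_lborel_along[OF _ v0]) measurable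
  also have "\<dots> = (\<integral>\<^sup>+x. indicator {0..1} (x \<bullet> v / (v \<bullet> v)) * (\<integral>\<^sup>+t. ennreal (f (x + t *\<^sub>R v)) \<partial>lborel) \<partial>lborel)"
  proof (rule nn_integral_cong_AE)
    show "AE x in lborel. indicator {0..1} (x \<bullet> v / (v \<bullet> v)) * (\<integral>\<^sup>+t. ennreal (f (lorentz_refl b v (x + t *\<^sub>R v))
          * conf_factor b v ((x + t *\<^sub>R v) /\<^sub>R norm (x + t *\<^sub>R v))) \<partial>lborel)
        = indicator {0..1} (x \<bullet> v / (v \<bullet> v)) * (\<integral>\<^sup>+t. ennreal (f (x + t *\<^sub>R v)) \<partial>lborel)"
      using null by eventually_elim (intro arg_cong2[where f = "(*)"] refl line)
  qed
  also have "\<dots> = (\<integral>\<^sup>+x. ennreal (f x) \<partial>lborel)"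
    by (rule nn_integral_lborel_along[OF _ v0, symmetric]) measurable
  finally show ?thesis .
qed

section \<open>Change of variables under the conformal reflection\<close>

lemma continuous_on_conf_factor: "continuous_on S (conf_factor b v)"
  unfolding conf_factor_def by (intro continuous_intros)

lemma continuous_on_conf_refl:
  fixes v :: "'a::euclidean_space"
  assumes "v \<bullet> v = 1 + b\<^sup>2"
  shows "continuous_on (sphere 0 1) (conf_refl b v)"
  unfolding conf_refl_def
  using conf_factor_pos[OF assms]
  by (intro continuous_intros continuous_on_conf_factor) (auto simp: less_le)

lemma conf_refl_measurable:
  fixes v :: "'a::euclidean_space"
  assumes "v \<bullet> v = 1 + b\<^sup>2"
  shows "conf_refl b v \<in> sphere_measure \<rightarrow>\<^sub>M sphere_measure"
proof -
  have "conf_refl b v \<in> sphere_measure \<rightarrow>\<^sub>M restrict_space borel (sphere 0 1)"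
    using borel_measurable_sphereI[OF continuous_on_conf_refl[OF assms]] norm_conf_refl[OF assms]
    by (intro measurable_restrict_space2) auto
  then show ?thesis by (simp cong: measurable_cong_sets)
qed

text \<open>Extend \<open>g\<close> to the unit ball, constant along rays, and compare both sides of
  \<open>nn_integral_lorentz_refl\<close> in polar coordinates. The ray through \<open>z\<close> is
  sent to the ray through \<open>conf_refl b v z\<close> and stretched by
  \<open>A = conf_factor b v z\<close>, so the radial integral contributes \<open>A\<close> to the
  power \<open>-DIM('a)\<close>; the Jacobian of the ambient map gives one factor \<open>A\<close>
  back.\<close>

lemma nn_integral_conf_refl:
  fixes v :: "'a::euclidean_space" and g :: "'a \<Rightarrow> real"
  assumes vv: "v \<bullet> v = 1 + b\<^sup>2" and g: "g \<in> borel_measurable sphere_measure"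
    and gn: "\<And>x. x \<in> sphere 0 1 \<Longrightarrow> 0 \<le> g x" and dim: "2 \<le> DIM('a)"
  shows "(\<integral>\<^sup>+x. ennreal (g (conf_refl b v x) / conf_factor b v x ^ (DIM('a) - 1)) \<partial>sphere_measure)
       = (\<integral>\<^sup>+x. ennreal (g x) \<partial>sphere_measure)"
proof -
  define N where "N = DIM('a)"
  have N: "2 \<le> N" using dim by (simp add: N_def)
  define f where "f x = (if x \<in> ball 0 1 - {0} then g (x /\<^sub>R norm x) else 0)" for x
  have f [measurable]: "f \<in> borel_measurable borel"
  proof -
    have g': "g \<in> borel_measurable (restrict_space borel (sphere 0 1))"
      using g by (simp cong: measurable_cong_sets)
    have "(\<lambda>x. g (x /\<^sub>R norm x)) \<in> borel_measurable (restrict_space lborel (ball 0 1 - {0}))"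
      using measurable_compose[OF measurable_normalize g'] .
    then have "(\<lambda>x. indicator (ball 0 1 - {0}) x *\<^sub>R g (x /\<^sub>R norm x)) \<in> borel_measurable lborel"
      by (subst (asm) borel_measurable_restrict_space_iff) auto
    also have "(\<lambda>x. indicator (ball 0 1 - {0}) x *\<^sub>R g (x /\<^sub>R norm x)) = f"
      by (auto simp: f_def indicator_def)
    finally show ?thesis by simp
  qed
  have [measurable]: "lorentz_refl b v \<in> borel_measurable borel"
    unfolding lorentz_refl_def by measurable
  have [measurable]: "(\<lambda>x. conf_factor b v (x /\<^sub>R norm x)) \<in> borel_measurable borel"
    unfolding conf_factor_def by measurable
  have [measurable]: "{0<..<1} \<in> sets (borel :: real measure)" "{0<..} \<in> sets (borel :: real measure)"
    by simp_all
  define c where "c = (\<integral>\<^sup>+r. ennreal (r ^ (N - 1)) * indicator {0<..<1} r \<partial>lborel)"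
  have c: "c = ennreal (1 / real N)"
  proof -
    have "c = (\<integral>\<^sup>+r. ennreal (r ^ (N - 1)) * indicator {0..1} r \<partial>lborel)"
      unfolding c_def
      by (rule nn_integral_cong_AE)
         (use AE_lborel_singleton[of "0::real"] AE_lborel_singleton[of "1::real"] in eventually_elim, auto simp: indicator_def)
    also have "\<dots> = ennreal (1 ^ N / real N - 0 ^ N / real N)"
      using N by (intro nn_integral_FTC_Icc[where F = "\<lambda>r. r ^ N / real N"])
        (auto intro!: derivative_eq_intros)
    finally show ?thesis using N by (simp add: power_0_left)
  qed
  have inner: "(\<integral>\<^sup>+r. ennreal (f (lorentz_refl b v (r *\<^sub>R z)) * conf_factor b v ((r *\<^sub>R z) /\<^sub>R norm (r *\<^sub>R z)))
         * ennreal (r ^ (N - 1)) * indicator {0<..} r \<partial>lborel)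
       = ennreal (g (conf_refl b v z) / conf_factor b v z ^ (N - 1)) * c"
    if z: "z \<in> sphere 0 1" for z
  proof -
    have z1: "norm z = 1" using z by simp
    define A where "A = conf_factor b v z"
    define G where "G = g (conf_refl b v z)"
    have A: "A > 0" unfolding A_def by (rule conf_factor_pos[OF vv z1])
    have sz: "norm (conf_refl b v z) = 1" by (rule norm_conf_refl[OF vv z1])
    have G: "G \<ge> 0" unfolding G_def using sz by (intro gn) simp
    have pt: "ennreal (f (lorentz_refl b v (r *\<^sub>R z)) * conf_factor b v ((r *\<^sub>R z) /\<^sub>R norm (r *\<^sub>R z)))
         * ennreal (r ^ (N - 1)) * indicator {0<..} r
       = ennreal (G * A / A ^ (N - 1)) * (ennreal ((A * r) ^ (N - 1)) * indicator {0<..<1} (A * r))" for r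
    proof (cases "r > 0")
      case True
      have "f (lorentz_refl b v (r *\<^sub>R z)) = (if A * r < 1 then G else 0)"
        using True A sz unfolding lorentz_refl_scaleR[OF vv z1 True] f_def G_def A_def
        by (auto simp: mult_ac)
      moreover have "(r *\<^sub>R z) /\<^sub>R norm (r *\<^sub>R z) = z" using True z1 by simp
      moreover have "G * A * r ^ (N - 1) = G * A / A ^ (N - 1) * (A * r) ^ (N - 1)"
        using A by (simp add: power_mult_distrib)
      ultimately show ?thesis using True A G
        by (auto simp: indicator_def A_def[symmetric] simp flip: ennreal_mult)
    next
      case False
      then show ?thesis using A by (auto simp: indicator_def zero_less_mult_iff)
    qed
    define I where "I = (\<integral>\<^sup>+r. ennreal ((A * r) ^ (N - 1)) * indicator {0<..<1} (A * r) \<partial>lborel)"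
    have Ic: "ennreal A * I = c"
      unfolding c_def I_def using A
      by (subst (2) nn_integral_real_affine[where c = A and t = 0]) simp_all
    have "ennreal (G * A / A ^ (N - 1)) = ennreal (G / A ^ (N - 1)) * ennreal A"
      using A G by (simp flip: ennreal_mult)
    then have "ennreal (G * A / A ^ (N - 1)) * I = ennreal (G / A ^ (N - 1)) * c"
      by (simp only: mult.assoc Ic)
    then show ?thesis
      unfolding pt I_def by (subst nn_integral_cmult) (simp_all add: A_def G_def)
  qed
  have inner2: "(\<integral>\<^sup>+r. ennreal (f (r *\<^sub>R z)) * ennreal (r ^ (N - 1)) * indicator {0<..} r \<partial>lborel)
       = ennreal (g z) * c" if z: "z \<in> sphere 0 1" for z
  proof -
    have "ennreal (f (r *\<^sub>R z)) * ennreal (r ^ (N - 1)) * indicator {0<..} r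
        = ennreal (g z) * (ennreal (r ^ (N - 1)) * indicator {0<..<1} r)" for r
      using z by (auto simp: f_def indicator_def)
    then show ?thesis unfolding c_def by (simp add: nn_integral_cmult)
  qed
  have cg: "(\<lambda>x. ennreal (g x)) \<in> borel_measurable sphere_measure" using g by measurable
  have "(\<lambda>x. g (conf_refl b v x)) \<in> borel_measurable sphere_measure"
    by (rule measurable_compose[OF conf_refl_measurable[OF vv] g])
  moreover have "conf_factor b v \<in> borel_measurable sphere_measure"
    by (rule borel_measurable_sphereI[OF continuous_on_conf_factor])
  ultimately have cg': "(\<lambda>x. ennreal (g (conf_refl b v x) / conf_factor b v x ^ (N - 1))) \<in> borel_measurable sphere_measure"
    by measurable
  have "of_nat N * ((\<integral>\<^sup>+z. ennreal (g (conf_refl b v z) / conf_factor b v z ^ (N - 1)) \<partial>sphere_measure) * c)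
      = (\<integral>\<^sup>+x. ennreal (f (lorentz_refl b v x) * conf_factor b v (x /\<^sub>R norm x)) \<partial>lborel)"
    by (subst nn_integral_polar, measurable)
       (auto simp only: N_def[symmetric] nn_integral_multc[OF cg', symmetric] space_sphere_measure
          intro!: arg_cong2[where f = "(*)"] nn_integral_cong inner[symmetric])
  also have "\<dots> = (\<integral>\<^sup>+x. ennreal (f x) \<partial>lborel)"
    by (rule nn_integral_lorentz_refl[OF vv f dim])
  also have "\<dots> = of_nat N * ((\<integral>\<^sup>+z. ennreal (g z) \<partial>sphere_measure) * c)"
    by (subst nn_integral_polar, measurable)
       (auto simp only: N_def[symmetric] nn_integral_multc[OF cg, symmetric] space_sphere_measure
          intro!: arg_cong2[where f = "(*)"] nn_integral_cong inner2)
  finally have *: "of_nat N * c * (\<integral>\<^sup>+z. ennreal (g (conf_refl b v z) / conf_factor b v z ^ (N - 1)) \<partial>sphere_measure)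
     = of_nat N * c * (\<integral>\<^sup>+z. ennreal (g z) \<partial>sphere_measure)"
    by (simp add: mult_ac)
  have "of_nat N * c = 1"
    using N by (simp add: c ennreal_of_nat_eq_real_of_nat flip: ennreal_mult)
  with * show ?thesis by (simp add: N_def)
qed

text \<open>For unit vectors the squared distance is -2 times the Minkowski product of the null
  vectors \<open>(1, x)\<close> and \<open>(1, y)\<close>. Reflecting the second one subtracts twice
  the product of the two heights over the mirror, and the reflected null vector is
  \<open>conf_factor b v y\<close> times \<open>(1, conf_refl b v y)\<close>. The added term is
  positive for two points on the same side, which later makes \<open>refl_kernel\<close>
  positive.\<close>

lemma conf_refl_inner:
  fixes v x y :: "'a::euclidean_space"
  assumes vv: "v \<bullet> v = 1 + b\<^sup>2" and x: "norm x = 1" and y: "norm y = 1"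
  shows "conf_factor b v y * (norm (x - conf_refl b v y))\<^sup>2
       = (norm (x - y))\<^sup>2 + 4 * (x \<bullet> v - b) * (y \<bullet> v - b)"
proof -
  define A where "A = conf_factor b v y"
  have A: "A > 0" unfolding A_def by (rule conf_factor_pos[OF vv y])
  have s: "norm (conf_refl b v y) = 1" by (rule norm_conf_refl[OF vv y])
  have d: "(norm (p - q))\<^sup>2 = 2 - 2 * (p \<bullet> q)" if "norm p = 1" "norm q = 1" for p q :: 'a
    using that by (simp add: power2_norm_eq_inner inner_diff_left inner_diff_right inner_commute norm_eq_1)
  have "A * (x \<bullet> conf_refl b v y) = x \<bullet> y - 2 * (y \<bullet> v - b) * (x \<bullet> v)"
    using A unfolding conf_refl_def A_def[symmetric] by (simp add: inner_diff_right)
  then show ?thesis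
    unfolding d[OF x s] d[OF x y] A_def[symmetric]
    by (simp add: right_diff_distrib A_def conf_factor_def inner_commute power2_eq_square algebra_simps)
qed

lemma conf_refl_height:
  fixes v x :: "'a::euclidean_space"
  assumes vv: "v \<bullet> v = 1 + b\<^sup>2" and x: "norm x = 1"
  shows "conf_factor b v x * (conf_refl b v x \<bullet> v - b) = - (x \<bullet> v - b)"
proof -
  define A where "A = conf_factor b v x"
  have A: "A > 0" unfolding A_def by (rule conf_factor_pos[OF vv x])
  have "A * (conf_refl b v x \<bullet> v) = x \<bullet> v - 2 * (x \<bullet> v - b) * (v \<bullet> v)"
    using A unfolding conf_refl_def A_def[symmetric] by (simp add: inner_diff_left)
  then show ?thesis unfolding vv A_def
    by (simp add: right_diff_distrib conf_factor_def inner_commute power2_eq_square algebra_simps)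
qed

lemma conf_factor_refl:
  fixes v x :: "'a::euclidean_space"
  assumes vv: "v \<bullet> v = 1 + b\<^sup>2" and x: "norm x = 1"
  shows "conf_factor b v (conf_refl b v x) = 1 / conf_factor b v x"
proof -
  define A where "A = conf_factor b v x"
  have A: "A > 0" unfolding A_def by (rule conf_factor_pos[OF vv x])
  have "A * (v \<bullet> conf_refl b v x) = A * b - (x \<bullet> v - b)"
    using conf_refl_height[OF vv x] by (simp add: A_def inner_commute algebra_simps)
  moreover have "A * conf_factor b v (conf_refl b v x) = A + 2 * b\<^sup>2 * A - 2 * b * (A * (v \<bullet> conf_refl b v x))"
    unfolding conf_factor_def[of _ _ "conf_refl _ _ _"] by (simp add: algebra_simps)
  ultimately have "A * conf_factor b v (conf_refl b v x) = A + 2 * b\<^sup>2 * A - 2 * b * (A * b - (x \<bullet> v - b))"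
    by simp
  also have "\<dots> = 1" by (simp add: A_def conf_factor_def inner_commute power2_eq_square algebra_simps)
  finally show ?thesis using A by (simp add: A_def field_simps)
qed

text \<open>The distance from \<open>x\<close> to its double image is evaluated with
  \<open>conf_refl_inner\<close>, once for the image and once for \<open>x\<close> itself, and the
  terms cancel.\<close>

lemma conf_refl_conf_refl:
  fixes v x :: "'a::euclidean_space"
  assumes vv: "v \<bullet> v = 1 + b\<^sup>2" and x: "norm x = 1"
  shows "conf_refl b v (conf_refl b v x) = x"
proof -
  have s: "norm (conf_refl b v x) = 1" by (rule norm_conf_refl[OF vv x])
  have A: "conf_factor b v x > 0" by (rule conf_factor_pos[OF vv x])
  have "conf_factor b v (conf_refl b v x) * (norm (x - conf_refl b v (conf_refl b v x)))\<^sup>2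
     = (norm (x - conf_refl b v x))\<^sup>2 + 4 * (x \<bullet> v - b) * (conf_refl b v x \<bullet> v - b)"
    by (rule conf_refl_inner[OF vv x s])
  then have "(norm (x - conf_refl b v (conf_refl b v x)))\<^sup>2
     = conf_factor b v x * (norm (x - conf_refl b v x))\<^sup>2 + 4 * (x \<bullet> v - b) * (conf_factor b v x * (conf_refl b v x \<bullet> v - b))"
    using A by (simp add: conf_factor_refl[OF vv x] field_simps)
  also have "\<dots> = 0" 
    unfolding conf_refl_inner[OF vv x x] conf_refl_height[OF vv x] by (simp add: algebra_simps)
  finally show ?thesis by simp
qed

lemma dist_conf_refl:
  fixes v x y :: "'a::euclidean_space"
  assumes vv: "v \<bullet> v = 1 + b\<^sup>2" and x: "norm x = 1" and y: "norm y = 1"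
  shows "conf_factor b v x * conf_factor b v y * (norm (conf_refl b v x - conf_refl b v y))\<^sup>2 = (norm (x - y))\<^sup>2"
proof -
  have s: "norm (conf_refl b v x) = 1" by (rule norm_conf_refl[OF vv x])
  have "conf_factor b v x * conf_factor b v y * (norm (conf_refl b v x - conf_refl b v y))\<^sup>2
     = conf_factor b v x * (norm (y - conf_refl b v x))\<^sup>2
       + 4 * (conf_factor b v x * (conf_refl b v x \<bullet> v - b)) * (y \<bullet> v - b)"
    by (simp only: mult.assoc conf_refl_inner[OF vv s y]) (simp add: norm_minus_commute algebra_simps)
  also have "\<dots> = (norm (x - y))\<^sup>2"
    unfolding conf_refl_inner[OF vv y x] conf_refl_height[OF vv x]
    by (simp add: norm_minus_commute algebra_simps)
  finally show ?thesis .
qed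

section \<open>Gegenbauer polynomials and the Poisson kernel\<close>

fun gegenbauer :: "real \<Rightarrow> nat \<Rightarrow> real poly" where
  "gegenbauer \<nu> 0 = 1"
| "gegenbauer \<nu> (Suc 0) = [:0, 2 * \<nu>:]"
| "gegenbauer \<nu> (Suc (Suc l)) = smult (1 / (real l + 2))
     (smult (2 * (real l + 1 + \<nu>)) ([:0, 1:] * gegenbauer \<nu> (Suc l)) - smult (real l + 2 * \<nu>) (gegenbauer \<nu> l))"

lemma gegenbauer_rec:
  "(real l + 2) * poly (gegenbauer \<nu> (Suc (Suc l))) t
     = 2 * (real l + 1 + \<nu>) * t * poly (gegenbauer \<nu> (Suc l)) t - (real l + 2 * \<nu>) * poly (gegenbauer \<nu> l) t"
  by (simp add: field_simps)

declare gegenbauer.simps(3) [simp del]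

lemma gegenbauer_rec_pderiv:
  "(real l + 2) * poly (pderiv (gegenbauer \<nu> (Suc (Suc l)))) t
     = 2 * (real l + 1 + \<nu>) * (poly (gegenbauer \<nu> (Suc l)) t + t * poly (pderiv (gegenbauer \<nu> (Suc l))) t)
       - (real l + 2 * \<nu>) * poly (pderiv (gegenbauer \<nu> l)) t"
proof -
  have "((\<lambda>t. (real l + 2) * poly (gegenbauer \<nu> (Suc (Suc l))) t) has_real_derivative
      (real l + 2) * poly (pderiv (gegenbauer \<nu> (Suc (Suc l)))) t) (at t)"
    by (intro DERIV_cmult poly_DERIV)
  moreover have "((\<lambda>t. (real l + 2) * poly (gegenbauer \<nu> (Suc (Suc l))) t) has_real_derivative
      2 * (real l + 1 + \<nu>) * (poly (gegenbauer \<nu> (Suc l)) t + t * poly (pderiv (gegenbauer \<nu> (Suc l))) t)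
       - (real l + 2 * \<nu>) * poly (pderiv (gegenbauer \<nu> l)) t) (at t)"
    unfolding gegenbauer_rec
    by (auto intro!: derivative_eq_intros simp: algebra_simps)
  ultimately show ?thesis by (rule DERIV_unique)
qed

text \<open>The two identities are proved jointly: the induction step for the first uses the second,
  and the step for the second uses the first.\<close>

lemma gegenbauer_pderiv_Suc:
  "poly (pderiv (gegenbauer \<nu> (Suc l))) t
     = t * poly (pderiv (gegenbauer \<nu> l)) t + (real l + 2 * \<nu>) * poly (gegenbauer \<nu> l) t \<and>
   t * poly (pderiv (gegenbauer \<nu> (Suc l))) t - poly (pderiv (gegenbauer \<nu> l)) t
     = (real l + 1) * poly (gegenbauer \<nu> (Suc l)) t"
proof (induction l)
  case 0
  show ?case by (simp add: pderiv_pCons)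
next
  case (Suc l)
  define c0 where "c0 = poly (gegenbauer \<nu> l) t"
  define c1 where "c1 = poly (gegenbauer \<nu> (Suc l)) t"
  define c2 where "c2 = poly (gegenbauer \<nu> (Suc (Suc l))) t"
  define d0 where "d0 = poly (pderiv (gegenbauer \<nu> l)) t"
  define d1 where "d1 = poly (pderiv (gegenbauer \<nu> (Suc l))) t"
  define d2 where "d2 = poly (pderiv (gegenbauer \<nu> (Suc (Suc l)))) t"
  note defs = c0_def[symmetric] c1_def[symmetric] c2_def[symmetric] d0_def[symmetric] d1_def[symmetric] d2_def[symmetric]
  define L where "L = real l"
  have IH1: "d1 = t * d0 + (L + 2 * \<nu>) * c0" and IH2: "t * d1 - d0 = (L + 1) * c1"
    using Suc.IH unfolding defs L_def by auto
  have R: "(L + 2) * c2 = 2 * (L + 1 + \<nu>) * t * c1 - (L + 2 * \<nu>) * c0"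
    using gegenbauer_rec[of l \<nu> t] unfolding defs L_def .
  have R': "(L + 2) * d2 = 2 * (L + 1 + \<nu>) * (c1 + t * d1) - (L + 2 * \<nu>) * d0"
    using gegenbauer_rec_pderiv[of l \<nu> t] unfolding defs L_def .
  have d0: "d0 = t * d1 - (L + 1) * c1" using IH2 by simp
  have "(L + 2) * d2 = (L + 2) * (t * d1 + (L + 1 + 2 * \<nu>) * c1)"
    unfolding R' d0 by (simp add: algebra_simps)
  then have A: "d2 = t * d1 + (L + 1 + 2 * \<nu>) * c1"
    by (simp add: L_def)
  have "t * d2 - d1 = t * (t * d1) - d1 + t * (L + 1 + 2 * \<nu>) * c1" unfolding A by (simp add: algebra_simps)
  also have "t * (t * d1) = t * (d0 + (L + 1) * c1)" using IH2 by simp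
  also have "t * (d0 + (L + 1) * c1) - d1 + t * (L + 1 + 2 * \<nu>) * c1 = (L + 2) * c2"
    unfolding R using IH1 by (simp add: algebra_simps)
  finally have B: "t * d2 - d1 = (L + 2) * c2" .
  show ?case using A B unfolding defs by (simp add: L_def algebra_simps)
qed

text \<open>The derivative identities give \<open>(1 - x^2) P'\<close> in terms of \<open>P\<close>
  and its predecessor \<open>Q\<close>. Differentiating this and eliminating \<open>Q'\<close> by
  the second identity leaves an equation in \<open>P\<close> alone.\<close>

lemma gegenbauer_ode:
  "(1 - t\<^sup>2) * poly (pderiv (pderiv (gegenbauer \<nu> l))) t - (2 * \<nu> + 1) * t * poly (pderiv (gegenbauer \<nu> l)) t
     + real l * (real l + 2 * \<nu>) * poly (gegenbauer \<nu> l) t = 0"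
proof (cases l)
  case 0
  then show ?thesis by simp
next
  case (Suc m)
  define P where "P = gegenbauer \<nu> (Suc m)"
  define Q where "Q = gegenbauer \<nu> m"
  have X: "poly (pderiv P) x * (1 - x\<^sup>2) = (real m + 2 * \<nu>) * poly Q x - (real m + 1) * (x * poly P x)" for x
  proof -
    have 1: "poly (pderiv P) x = x * poly (pderiv Q) x + (real m + 2 * \<nu>) * poly Q x"
      and 2: "x * poly (pderiv P) x - poly (pderiv Q) x = (real m + 1) * poly P x"
      using gegenbauer_pderiv_Suc[of \<nu> m x] unfolding P_def Q_def by auto
    have "poly (pderiv P) x * (1 - x\<^sup>2) = poly (pderiv P) x - x * (x * poly (pderiv P) x)"
      by (simp add: power2_eq_square algebra_simps)
    also have "x * poly (pderiv P) x = poly (pderiv Q) x + (real m + 1) * poly P x" using 2 by simp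
    finally show ?thesis using 1 by (simp add: algebra_simps)
  qed
  have "((\<lambda>x. poly (pderiv P) x * (1 - x\<^sup>2)) has_real_derivative
      poly (pderiv (pderiv P)) t * (1 - t\<^sup>2) + poly (pderiv P) t * (- (2 * t))) (at t)"
    by (auto intro!: derivative_eq_intros)
  moreover have "((\<lambda>x. poly (pderiv P) x * (1 - x\<^sup>2)) has_real_derivative
      (real m + 2 * \<nu>) * poly (pderiv Q) t - (real m + 1) * (poly P t + t * poly (pderiv P) t)) (at t)"
    unfolding X by (auto intro!: derivative_eq_intros)
  ultimately have E: "poly (pderiv (pderiv P)) t * (1 - t\<^sup>2) + poly (pderiv P) t * (- (2 * t))
     = (real m + 2 * \<nu>) * poly (pderiv Q) t - (real m + 1) * (poly P t + t * poly (pderiv P) t)"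
    by (rule DERIV_unique)
  have "poly (pderiv Q) t = t * poly (pderiv P) t - (real m + 1) * poly P t"
    using gegenbauer_pderiv_Suc[of \<nu> m t] unfolding P_def Q_def by auto
  with E show ?thesis unfolding Suc P_def[symmetric] by (simp add: algebra_simps)
qed

section \<open>Taylor coefficients of \<open>(1 - z) powr (- \<nu>)\<close> and the Gegenbauer
  generating function\<close>

definition binom_coeff :: "real \<Rightarrow> nat \<Rightarrow> real" where
  "binom_coeff \<nu> k = pochhammer \<nu> k / fact k"

lemma binom_coeff_0 [simp]: "binom_coeff \<nu> 0 = 1"
  by (simp add: binom_coeff_def)

lemma binom_coeff_Suc: "(real k + 1) * binom_coeff \<nu> (Suc k) = (\<nu> + real k) * binom_coeff \<nu> k"
proof -
  have "(real k + 1) * (x / ((real k + 1) * y)) = x / y" for x y by simp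
  from this[of "pochhammer \<nu> k * (\<nu> + real k)" "fact k"] show ?thesis
    by (simp add: binom_coeff_def pochhammer_Suc add.commute mult.commute)
qed

lemma binom_coeff_pos: "\<nu> > 0 \<Longrightarrow> binom_coeff \<nu> k > 0"
  by (simp add: binom_coeff_def pochhammer_pos)

lemma binom_coeff_sums:
  fixes z :: complex
  assumes "norm z < 1"
  shows "(\<lambda>k. of_real (binom_coeff \<nu> k) * z ^ k) sums (1 - z) powr (- of_real \<nu>)"
proof -
  have "(\<lambda>k. ((- of_real \<nu>) gchoose k) * (- z) ^ k) sums (1 + (- z)) powr (- of_real \<nu>)"
    by (rule gen_binomial_complex) (use assms in simp)
  moreover have "((- of_real \<nu>) gchoose k) * (- z) ^ k = of_real (binom_coeff \<nu> k) * z ^ k" for k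
  proof -
    have "((- of_real \<nu> :: complex) gchoose k) = (-1) ^ k * of_real (binom_coeff \<nu> k)"
      by (simp add: gbinomial_pochhammer binom_coeff_def pochhammer_of_real)
    moreover have "(- z) ^ k = (-1) ^ k * z ^ k" by (rule power_minus)
    ultimately show ?thesis by (simp add: mult_ac flip: power_mult_distrib)
  qed
  ultimately show ?thesis by simp
qed

lemma summable_binom_coeff:
  assumes "\<nu> > 0" "0 \<le> r" "r < 1"
  shows "summable (\<lambda>k. binom_coeff \<nu> k * r ^ k)"
proof -
  have "summable (\<lambda>k. of_real (binom_coeff \<nu> k) * (of_real r :: complex) ^ k)"
    using binom_coeff_sums[of "of_real r" \<nu>] assms by (simp add: sums_iff)
  also have "(\<lambda>k. of_real (binom_coeff \<nu> k) * (of_real r :: complex) ^ k) = (\<lambda>k. of_real (binom_coeff \<nu> k * r ^ k))"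
    by simp
  finally show ?thesis unfolding summable_of_real_iff .
qed

text \<open>This is the value of \<open>gegenbauer \<nu> l\<close> at 1. The convolution form makes
  summability an instance of the Cauchy product.\<close>

definition gegenbauer_bound :: "real \<Rightarrow> nat \<Rightarrow> real" where
  "gegenbauer_bound \<nu> l = (\<Sum>i\<le>l. binom_coeff \<nu> i * binom_coeff \<nu> (l - i))"

text \<open>Factoring \<open>1 - 2 r cos x + r\<^sup>2 = (1 - r cis x) (1 - r cis (- x))\<close> gives a cosine sum with positive
  coefficients, hence the bound by the value at 1.\<close>

lemma gegenbauer_cos:
  "complex_of_real (poly (gegenbauer \<nu> l) (cos x))
     = (\<Sum>i\<le>l. (of_real (binom_coeff \<nu> i) * cis x ^ i) * (of_real (binom_coeff \<nu> (l - i)) * cis (- x) ^ (l - i)))"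
proof -
  \<comment> \<open>\<open>A w\<close> is the formal series of the power \<open>- \<nu>\<close> of
    \<open>1 - w X\<close>. The product \<open>P\<close> of the two conjugate series satisfies a
    first-order differential equation, whose coefficients obey the Gegenbauer recurrence; being
    formal, the argument involves no convergence.\<close>
  define A where "A w = Abs_fps (\<lambda>k. complex_of_real (binom_coeff \<nu> k) * w ^ k)" for w
  have dA: "(1 - fps_const w * fps_X) * fps_deriv (A w) = fps_const (of_real \<nu> * w) * A w" for w
  proof (rule fps_ext)
    fix k
    have S: "of_nat (Suc k) * (complex_of_real (binom_coeff \<nu> (Suc k)) * w ^ Suc k)
        = w * (of_real \<nu> + of_nat k) * (of_real (binom_coeff \<nu> k) * w ^ k)" for k
    proof -
      have "of_nat (Suc k) * complex_of_real (binom_coeff \<nu> (Suc k)) = of_real ((real k + 1) * binom_coeff \<nu> (Suc k))"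
        by simp
      also have "\<dots> = (of_real \<nu> + of_nat k) * of_real (binom_coeff \<nu> k)"
        unfolding binom_coeff_Suc by simp
      finally show ?thesis by (simp add: mult_ac)
    qed
    show "fps_nth ((1 - fps_const w * fps_X) * fps_deriv (A w)) k = fps_nth (fps_const (of_real \<nu> * w) * A w) k"
    proof (cases k)
      case 0
      then show ?thesis using S[of 0] by (simp add: A_def algebra_simps)
    next
      case (Suc m)
      have "fps_nth ((1 - fps_const w * fps_X) * fps_deriv (A w)) k
          = of_nat (Suc k) * (complex_of_real (binom_coeff \<nu> (Suc k)) * w ^ Suc k)
          - w * (of_nat k * (complex_of_real (binom_coeff \<nu> k) * w ^ k))"
        by (simp add: A_def Suc left_diff_distrib mult.assoc)
      also have "\<dots> = w * of_real \<nu> * (of_real (binom_coeff \<nu> k) * w ^ k)"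
        unfolding S by (simp add: algebra_simps)
      finally show ?thesis by (simp add: A_def algebra_simps)
    qed
  qed
  define w where "w = cis x"
  define w' where "w' = cis (- x)"
  have ww: "w * w' = 1" by (simp add: w_def w'_def cis_mult)
  have w2: "w + w' = 2 * of_real (cos x)" by (simp add: w_def w'_def complex_eq_iff)
  define P where "P = A w * A w'"
  define T where "T = complex_of_real (cos x)"
  define W where "W = fps_const w"
  define W' where "W' = fps_const w'"
  define V where "V = fps_const (complex_of_real \<nu>)"
  have ww': "W * W' = 1" using ww by (simp add: W_def W'_def)
  have ws: "W + W' = fps_const (2 * T)" using w2 by (simp add: T_def W_def W'_def)
  have dW: "(1 - W * fps_X) * fps_deriv (A w) = V * W * A w"
    and dW': "(1 - W' * fps_X) * fps_deriv (A w') = V * W' * A w'"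
    using dA[of w] dA[of w'] by (simp_all add: W_def W'_def V_def)
  have "(1 - W * fps_X) * (1 - W' * fps_X) * fps_deriv P
      = (1 - W' * fps_X) * (A w' * ((1 - W * fps_X) * fps_deriv (A w)))
      + (1 - W * fps_X) * (A w * ((1 - W' * fps_X) * fps_deriv (A w')))"
    unfolding P_def by (simp add: algebra_simps)
  also have "\<dots> = V * (W + W' - 2 * (W * W') * fps_X) * P"
    unfolding dW dW' P_def by (simp add: algebra_simps)
  also have "\<dots> = V * (fps_const (2 * T) - 2 * fps_X) * P"
    unfolding ww' ws by simp
  also have "(1 - W * fps_X) * (1 - W' * fps_X)
      = 1 - (W + W') * fps_X + (W * W') * fps_X * fps_X"
    by (simp add: algebra_simps)
  also have "\<dots> = 1 - fps_const (2 * T) * fps_X + fps_X * fps_X" unfolding ww' ws by simp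
  finally have ODE: "(1 - fps_const (2 * T) * fps_X + fps_X * fps_X) * fps_deriv P
     = fps_const (of_real \<nu>) * (fps_const (2 * T) - 2 * fps_X) * P" unfolding V_def .
  have ODE': "fps_deriv P - fps_const (2 * T) * (fps_X * fps_deriv P) + fps_X * (fps_X * fps_deriv P)
     = fps_const (2 * of_real \<nu> * T) * P - fps_const (2 * of_real \<nu>) * (fps_X * P)"
  proof -
    have two: "(2 :: complex fps) = fps_const 2" by (simp add: fps_numeral_fps_const)
    have "fps_const (of_real \<nu>) * (fps_const (2 * T) - 2 * fps_X) * P
       = fps_const (2 * of_real \<nu> * T) * P - fps_const (2 * of_real \<nu>) * (fps_X * P)"
      unfolding two by (simp add: algebra_simps flip: fps_const_mult)
    moreover have "fps_deriv P - fps_const (2 * T) * (fps_X * fps_deriv P) + fps_X * (fps_X * fps_deriv P)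
       = (1 - fps_const (2 * T) * fps_X + fps_X * fps_X) * fps_deriv P"
      by (simp add: algebra_simps)
    ultimately show ?thesis using ODE by simp
  qed
  have P0: "fps_nth P 0 = 1" by (simp add: P_def A_def fps_mult_nth)
  have P1: "fps_nth P 1 = 2 * of_real \<nu> * T"
    using arg_cong[OF ODE', of "\<lambda>f. fps_nth f 0"] by (simp add: P0)
  have Prec: "(of_nat l + 2) * fps_nth P (Suc (Suc l))
     = 2 * (of_nat l + 1 + of_real \<nu>) * T * fps_nth P (Suc l) - (of_nat l + 2 * of_real \<nu>) * fps_nth P l" for l
  proof (cases l)
    case 0
    then show ?thesis using arg_cong[OF ODE', of "\<lambda>f. fps_nth f (Suc l)"]
      by (simp add: algebra_simps)
  next
    case (Suc m)
    then show ?thesis using arg_cong[OF ODE', of "\<lambda>f. fps_nth f (Suc l)"]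
      by (simp add: algebra_simps)
  qed
  have "complex_of_real (poly (gegenbauer \<nu> l) (cos x)) = fps_nth P l \<and>
        complex_of_real (poly (gegenbauer \<nu> (Suc l)) (cos x)) = fps_nth P (Suc l)" for l
  proof (induction l)
    case 0
    show ?case using P0 P1 by (simp add: T_def)
  next
    case (Suc l)
    have "(of_nat l + 2) * complex_of_real (poly (gegenbauer \<nu> (Suc (Suc l))) (cos x))
       = of_real ((real l + 2) * poly (gegenbauer \<nu> (Suc (Suc l))) (cos x))" by simp
    also have "\<dots> = (of_nat l + 2) * fps_nth P (Suc (Suc l))"
      unfolding gegenbauer_rec Prec T_def using Suc.IH by simp
    finally have "complex_of_real (poly (gegenbauer \<nu> (Suc (Suc l))) (cos x)) = fps_nth P (Suc (Suc l))"
      by (subst (asm) mult_cancel_left) (metis add_2_eq_Suc' of_nat_add of_nat_eq_0_iff of_nat_numeral nat.distinct(1))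
    then show ?case using Suc.IH by simp
  qed
  then show ?thesis unfolding P_def A_def fps_mult_nth w_def w'_def by (simp add: atLeast0AtMost)
qed

lemma gegenbauer_abs_le:
  assumes "\<nu> > 0" "\<bar>t\<bar> \<le> 1"
  shows "\<bar>poly (gegenbauer \<nu> l) t\<bar> \<le> gegenbauer_bound \<nu> l"
proof -
  have t: "t = cos (arccos t)" using assms by (simp add: abs_le_iff)
  have "\<bar>poly (gegenbauer \<nu> l) t\<bar> = norm (complex_of_real (poly (gegenbauer \<nu> l) (cos (arccos t))))"
    using t by simp
  also have "\<dots> \<le> gegenbauer_bound \<nu> l"
    unfolding gegenbauer_cos gegenbauer_bound_def
    by (rule order.trans[OF norm_sum])
       (use binom_coeff_pos[OF assms(1)] in \<open>auto simp: norm_mult norm_power abs_of_pos intro!: sum_mono\<close>)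
  finally show ?thesis .
qed

lemma summable_gegenbauer_bound:
  assumes "\<nu> > 0" "0 \<le> r" "r < 1"
  shows "summable (\<lambda>l. gegenbauer_bound \<nu> l * r ^ l)"
proof -
  have p: "norm (binom_coeff \<nu> k * r ^ k) = binom_coeff \<nu> k * r ^ k" for k
    using binom_coeff_pos[OF assms(1), of k] assms by simp
  have s: "summable (\<lambda>k. norm (binom_coeff \<nu> k * r ^ k))"
    unfolding p by (rule summable_binom_coeff[OF assms])
  have "summable (\<lambda>k. \<Sum>i\<le>k. (binom_coeff \<nu> i * r ^ i) * (binom_coeff \<nu> (k - i) * r ^ (k - i)))"
    by (rule summable_Cauchy_product[OF s s])
  also have "(\<lambda>k. \<Sum>i\<le>k. (binom_coeff \<nu> i * r ^ i) * (binom_coeff \<nu> (k - i) * r ^ (k - i)))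
      = (\<lambda>l. gegenbauer_bound \<nu> l * r ^ l)"
    unfolding gegenbauer_bound_def sum_distrib_right
    by (intro ext sum.cong refl) (simp add: mult_ac flip: power_add)
  finally show ?thesis .
qed

lemma poisson_denom_pos:
  assumes "\<bar>t\<bar> \<le> 1" "0 \<le> r" "r < (1::real)"
  shows "0 < 1 - 2 * r * t + r\<^sup>2"
proof -
  have "0 < (1 - r)\<^sup>2" using assms by simp
  also have "\<dots> \<le> 1 - 2 * r * t + r\<^sup>2"
    using mult_left_mono[of t 1 "2 * r"] assms by (simp add: power2_eq_square algebra_simps)
  finally show ?thesis .
qed

text \<open>With \<open>t = cos x\<close> and \<open>z = r cis x\<close> the series is the Cauchy
  product of the binomial series at \<open>z\<close> and at its conjugate, by
  \<open>gegenbauer_cos\<close>.\<close>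

lemma gegenbauer_sums:
  assumes \<nu>: "\<nu> > 0" and t: "\<bar>t\<bar> \<le> 1" and r: "0 \<le> r" "r < 1"
  shows "(\<lambda>l. poly (gegenbauer \<nu> l) t * r ^ l) sums (1 - 2 * r * t + r\<^sup>2) powr (- \<nu>)"
proof -
  define x where "x = arccos t"
  have t': "t = cos x" using t by (simp add: abs_le_iff x_def)
  define z where "z = cis x * of_real r"
  have z: "norm z < 1" using r by (simp add: z_def norm_mult)
  have cz: "cnj z = cis (- x) * of_real r" by (simp add: z_def cis_cnj)
  have p: "norm (of_real (binom_coeff \<nu> k) * y ^ k) = binom_coeff \<nu> k * r ^ k" if "norm y = r" for k and y :: complex
    using binom_coeff_pos[OF \<nu>, of k] that by (simp add: norm_mult norm_power)
  have nz: "norm z = r" "norm (cnj z) = r" using r by (simp_all add: z_def norm_mult)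
  have s: "summable (\<lambda>k. norm (of_real (binom_coeff \<nu> k) * y ^ k))" if "norm y = r" for y :: complex
    unfolding p[OF that] by (rule summable_binom_coeff[OF \<nu> r])
  have "(\<lambda>k. \<Sum>i\<le>k. (of_real (binom_coeff \<nu> i) * z ^ i) * (of_real (binom_coeff \<nu> (k - i)) * cnj z ^ (k - i)))
     sums ((\<Sum>k. of_real (binom_coeff \<nu> k) * z ^ k) * (\<Sum>k. of_real (binom_coeff \<nu> k) * cnj z ^ k))"
    by (rule Cauchy_product_sums[OF s s]) (use nz in auto)
  moreover have "(\<Sum>i\<le>k. (of_real (binom_coeff \<nu> i) * z ^ i) * (of_real (binom_coeff \<nu> (k - i)) * cnj z ^ (k - i)))
      = of_real (poly (gegenbauer \<nu> k) t * r ^ k)" for k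
  proof -
    have "of_real (poly (gegenbauer \<nu> k) t * r ^ k)
       = (\<Sum>i\<le>k. (of_real (binom_coeff \<nu> i) * cis x ^ i) * (of_real (binom_coeff \<nu> (k - i)) * cis (- x) ^ (k - i)) * complex_of_real r ^ k)"
      unfolding t' of_real_mult gegenbauer_cos sum_distrib_right by simp
    also have "\<dots> = (\<Sum>i\<le>k. (of_real (binom_coeff \<nu> i) * z ^ i) * (of_real (binom_coeff \<nu> (k - i)) * cnj z ^ (k - i)))"
    proof (intro sum.cong refl)
      fix i assume "i \<in> {..k}"
      then have "complex_of_real r ^ k = of_real r ^ i * of_real r ^ (k - i)" by (simp flip: power_add)
      then show "(of_real (binom_coeff \<nu> i) * cis x ^ i) * (of_real (binom_coeff \<nu> (k - i)) * cis (- x) ^ (k - i)) * complex_of_real r ^ k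
        = (of_real (binom_coeff \<nu> i) * z ^ i) * (of_real (binom_coeff \<nu> (k - i)) * cnj z ^ (k - i))"
        unfolding cz by (simp add: z_def power_mult_distrib mult_ac)
    qed
    finally show ?thesis by simp
  qed
  moreover have "(\<Sum>k. of_real (binom_coeff \<nu> k) * y ^ k) = (1 - y) powr (- of_real \<nu>)" if "norm y < 1" for y :: complex
    using binom_coeff_sums[OF that] by (simp add: sums_iff)
  ultimately have S: "(\<lambda>k. complex_of_real (poly (gegenbauer \<nu> k) t * r ^ k)) sums ((1 - z) powr (- of_real \<nu>) * (1 - cnj z) powr (- of_real \<nu>))"
    using z by simp
  have z1: "1 - z \<noteq> 0" using z by auto
  have nn: "1 - z \<notin> \<real>\<^sub>\<le>\<^sub>0"
  proof
    assume "1 - z \<in> \<real>\<^sub>\<le>\<^sub>0"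
    then have "Re (1 - z) \<le> 0" by (auto simp: complex_nonpos_Reals_iff)
    then show False using z abs_Re_le_cmod[of z] by simp
  qed
  \<comment> \<open>The two factors are conjugate, so their product is a squared modulus. This
    yields a real power without multiplying complex powers of different bases.\<close>
  have "(1 - cnj z) powr (- of_real \<nu>) = cnj ((1 - z) powr (- of_real \<nu>))"
    using z1 nn by (auto simp: powr_def exp_cnj cnj_Ln)
  then have "(1 - z) powr (- of_real \<nu>) * (1 - cnj z) powr (- of_real \<nu>) = of_real ((norm ((1 - z) powr (- of_real \<nu>)))\<^sup>2)"
    by (simp only: complex_norm_square)
  also have "norm ((1 - z) powr (- of_real \<nu>)) = norm (1 - z) powr (- \<nu>)"
    using norm_powr_real_powr'[of "- of_real \<nu>" "1 - z"] by simp
  also have "(norm (1 - z) powr (- \<nu>))\<^sup>2 = ((norm (1 - z))\<^sup>2) powr (- \<nu>)"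
    using z1 by (simp add: power2_eq_square powr_mult)
  also have "(norm (1 - z))\<^sup>2 = 1 - 2 * r * t + r\<^sup>2"
    unfolding cmod_power2 z_def t'
    by (simp add: power2_eq_square algebra_simps) (simp add: flip: distrib_left power2_eq_square)
  finally have "(\<lambda>k. complex_of_real (poly (gegenbauer \<nu> k) t * r ^ k)) sums of_real ((1 - 2 * r * t + r\<^sup>2) powr (- \<nu>))"
    using S by simp
  then show ?thesis unfolding sums_of_real_iff .
qed

text \<open>For \<open>2 * \<nu> = DIM('a) - 2\<close>, unit vectors \<open>x\<close>,
  \<open>y\<close> and \<open>t = x \<bullet> y\<close> this is \<open>1 - r^2\<close> divided by
  the power \<open>DIM('a)\<close> of \<open>norm (x - r *\<^sub>R y)\<close>: the Poisson kernel of
  the unit ball up to normalisation.\<close>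

definition poisson_kernel :: "real \<Rightarrow> real \<Rightarrow> real \<Rightarrow> real" where
  "poisson_kernel \<nu> r t = (1 - r\<^sup>2) * (1 - 2 * r * t + r\<^sup>2) powr (- (\<nu> + 1))"

lemma summable_weighted_gegenbauer_bound:
  assumes \<nu>: "\<nu> > 0" and r: "0 \<le> r" "r < 1"
  shows "summable (\<lambda>l. (real l + \<nu>) / \<nu> * gegenbauer_bound \<nu> l * r ^ l)"
proof -
  have kpos: "gegenbauer_bound \<nu> l \<ge> 0" for l
    unfolding gegenbauer_bound_def using binom_coeff_pos[OF \<nu>] by (intro sum_nonneg) (auto simp: less_imp_le)
  have "summable (\<lambda>n. gegenbauer_bound \<nu> n * x ^ n)" if "norm x < 1" for x :: real
  proof (rule summable_comparison_test)
    show "\<exists>N. \<forall>n\<ge>N. norm (gegenbauer_bound \<nu> n * x ^ n) \<le> gegenbauer_bound \<nu> n * \<bar>x\<bar> ^ n"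
      using kpos by (auto simp: abs_mult power_abs)
    show "summable (\<lambda>n. gegenbauer_bound \<nu> n * \<bar>x\<bar> ^ n)"
      using that by (intro summable_gegenbauer_bound \<nu>) auto
  qed
  then have "summable (\<lambda>n. diffs (gegenbauer_bound \<nu>) n * r ^ n)"
    using r by (intro termdiff_converges[where K = 1]) auto
  then have "summable (\<lambda>n. real n * gegenbauer_bound \<nu> n * r ^ (n - Suc 0))"
    using diffs_equiv sums_iff by fastforce
  then have "summable (\<lambda>n. r / \<nu> * (real n * gegenbauer_bound \<nu> n * r ^ (n - Suc 0)))"
    by (rule summable_mult)
  moreover have "r / \<nu> * (real n * gegenbauer_bound \<nu> n * r ^ (n - Suc 0)) = real n / \<nu> * gegenbauer_bound \<nu> n * r ^ n" for n
    by (cases n) auto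
  ultimately have "summable (\<lambda>n. real n / \<nu> * gegenbauer_bound \<nu> n * r ^ n + gegenbauer_bound \<nu> n * r ^ n)"
    using summable_gegenbauer_bound[OF \<nu> r] by (intro summable_add) (simp_all only:)
  then show ?thesis using \<nu> by (simp add: field_simps)
qed

text \<open>Apply the operator 1 plus \<open>r / \<nu>\<close> times the derivative in
  \<open>r\<close> to the generating function: it multiplies the \<open>l\<close>-th term by
  \<open>(l + \<nu>) / \<nu>\<close> and turns the closed form into the Poisson kernel. The case
  \<open>r = 0\<close> is separate because the closed form is available only on one side of
  0.\<close>

lemma poisson_kernel_sums:
  assumes \<nu>: "\<nu> > 0" and t: "\<bar>t\<bar> \<le> 1" and r: "0 \<le> r" "r < 1"
  shows "(\<lambda>l. (real l + \<nu>) / \<nu> * poly (gegenbauer \<nu> l) t * r ^ l) sums poisson_kernel \<nu> r t"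
proof (cases "r = 0")
  case True
  have "(\<lambda>l. (real l + \<nu>) / \<nu> * poly (gegenbauer \<nu> l) t * 0 ^ l) sums ((real 0 + \<nu>) / \<nu> * poly (gegenbauer \<nu> 0) t)"
    by (rule powser_sums_zero)
  then show ?thesis using \<nu> True by (simp add: poisson_kernel_def)
next
  case False
  then have r0: "0 < r" using r by simp
  define c where "c l = poly (gegenbauer \<nu> l) t" for l
  define D where "D = 1 - 2 * r * t + r\<^sup>2"
  have D: "D > 0" unfolding D_def by (rule poisson_denom_pos[OF t r])
  \<comment> \<open>\<open>(1 + r) / 2\<close> is a radius strictly between \<open>r\<close> and 1,
    as termwise differentiation at \<open>r\<close> requires.\<close>
  have sc: "summable (\<lambda>l. c l * ((1 + r) / 2) ^ l)"
    using gegenbauer_sums[OF \<nu> t, of "(1 + r) / 2"] r by (simp add: c_def sums_iff)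
  have rn: "norm r < norm ((1 + r) / 2)" using r by simp
  have d1: "((\<lambda>x. \<Sum>n. c n * x ^ n) has_real_derivative (\<Sum>n. diffs c n * r ^ n)) (at r)"
    using termdiffs_strong[OF sc rn] .
  have "((\<lambda>x. (1 - 2 * x * t + x\<^sup>2) powr (- \<nu>)) has_real_derivative
       - \<nu> * D powr (- \<nu> - 1) * (- 2 * t + 2 * r)) (at r)"
    using D unfolding D_def by (auto intro!: derivative_eq_intros simp: powr_diff)
  then have d2: "((\<lambda>x. \<Sum>n. c n * x ^ n) has_real_derivative - \<nu> * D powr (- \<nu> - 1) * (- 2 * t + 2 * r)) (at r)"
  proof (rule DERIV_cong_ev[THEN iffD1, rotated 3])
    have "\<forall>\<^sub>F x in nhds r. x \<in> {0<..<1}" using r0 r by (intro eventually_nhds_in_open) auto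
    then show "\<forall>\<^sub>F x in nhds r. (1 - 2 * x * t + x\<^sup>2) powr (- \<nu>) = (\<Sum>n. c n * x ^ n)"
      by eventually_elim (use gegenbauer_sums[OF \<nu> t] in \<open>auto simp: c_def sums_iff\<close>)
  qed auto
  have eq: "(\<Sum>n. diffs c n * r ^ n) = - \<nu> * D powr (- \<nu> - 1) * (- 2 * t + 2 * r)"
    using DERIV_unique[OF d1 d2] .
  have "summable (\<lambda>n. diffs c n * r ^ n)"
    by (rule termdiff_converges[OF rn]) (use powser_inside[OF sc] in auto)
  from diffs_equiv[OF this] have "(\<lambda>n. real n * c n * r ^ (n - Suc 0)) sums (- \<nu> * D powr (- \<nu> - 1) * (- 2 * t + 2 * r))"
    unfolding eq .
  from sums_mult[OF this, of "r / \<nu>"]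
  have "(\<lambda>n. r / \<nu> * (real n * c n * r ^ (n - Suc 0))) sums (D powr (- \<nu> - 1) * (2 * r * t - 2 * r\<^sup>2))"
    using \<nu> by (simp add: power2_eq_square algebra_simps)
  moreover have "r / \<nu> * (real n * c n * r ^ (n - Suc 0)) = real n / \<nu> * c n * r ^ n" for n
    by (cases n) auto
  ultimately have "(\<lambda>n. real n / \<nu> * c n * r ^ n) sums (D powr (- \<nu> - 1) * (2 * r * t - 2 * r\<^sup>2))"
    by (simp only:)
  from sums_add[OF this gegenbauer_sums[OF \<nu> t r, folded c_def D_def]]
  have "(\<lambda>n. (real n + \<nu>) / \<nu> * c n * r ^ n) sums (D powr (- \<nu> - 1) * (2 * r * t - 2 * r\<^sup>2) + D powr (- \<nu>))"
    using \<nu> by (simp add: field_simps)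
  also have "D powr (- \<nu>) = D powr (- \<nu> - 1) * D"
    using D by (simp add: powr_diff)
  also have "D powr (- \<nu> - 1) * (2 * r * t - 2 * r\<^sup>2) + D powr (- \<nu> - 1) * D = poisson_kernel \<nu> r t"
  proof -
    have "2 * r * t - 2 * r\<^sup>2 + D = 1 - r\<^sup>2" by (simp add: D_def)
    then have "D powr (- \<nu> - 1) * (2 * r * t - 2 * r\<^sup>2) + D powr (- \<nu> - 1) * D = D powr (- \<nu> - 1) * (1 - r\<^sup>2)"
      by (simp only: flip: distrib_left)
    moreover have "- (\<nu> + 1) = - \<nu> - 1" by simp
    ultimately show ?thesis unfolding poisson_kernel_def D_def[symmetric] by (simp only: mult.commute)
  qed
  finally show ?thesis unfolding c_def .
qed

text \<open>The cone over a cap is covered by about \<open>1/\<rho>\<close> balls of radius \<open>2\<rho>\<close> centred on its axis.\<close>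

lemma emeasure_sphere_cap_le:
  fixes y :: "'a::euclidean_space"
  assumes y: "norm y = 1" and \<rho>: "0 < \<rho>"
  shows "emeasure sphere_measure (sphere 0 1 \<inter> ball y \<rho>)
       \<le> ennreal (2 ^ (DIM('a) + 1) * unit_ball_vol (real DIM('a)) * \<rho> ^ (DIM('a) - 1))"
proof -
  define N where "N = DIM('a)"
  have N: "N = Suc (N - 1)" unfolding N_def by simp
  define V where "V = unit_ball_vol (real N)"
  have V: "V \<ge> 0" unfolding V_def by (rule less_imp_le[OF unit_ball_vol_pos]) simp
  define A where "A = {x \<in> ball (0::'a) 1 - {0}. x /\<^sub>R norm x \<in> ball y \<rho>}"
  have meas: "sphere 0 1 \<inter> ball y \<rho> \<in> sets sphere_measure"
    by (auto simp: sets_restrict_space)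
  have [measurable]: "ball y \<rho> \<in> sets borel" "ball (0::'a) 1 - {0} \<in> sets borel"
    by simp_all
  have Am: "A \<in> sets lborel"
    unfolding A_def by measurable
  have eA: "emeasure sphere_measure (sphere 0 1 \<inter> ball y \<rho>) = emeasure lborel A"
  proof -
    have "emeasure sphere_measure (sphere 0 1 \<inter> ball y \<rho>) = (\<integral>\<^sup>+x. indicator (sphere 0 1 \<inter> ball y \<rho>) x \<partial>sphere_measure)"
      using meas by simp
    also have "\<dots> = (\<integral>\<^sup>+x. indicator A x \<partial>lborel)"
      using meas
      by (subst nn_integral_sphere_measure, simp, intro nn_integral_cong) (auto simp: A_def indicator_def)
    finally show ?thesis using Am by simp
  qed
  show ?thesis
  proof (cases "\<rho> \<le> 1")
    case True
    define K where "K = nat \<lfloor>1 / \<rho>\<rfloor>"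
    have K: "real K \<le> 1 / \<rho>" unfolding K_def using \<rho> by (simp add: of_nat_nat)
    have sub: "A \<subseteq> (\<Union>k\<le>K. ball ((real k * \<rho>) *\<^sub>R y) (2 * \<rho>))"
    proof
      fix x assume "x \<in> A"
      then have x: "norm x < 1" "x \<noteq> 0" "norm (y - x /\<^sub>R norm x) < \<rho>"
        by (auto simp: A_def dist_norm)
      define k where "k = nat \<lfloor>norm x / \<rho>\<rfloor>"
      have k1: "real k * \<rho> \<le> norm x"
      proof -
        have "real k \<le> norm x / \<rho>" unfolding k_def using \<rho> by (simp add: of_nat_nat)
        then show ?thesis using \<rho> by (simp add: field_simps)
      qed
      have k2: "norm x < (real k + 1) * \<rho>"
      proof -
        have "norm x / \<rho> < real k + 1" unfolding k_def using \<rho>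
          by (simp add: of_nat_nat)
        then show ?thesis using \<rho> by (simp add: field_simps)
      qed
      have "norm x / \<rho> \<le> 1 / \<rho>" using x \<rho> by (intro divide_right_mono) auto
      then have kK: "k \<le> K" unfolding k_def K_def by (intro nat_mono floor_mono)
      have "norm (norm x *\<^sub>R y - x) = norm x * norm (y - x /\<^sub>R norm x)"
      proof -
        have "norm x *\<^sub>R y - x = norm x *\<^sub>R (y - x /\<^sub>R norm x)"
          using x by (simp add: scaleR_diff_right)
        then show ?thesis by simp
      qed
      also have "\<dots> \<le> 1 * \<rho>" using x by (intro mult_mono) auto
      finally have d1: "norm (norm x *\<^sub>R y - x) \<le> \<rho>" by simp
      have "(real k * \<rho>) *\<^sub>R y - norm x *\<^sub>R y = (real k * \<rho> - norm x) *\<^sub>R y"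
        by (simp add: scaleR_diff_left)
      then have "norm ((real k * \<rho>) *\<^sub>R y - norm x *\<^sub>R y) = \<bar>real k * \<rho> - norm x\<bar>"
        using y by (simp only: norm_scaleR) simp
      then have d2: "norm ((real k * \<rho>) *\<^sub>R y - norm x *\<^sub>R y) < \<rho>"
        using k1 k2 by (simp add: algebra_simps abs_if)
      have "norm ((real k * \<rho>) *\<^sub>R y - x) < 2 * \<rho>"
        using norm_triangle_ineq[of "(real k * \<rho>) *\<^sub>R y - norm x *\<^sub>R y" "norm x *\<^sub>R y - x"] d1 d2 by simp
      then show "x \<in> (\<Union>k\<le>K. ball ((real k * \<rho>) *\<^sub>R y) (2 * \<rho>))"
        using kK by (auto simp: dist_norm)
    qed
    have "emeasure lborel A \<le> emeasure lborel (\<Union>k\<le>K. ball ((real k * \<rho>) *\<^sub>R y) (2 * \<rho>))"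
      by (rule emeasure_mono[OF sub]) auto
    also have "\<dots> \<le> (\<Sum>k\<le>K. emeasure lborel (ball ((real k * \<rho>) *\<^sub>R y) (2 * \<rho>)))"
      by (rule emeasure_subadditive_finite) auto
    also have "\<dots> = (\<Sum>k\<le>K. ennreal (V * (2 * \<rho>) ^ N))"
      using \<rho> by (simp add: emeasure_ball V_def N_def)
    also have "\<dots> = ennreal ((real K + 1) * (V * (2 * \<rho>) ^ N))"
      using V \<rho> by (subst sum_ennreal) (auto simp: algebra_simps)
    also have "\<dots> \<le> ennreal (2 / \<rho> * (V * (2 * \<rho>) ^ N))"
    proof (intro ennreal_leI mult_right_mono)
      have "1 \<le> 1 / \<rho>" using True \<rho> by simp
      then show "real K + 1 \<le> 2 / \<rho>" using K by simp
    qed (use V \<rho> in auto)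
    also have "2 / \<rho> * (V * (2 * \<rho>) ^ N) = 2 ^ (N + 1) * V * \<rho> ^ (N - 1)"
    proof -
      obtain m where "N = Suc m" using N by blast
      then show ?thesis using \<rho> by (simp add: power_mult_distrib field_simps)
    qed
    finally show ?thesis unfolding eA N_def V_def .
  next
    case False
    have "emeasure lborel A \<le> emeasure lborel (ball (0::'a) 1)"
      by (rule emeasure_mono) (auto simp: A_def)
    also have "\<dots> = ennreal V" by (simp add: emeasure_ball V_def N_def)
    also have "\<dots> \<le> ennreal (2 ^ (N + 1) * V * \<rho> ^ (N - 1))"
    proof (rule ennreal_leI)
      have "1 * V * 1 \<le> 2 ^ (N + 1) * V * \<rho> ^ (N - 1)"
        using False V by (intro mult_mono one_le_power) auto
      then show "V \<le> 2 ^ (N + 1) * V * \<rho> ^ (N - 1)" by simp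
    qed
    finally show ?thesis unfolding eA N_def V_def .
  qed
qed

section \<open>Uniform mass bound and radial integral of the Poisson kernel\<close>

lemma norm_diff_scaleR_unit:
  fixes x y :: "'a::euclidean_space"
  assumes "norm x = 1" "norm y = 1"
  shows "(norm (x - r *\<^sub>R y))\<^sup>2 = 1 - 2 * r * (x \<bullet> y) + r\<^sup>2"
  using assms unfolding power2_norm_eq_inner
  by (simp add: inner_diff_left inner_diff_right inner_commute norm_eq_1 power2_eq_square)

lemma abs_inner_unit_le:
  fixes x y :: "'a::euclidean_space"
  assumes "norm x = 1" "norm y = 1"
  shows "\<bar>x \<bullet> y\<bar> \<le> 1"
  using Cauchy_Schwarz_ineq2[of x y] assms by simp

lemma poisson_kernel_nonneg:
  assumes "0 \<le> r" "r \<le> 1"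
  shows "0 \<le> poisson_kernel \<nu> r t"
  using assms unfolding poisson_kernel_def
  by (intro mult_nonneg_nonneg) (auto simp: power_le_one)

lemma continuous_on_poisson_kernel:
  fixes y :: "'a::euclidean_space"
  assumes y: "norm y = 1" and r: "0 \<le> r" "r < 1"
  shows "continuous_on (sphere 0 1) (\<lambda>x. poisson_kernel \<nu> r (x \<bullet> y))"
  unfolding poisson_kernel_def
proof (intro continuous_intros ballI)
  fix x :: 'a assume "x \<in> sphere 0 1"
  then show "1 - 2 * r * (x \<bullet> y) + r\<^sup>2 \<noteq> 0"
    using poisson_denom_pos[OF abs_inner_unit_le r, of x y] y by auto
qed

text \<open>Layer-cake integration of \<open>a\<close> to the power \<open>-N\<close>: the level
  \<open>t\<close> contributes only for \<open>t \<ge> 1 - r\<close>, from a cap of measure at most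
  a multiple of the power \<open>N - 1\<close> of \<open>t\<close>. What is left is the integral of
  \<open>t\<close> to the power -2 from \<open>1 - r\<close>, and its value
  \<open>1 / (1 - r)\<close> cancels the factor \<open>1 - r\<close> of the kernel.\<close>

lemma poisson_mass_bounded:
  assumes nu: "2 * \<nu> = real DIM('a) - 2"
  obtains M where "0 < M" "\<And>y::'a::euclidean_space. \<And>r. norm y = 1 \<Longrightarrow> 0 \<le> r \<Longrightarrow> r < 1 \<Longrightarrow>
     (\<integral>\<^sup>+x. ennreal (poisson_kernel \<nu> r (x \<bullet> y)) \<partial>sphere_measure) \<le> ennreal M"
proof -
  define N where "N = DIM('a)"
  have N: "0 < N" "N = Suc (N - 1)" unfolding N_def by simp_all
  define V where "V = 2 ^ (N + 1) * unit_ball_vol (real N)"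
  have V: "V > 0" unfolding V_def by simp
  define M where "M = 2 * (real N * V * 3 ^ (N - 1))"
  have M: "M > 0" unfolding M_def using V N by simp
  moreover have "(\<integral>\<^sup>+x. ennreal (poisson_kernel \<nu> r (x \<bullet> y)) \<partial>sphere_measure) \<le> ennreal M"
    if y: "norm y = 1" and r: "0 \<le> r" "r < 1" for y :: 'a and r
  proof -
    \<comment> \<open>A lower bound for \<open>norm (x - r *\<^sub>R y)\<close>. If
      \<open>a x \<le> t\<close> then \<open>norm (x - y) \<le> 2 * t\<close>, which places
      \<open>x\<close> in the open ball of radius \<open>3 * t\<close> used below.\<close>
    define a where "a x = max (1 - r) (norm (x - y) / 2)" for x
    have apos: "a x > 0" for x unfolding a_def using r by simp
    have am [measurable]: "a \<in> borel_measurable sphere_measure"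
      unfolding a_def by (intro borel_measurable_sphere_restrictI) measurable
    have dist: "a x \<le> norm (x - r *\<^sub>R y)" if "norm x = 1" for x
    proof -
      have 1: "1 - r \<le> norm (x - r *\<^sub>R y)"
        using norm_triangle_ineq2[of x "r *\<^sub>R y"] that y r by simp
      have "norm (x - y) \<le> norm (x - r *\<^sub>R y) + norm (r *\<^sub>R y - y)"
        using norm_triangle_ineq[of "x - r *\<^sub>R y" "r *\<^sub>R y - y"] by simp
      also have "norm (r *\<^sub>R y - y) = norm ((r - 1) *\<^sub>R y)" by (simp add: scaleR_diff_left)
      also have "\<dots> = 1 - r" using y r by simp
      finally show ?thesis using 1 unfolding a_def by simp
    qed
    have P: "ennreal (poisson_kernel \<nu> r (x \<bullet> y)) \<le> ennreal (2 * (1 - r)) * ennreal (inverse (a x ^ N))"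
      if "norm x = 1" for x
    proof -
      define D where "D = norm (x - r *\<^sub>R y)"
      have D: "D > 0" using dist[OF that] apos[of x] unfolding D_def by linarith
      have "(1 - 2 * r * (x \<bullet> y) + r\<^sup>2) powr (- (\<nu> + 1)) = (D\<^sup>2) powr (- (real N / 2))"
      proof -
        have "- (\<nu> + 1) = - (real N / 2)" using nu by (simp add: N_def)
        then show ?thesis unfolding D_def norm_diff_scaleR_unit[OF that y] by (simp only:)
      qed
      also have "\<dots> = D powr (- real N)"
        using D by (simp add: powr_powr flip: powr_numeral)
      also have "\<dots> = inverse (D ^ N)"
        using D by (simp add: powr_minus powr_realpow)
      finally have "poisson_kernel \<nu> r (x \<bullet> y) = (1 - r) * (1 + r) * inverse (D ^ N)"
        unfolding poisson_kernel_def by (simp add: power2_eq_square algebra_simps)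
      also have "\<dots> \<le> (1 - r) * 2 * inverse (a x ^ N)"
        using r D apos[of x] dist[OF that, folded D_def]
        by (intro mult_mono le_imp_inverse_le power_mono zero_less_power) auto
      finally show ?thesis
        using r apos[of x] by (subst ennreal_mult[symmetric]) (auto simp: mult_ac intro!: ennreal_leI less_imp_le)
    qed
    have layer: "ennreal (inverse (a x ^ N)) = (\<integral>\<^sup>+t. ennreal (real N / t ^ (N + 1)) * indicator {a x..} t \<partial>lborel)" for x
    proof -
      have "(\<integral>\<^sup>+t. ennreal (real N / t ^ (N + 1)) * indicator {a x..} t \<partial>lborel)
         = (\<integral>\<^sup>+t. ennreal (inverse (a x ^ N)) * (ennreal (real N * a x ^ N / t ^ (N + 1)) * indicator {a x..} t) \<partial>lborel)"
      proof (rule nn_integral_cong)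
        fix t :: real
        have "real N / t ^ (N + 1) = inverse (a x ^ N) * (real N * a x ^ N / t ^ (N + 1))"
          using apos[of x] by (simp add: field_simps)
        moreover have "ennreal (inverse (a x ^ N) * (real N * a x ^ N / t ^ (N + 1)))
            = ennreal (inverse (a x ^ N)) * ennreal (real N * a x ^ N / t ^ (N + 1))"
          using apos[of x] by (intro ennreal_mult') auto
        ultimately have "ennreal (real N / t ^ (N + 1)) = ennreal (inverse (a x ^ N)) * ennreal (real N * a x ^ N / t ^ (N + 1))"
          by (simp only:)
        then show "ennreal (real N / t ^ (N + 1)) * indicator {a x..} t
          = ennreal (inverse (a x ^ N)) * (ennreal (real N * a x ^ N / t ^ (N + 1)) * indicator {a x..} t)"
          by (simp only: mult.assoc)
      qed
      also have "\<dots> = ennreal (inverse (a x ^ N))"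
        by (subst nn_integral_cmult) (use nn_integral_power_tail[OF apos N(1)] in auto)
      finally show ?thesis ..
    qed
    interpret PS: pair_sigma_finite "sphere_measure :: 'a measure" "lborel :: real measure" ..
    have "(\<integral>\<^sup>+x. ennreal (inverse (a x ^ N)) \<partial>sphere_measure)
        = (\<integral>\<^sup>+x. (\<integral>\<^sup>+t. (if a x \<le> t then ennreal (real N / t ^ (N + 1)) else 0) \<partial>lborel) \<partial>sphere_measure)"
      unfolding layer by (intro nn_integral_cong) (auto simp: indicator_def)
    also have "\<dots> = (\<integral>\<^sup>+t. (\<integral>\<^sup>+x. (if a x \<le> t then ennreal (real N / t ^ (N + 1)) else 0) \<partial>sphere_measure) \<partial>lborel)"
      by (rule PS.Fubini'[symmetric]) measurable
    also have "\<dots> \<le> (\<integral>\<^sup>+t. ennreal (real N * V * 3 ^ (N - 1) / (1 - r)) * (ennreal (real 1 * (1 - r) ^ 1 / t ^ (1 + 1)) * indicator {1 - r..} t) \<partial>lborel)"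
    proof (rule nn_integral_mono)
      fix t :: real
      show "(\<integral>\<^sup>+x. (if a x \<le> t then ennreal (real N / t ^ (N + 1)) else 0) \<partial>sphere_measure)
        \<le> ennreal (real N * V * 3 ^ (N - 1) / (1 - r)) * (ennreal (real 1 * (1 - r) ^ 1 / t ^ (1 + 1)) * indicator {1 - r..} t)"
      proof (cases "1 - r \<le> t")
        case True
        then have t: "t > 0" using r by simp
        have "(\<integral>\<^sup>+x. (if a x \<le> t then ennreal (real N / t ^ (N + 1)) else 0) \<partial>sphere_measure)
           \<le> (\<integral>\<^sup>+x. ennreal (real N / t ^ (N + 1)) * indicator (sphere 0 1 \<inter> ball y (3 * t)) x \<partial>sphere_measure)"
          using t by (intro nn_integral_mono) (auto simp: a_def dist_norm norm_minus_commute indicator_def)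
        also have "\<dots> = ennreal (real N / t ^ (N + 1)) * emeasure sphere_measure (sphere 0 1 \<inter> ball y (3 * t))"
          by (rule nn_integral_cmult_indicator) (auto simp: sets_restrict_space)
        also have "\<dots> \<le> ennreal (real N / t ^ (N + 1)) * ennreal (V * (3 * t) ^ (N - 1))"
          using emeasure_sphere_cap_le[OF y, of "3 * t"] t
          by (intro mult_left_mono) (auto simp: V_def N_def)
        also have "\<dots> = ennreal (real N / t ^ (N + 1) * (V * (3 * t) ^ (N - 1)))"
          using t V by (subst ennreal_mult) auto
        also have "real N / t ^ (N + 1) * (V * (3 * t) ^ (N - 1)) = real N * V * 3 ^ (N - 1) / (1 - r) * (real 1 * (1 - r) ^ 1 / t ^ (1 + 1))"
          using t r by (subst (2) N(2)) (simp add: power_mult_distrib field_simps)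
        also have "ennreal \<dots> = ennreal (real N * V * 3 ^ (N - 1) / (1 - r)) * ennreal (real 1 * (1 - r) ^ 1 / t ^ (1 + 1))"
          using t r V by (subst ennreal_mult) auto
        finally show ?thesis using True by simp
      next
        case False
        then have "\<not> a x \<le> t" for x unfolding a_def by simp
        then show ?thesis by simp
      qed
    qed
    also have "\<dots> = ennreal (real N * V * 3 ^ (N - 1) / (1 - r))"
      using nn_integral_power_tail[of "1 - r" 1] r by (subst nn_integral_cmult) auto
    finally have I: "(\<integral>\<^sup>+x. ennreal (inverse (a x ^ N)) \<partial>sphere_measure) \<le> ennreal (real N * V * 3 ^ (N - 1) / (1 - r))" .
    have "(\<integral>\<^sup>+x. ennreal (poisson_kernel \<nu> r (x \<bullet> y)) \<partial>sphere_measure)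
       \<le> (\<integral>\<^sup>+x. ennreal (2 * (1 - r)) * ennreal (inverse (a x ^ N)) \<partial>sphere_measure)"
      by (intro nn_integral_mono P) auto
    also have "\<dots> = ennreal (2 * (1 - r)) * (\<integral>\<^sup>+x. ennreal (inverse (a x ^ N)) \<partial>sphere_measure)"
      by (rule nn_integral_cmult) measurable
    also have "\<dots> \<le> ennreal (2 * (1 - r)) * ennreal (real N * V * 3 ^ (N - 1) / (1 - r))"
      by (intro mult_left_mono I) auto
    also have "\<dots> = ennreal (2 * (1 - r) * (real N * V * 3 ^ (N - 1) / (1 - r)))"
      using r V by (intro ennreal_mult[symmetric]) auto
    also have "2 * (1 - r) * (real N * V * 3 ^ (N - 1) / (1 - r)) = M"
    proof -
      have "2 * (1 - r) * (Z / (1 - r)) = 2 * Z" for Z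
        using r by (simp add: divide_simps)
      then show ?thesis unfolding M_def .
    qed
    finally show ?thesis .
  qed
  ultimately show ?thesis using that by blast
qed

lemma nn_integral_Beta:
  assumes "0 < a" "0 < (b::real)"
  shows "(\<integral>\<^sup>+z. ennreal (z powr (a - 1) * (1 - z) powr (b - 1) * indicator {0..1} z) \<partial>lborel) = ennreal (Beta a b)"
proof -
  have "((\<lambda>z. z powr (a - 1) * (1 - z) powr (b - 1) * indicator {0..1} z) has_integral Beta a b) UNIV"
    using has_integral_Beta_real[OF assms]
    by (subst (asm) has_integral_restrict_UNIV[symmetric]) (simp add: indicator_def of_bool_def if_distrib cong: if_cong)
  then show ?thesis
    by (intro nn_integral_has_integral_lborel[where f = "\<lambda>z. z powr (a - 1) * (1 - z) powr (b - 1) * indicator {0..1} z"]) auto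
qed

text \<open>The relation \<open>\<alpha> + s = \<nu> + 1 / 2\<close> is what makes the powers of
  \<open>den r\<close> produced by the substitution add up to the exponent
  \<open>- (\<nu> + 1)\<close> of the Poisson kernel. For unit vectors with
  \<open>t = x \<bullet> y\<close> the base \<open>2 - 2 * t\<close> is the squared distance, so the
  Riesz kernel appears.\<close>

lemma nn_integral_poisson_kernel_radial:
  assumes t: "\<bar>t\<bar> \<le> 1" "t < 1" and \<alpha>: "0 < \<alpha>" and s: "0 < s" and eq: "\<alpha> + s = \<nu> + 1 / 2"
  shows "(\<integral>\<^sup>+r. ennreal (r powr (\<alpha> - 1) * (1 - r) powr (2 * s - 1) * poisson_kernel \<nu> r t) * indicator {0..1} r \<partial>lborel)
       = ennreal (Beta \<alpha> (s + 1 / 2) * (2 - 2 * t) powr (- \<alpha>))"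
proof -
  define D where "D = 2 - 2 * t"
  have D: "D > 0" using t by (simp add: D_def)
  define den where "den r = 1 - 2 * r * t + r\<^sup>2" for r
  have den_eq: "den r = (1 - r)\<^sup>2 + r * D" for r
    by (simp add: den_def D_def power2_eq_square algebra_simps)
  have den: "den r > 0" if "r \<in> {0..1}" for r
  proof (cases "r = 1")
    case True
    then show ?thesis using D by (simp add: den_eq)
  next
    case False
    then have "(1 - r)\<^sup>2 > 0" using that by simp
    moreover have "r * D \<ge> 0" using that D by simp
    ultimately show ?thesis unfolding den_eq by linarith
  qed
  \<comment> \<open>The substitution \<open>z = r D / den r\<close> maps the integral to Euler's Beta integral.\<close>
  define g where "g r = r * D / den r" for r
  define g' where "g' r = D * (1 - r\<^sup>2) / (den r)\<^sup>2" for r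
  define f where "f z = z powr (\<alpha> - 1) * (1 - z) powr (s + 1 / 2 - 1)" for z :: real
  have g0: "g 0 = 0" by (simp add: g_def)
  have g1: "g 1 = 1" using D by (simp add: g_def den_eq)
  have sub: "(\<integral>\<^sup>+z. ennreal (f z * indicator {g 0..g 1} z) \<partial>lborel) = (\<integral>\<^sup>+r. ennreal (f (g r) * g' r * indicator {0..1} r) \<partial>lborel)"
  proof (rule nn_integral_substitution)
    show "set_borel_measurable borel {g 0..g 1} f"
      unfolding set_borel_measurable_def f_def by measurable
    show "(g has_real_derivative g' r) (at r)" if "r \<in> {0..1}" for r
    proof -
      have "(g has_real_derivative ((D * den r - r * D * (2 * r - 2 * t)) / (den r * den r))) (at r)"
        unfolding g_def den_def using den[OF that] unfolding den_def
        by (auto intro!: derivative_eq_intros simp: algebra_simps)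
      also have "D * den r - r * D * (2 * r - 2 * t) = D * (1 - r\<^sup>2)"
        by (simp add: den_def power2_eq_square algebra_simps)
      finally show ?thesis by (simp add: g'_def power2_eq_square)
    qed
    show "continuous_on {0..1} g'"
      unfolding g'_def den_def using den unfolding den_def
      by (intro continuous_intros) (auto simp: less_le)
    show "g' r \<ge> 0" if "r \<in> {0..1}" for r
      unfolding g'_def using that D by (auto intro!: mult_nonneg_nonneg divide_nonneg_nonneg simp: power_le_one)
  qed simp
  have pt: "f (g r) * g' r = D powr \<alpha> * (r powr (\<alpha> - 1) * (1 - r) powr (2 * s - 1) * poisson_kernel \<nu> r t)"
    if r: "0 < r" "r < 1" for r
  proof -
    have d: "den r > 0" using den[of r] r by simp
    have 1: "1 - g r = (1 - r)\<^sup>2 / den r"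
      using d unfolding g_def by (simp add: field_simps) (simp add: den_eq)
    have quot: "(x / y) powr e = x powr e * y powr (- e)" if "x > 0" "y > 0" for x y e :: real
      using that by (simp add: powr_divide powr_minus_divide)
    have gp: "g r powr (\<alpha> - 1) = r powr (\<alpha> - 1) * D powr (\<alpha> - 1) * den r powr (- (\<alpha> - 1))"
      unfolding g_def using r D d by (simp only: quot[of "r * D"] mult_pos_pos) (simp add: powr_mult)
    have "((1 - r)\<^sup>2) powr (s + 1 / 2 - 1) = (1 - r) powr (2 * s - 1)"
      using r by (simp add: powr_powr algebra_simps flip: powr_numeral)
    then have hp: "(1 - g r) powr (s + 1 / 2 - 1) = (1 - r) powr (2 * s - 1) * den r powr (- (s + 1 / 2 - 1))"
      unfolding 1 using r d by (simp only: quot[of "(1 - r)\<^sup>2"] zero_less_power diff_gt_0_iff_gt)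
    have d2: "g' r = D powr 1 * (1 - r\<^sup>2) * den r powr (- 2)"
      unfolding g'_def using d D by (simp add: powr_minus divide_inverse powr_numeral)
    have e: "(- (\<alpha> - 1)) + (- (s + 1 / 2 - 1)) + (- 2) = - (\<nu> + 1)" using eq by simp
    have dd: "den r powr (- (\<nu> + 1)) = den r powr (- (\<alpha> - 1)) * den r powr (- (s + 1 / 2 - 1)) * den r powr (- 2)"
      by (simp only: e[symmetric] powr_add)
    have DD: "D powr \<alpha> = D powr (\<alpha> - 1) * D powr 1"
      by (simp only: powr_add[symmetric]) simp
    show ?thesis
      unfolding f_def gp hp d2 poisson_kernel_def den_def[symmetric] dd DD by (simp only: mult_ac)
  qed
  have pm [measurable]: "(\<lambda>r. poisson_kernel \<nu> r t) \<in> borel_measurable borel"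
    unfolding poisson_kernel_def by measurable
  have "ennreal (Beta \<alpha> (s + 1 / 2)) = (\<integral>\<^sup>+z. ennreal (f z * indicator {g 0..g 1} z) \<partial>lborel)"
    unfolding f_def g0 g1 using nn_integral_Beta[of \<alpha> "s + 1 / 2"] \<alpha> s by simp
  also have "\<dots> = (\<integral>\<^sup>+r. ennreal (D powr \<alpha>) * (ennreal (r powr (\<alpha> - 1) * (1 - r) powr (2 * s - 1) * poisson_kernel \<nu> r t) * indicator {0..1} r) \<partial>lborel)"
    unfolding sub
  proof (rule nn_integral_cong_AE)
    show "AE r in lborel. ennreal (f (g r) * g' r * indicator {0..1} r)
       = ennreal (D powr \<alpha>) * (ennreal (r powr (\<alpha> - 1) * (1 - r) powr (2 * s - 1) * poisson_kernel \<nu> r t) * indicator {0..1} r)"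
      using AE_lborel_singleton[of "0::real"] AE_lborel_singleton[of "1::real"]
    proof eventually_elim
      case (elim r)
      show ?case
      proof (cases "r \<in> {0<..<1}")
        case True
        then show ?thesis using pt[of r] by (simp add: ennreal_mult'[symmetric])
      next
        case False
        then show ?thesis using elim by (auto simp: indicator_def)
      qed
    qed
  qed
  also have "\<dots> = ennreal (D powr \<alpha>) * (\<integral>\<^sup>+r. ennreal (r powr (\<alpha> - 1) * (1 - r) powr (2 * s - 1) * poisson_kernel \<nu> r t) * indicator {0..1} r \<partial>lborel)"
    by (rule nn_integral_cmult) measurable
  finally have B: "ennreal (Beta \<alpha> (s + 1 / 2)) = ennreal (D powr \<alpha>) * (\<integral>\<^sup>+r. ennreal (r powr (\<alpha> - 1) * (1 - r) powr (2 * s - 1) * poisson_kernel \<nu> r t) * indicator {0..1} r \<partial>lborel)" .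
  have one: "ennreal (D powr (- \<alpha>)) * ennreal (D powr \<alpha>) = 1"
    using D by (simp add: powr_minus flip: ennreal_mult)
  have "ennreal (Beta \<alpha> (s + 1 / 2) * D powr (- \<alpha>)) = ennreal (D powr (- \<alpha>)) * ennreal (Beta \<alpha> (s + 1 / 2))"
    by (subst mult.commute, rule ennreal_mult') simp
  also have "\<dots> = (\<integral>\<^sup>+r. ennreal (r powr (\<alpha> - 1) * (1 - r) powr (2 * s - 1) * poisson_kernel \<nu> r t) * indicator {0..1} r \<partial>lborel)"
    unfolding B by (simp only: mult.assoc[symmetric] one mult_1_left)
  finally show ?thesis unfolding D_def ..
qed

section \<open>Zonal eigenfunctions\<close>

lemma C1_onI:
  assumes "\<And>x. x \<in> S \<Longrightarrow> (g has_derivative g' x) (at x)" "\<And>v. continuous_on S (\<lambda>x. g' x v)"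
  shows "C1_on S g"
  using assms unfolding C1_on_def by blast

lemma C1_on_imp_continuous_on: "C1_on S g \<Longrightarrow> continuous_on S g"
  unfolding C1_on_def
  by (meson continuous_at_imp_continuous_on has_derivative_continuous)

lemma C1_on_const: "C1_on S (\<lambda>_. c)"
  by (rule C1_onI[where g' = "\<lambda>_ _. 0"]) auto

lemma C1_on_inner: "C1_on S (\<lambda>x. x \<bullet> y)"
  by (rule C1_onI[where g' = "\<lambda>_ v. v \<bullet> y"]) (auto intro!: derivative_eq_intros continuous_intros)

lemma C1_on_diff:
  assumes "C1_on S f" "C1_on S g"
  shows "C1_on S (\<lambda>x. f x - g x)"
proof -
  from assms obtain f' g' where "\<forall>x\<in>S. (f has_derivative f' x) (at x)" "\<forall>v. continuous_on S (\<lambda>x. f' x v)"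
    "\<forall>x\<in>S. (g has_derivative g' x) (at x)" "\<forall>v. continuous_on S (\<lambda>x. g' x v)"
    unfolding C1_on_def by blast
  then show ?thesis
    by (intro C1_onI[where g' = "\<lambda>x v. f' x v - g' x v"]) (auto intro!: has_derivative_diff continuous_intros)
qed

lemma C1_on_mult:
  assumes "C1_on S f" "C1_on S g"
  shows "C1_on S (\<lambda>x. f x * g x)"
proof -
  from assms obtain f' g' where *: "\<forall>x\<in>S. (f has_derivative f' x) (at x)" "\<forall>v. continuous_on S (\<lambda>x. f' x v)"
    "\<forall>x\<in>S. (g has_derivative g' x) (at x)" "\<forall>v. continuous_on S (\<lambda>x. g' x v)"
    unfolding C1_on_def by blast
  show ?thesis
    by (rule C1_onI[where g' = "\<lambda>x v. f x * g' x v + f' x v * g x"])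
       (use * C1_on_imp_continuous_on assms in \<open>auto intro!: has_derivative_mult continuous_intros\<close>)
qed

lemma C1_on_poly:
  fixes q :: "real poly"
  assumes "C1_on S f"
  shows "C1_on S (\<lambda>x. poly q (f x))"
proof -
  from assms obtain f' where *: "\<forall>x\<in>S. (f has_derivative f' x) (at x)" "\<forall>v. continuous_on S (\<lambda>x. f' x v)"
    unfolding C1_on_def by blast
  show ?thesis
  proof (rule C1_onI[where g' = "\<lambda>x v. poly (pderiv q) (f x) * f' x v"])
    show "((\<lambda>x. poly q (f x)) has_derivative (\<lambda>v. poly (pderiv q) (f x) * f' x v)) (at x)" if "x \<in> S" for x
      by (rule has_derivative_compose[where f = f and g = "poly q"])
         (use * that poly_DERIV[of q "f x", unfolded has_field_derivative_def] in auto)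
  qed (use * C1_on_imp_continuous_on[OF assms] in \<open>auto intro!: continuous_intros\<close>)
qed

lemma has_derivative_inverse_norm:
  fixes x :: "'a::euclidean_space"
  assumes "x \<noteq> 0"
  shows "((\<lambda>x. inverse (norm x)) has_derivative (\<lambda>v. - (x \<bullet> v) * inverse (norm x) ^ 3)) (at x)"
proof -
  have "((\<lambda>x. inverse (norm x)) has_derivative (\<lambda>v. - (inverse (norm x) * (v \<bullet> sgn x) * inverse (norm x)))) (at x)"
    by (rule has_derivative_compose[where f = norm and g = inverse])
       (use assms in \<open>auto intro!: has_derivative_norm has_derivative_inverse'\<close>)
  moreover have "- (inverse (norm x) * (v \<bullet> sgn x) * inverse (norm x)) = - (x \<bullet> v) * inverse (norm x) ^ 3" for v
    by (simp add: sgn_div_norm inner_commute power3_eq_cube divide_inverse mult_ac)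
  ultimately show ?thesis by simp
qed

lemma C1_on_inverse_norm: "C1_on (- {0}) (\<lambda>x::'a::euclidean_space. inverse (norm x))"
proof (rule C1_onI)
  show "((\<lambda>x. inverse (norm x)) has_derivative (\<lambda>v. - (x \<bullet> v) * inverse (norm x) ^ 3)) (at x)"
    if "x \<in> - {0}" for x :: 'a
    using that by (intro has_derivative_inverse_norm) auto
qed (auto intro!: continuous_intros)

text \<open>The derivative at \<open>x\<close> in direction \<open>v\<close> of
  \<open>x \<bullet> y\<close> divided by \<open>norm x\<close>, the argument of a zonal function
  after extension constant along rays.\<close>

definition zonal_grad :: "'a::euclidean_space \<Rightarrow> 'a \<Rightarrow> 'a \<Rightarrow> real" where
  "zonal_grad y x v = (v \<bullet> y) * inverse (norm x) - (x \<bullet> y) * ((x \<bullet> v) * inverse (norm x) ^ 3)"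

lemma has_derivative_zonal:
  fixes x y :: "'a::euclidean_space"
  assumes "x \<noteq> 0"
  shows "((\<lambda>x. poly q ((x \<bullet> y) * inverse (norm x))) has_derivative
     (\<lambda>v. poly (pderiv q) ((x \<bullet> y) * inverse (norm x)) * zonal_grad y x v)) (at x)"
proof -
  have "((\<lambda>x. (x \<bullet> y) * inverse (norm x)) has_derivative
      (\<lambda>v. (x \<bullet> y) * (- (x \<bullet> v) * inverse (norm x) ^ 3) + (v \<bullet> y) * inverse (norm x))) (at x)"
    by (intro has_derivative_mult has_derivative_inverse_norm assms) (auto intro!: derivative_eq_intros)
  also have "(\<lambda>v. (x \<bullet> y) * (- (x \<bullet> v) * inverse (norm x) ^ 3) + (v \<bullet> y) * inverse (norm x)) = zonal_grad y x"
    by (auto simp: zonal_grad_def)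
  finally show ?thesis
    by (rule has_derivative_compose[where g = "poly q"])
       (rule poly_DERIV[of q "(x \<bullet> y) * inverse (norm x)", unfolded has_field_derivative_def])
qed

lemma has_real_derivativeI:
  fixes f :: "real \<Rightarrow> real"
  assumes "(f has_derivative f') (at x)" "\<And>h. f' h = D * h"
  shows "(f has_real_derivative D) (at x)"
  using assms unfolding has_field_derivative_def by (metis (no_types, lifting) ext)

lemma hom0_ext_zonal: "hom0_ext (\<lambda>x. poly q (x \<bullet> y)) = (\<lambda>x. poly q ((x \<bullet> y) * inverse (norm x)))"
  by (simp add: hom0_ext_def fun_eq_iff mult.commute)

lemma C2_on_zonal:
  fixes y :: "'a::euclidean_space"
  shows "C2_on (- {0}) (hom0_ext (\<lambda>x. poly q (x \<bullet> y)))"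
  unfolding C2_on_def hom0_ext_zonal
proof (intro exI conjI allI ballI)
  show "((\<lambda>x. poly q ((x \<bullet> y) * inverse (norm x))) has_derivative
     (\<lambda>v. poly (pderiv q) ((x \<bullet> y) * inverse (norm x)) * zonal_grad y x v)) (at x)" if "x \<in> - {0}" for x
    using that by (intro has_derivative_zonal) auto
  show "C1_on (- {0}) (\<lambda>x. poly (pderiv q) ((x \<bullet> y) * inverse (norm x)) * zonal_grad y x v)" for v
    unfolding zonal_grad_def power3_eq_cube
    by (intro C1_on_mult C1_on_poly C1_on_diff C1_on_inner C1_on_inverse_norm C1_on_const)
qed

text \<open>The second derivative of the extension is computed along each coordinate line. Summation
  over the basis uses only the expansions of \<open>x \<bullet> y\<close>,
  \<open>x \<bullet> x\<close> and \<open>y \<bullet> y\<close>, the last two being 1.\<close>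

lemma laplace_beltrami_zonal:
  fixes x y :: "'a::euclidean_space"
  assumes x: "norm x = 1" and y: "norm y = 1"
  shows "laplace_beltrami (\<lambda>x. poly q (x \<bullet> y)) x
     = (1 - (x \<bullet> y)\<^sup>2) * poly (pderiv (pderiv q)) (x \<bullet> y) - (real DIM('a) - 1) * (x \<bullet> y) * poly (pderiv q) (x \<bullet> y)"
proof -
  define T where "T = x \<bullet> y"
  define g where "g = (\<lambda>x::'a. poly q ((x \<bullet> y) * inverse (norm x)))"
  have second: "deriv (\<lambda>t. deriv (\<lambda>r. g (x + r *\<^sub>R b)) t) 0
     = poly (pderiv (pderiv q)) T * (b \<bullet> y - T * (x \<bullet> b))\<^sup>2
       + poly (pderiv q) T * (3 * T * (x \<bullet> b)\<^sup>2 - 2 * (b \<bullet> y) * (x \<bullet> b) - T)" if b: "b \<in> Basis" for b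
  proof -
    have x0: "x \<noteq> 0" using x by auto
    have line: "((\<lambda>t. x + t *\<^sub>R b) has_derivative (\<lambda>s. s *\<^sub>R b)) (at t)" for t
      by (auto intro!: derivative_eq_intros)
    have first: "((\<lambda>r. g (x + r *\<^sub>R b)) has_real_derivative
        poly (pderiv q) (((x + t *\<^sub>R b) \<bullet> y) * inverse (norm (x + t *\<^sub>R b))) * zonal_grad y (x + t *\<^sub>R b) b) (at t)"
      if "x + t *\<^sub>R b \<noteq> 0" for t
    proof -
      have "zonal_grad y z (s *\<^sub>R b) = zonal_grad y z b * s" for z s
        by (simp add: zonal_grad_def algebra_simps)
      then show ?thesis
        unfolding g_def
        by (intro has_real_derivativeI[OF has_derivative_compose[OF line has_derivative_zonal[OF that, of q y]]])
           (simp add: mult.assoc)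
    qed
    have "\<forall>\<^sub>F t in nhds 0. x + t *\<^sub>R b \<in> - {0}"
    proof -
      have "open ((\<lambda>t. x + t *\<^sub>R b) -` (- {0}))"
        by (intro continuous_open_vimage continuous_intros)
      from eventually_nhds_in_open[OF this, of 0] x0 show ?thesis by simp
    qed
    then have ev: "\<forall>\<^sub>F t in nhds 0. deriv (\<lambda>r. g (x + r *\<^sub>R b)) t
       = poly (pderiv q) (((x + t *\<^sub>R b) \<bullet> y) * inverse (norm (x + t *\<^sub>R b))) * zonal_grad y (x + t *\<^sub>R b) b"
      by eventually_elim (rule DERIV_imp_deriv[OF first], simp)
    define s where "s t = ((x + t *\<^sub>R b) \<bullet> y) * inverse (norm (x + t *\<^sub>R b))" for t
    have ds: "(s has_real_derivative b \<bullet> y - T * (x \<bullet> b)) (at 0)"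
    proof -
      have "zonal_grad y x (h *\<^sub>R b) = (b \<bullet> y - T * (x \<bullet> b)) * h" for h
        using x by (simp add: zonal_grad_def T_def algebra_simps)
      moreover have "x + 0 *\<^sub>R b \<noteq> 0" using x0 by simp
      \<comment> \<open>The identity polynomial specialises \<open>has_derivative_zonal\<close> to
        the normalised inner product itself.\<close>
      ultimately have "((\<lambda>r. poly [:0, 1:] (((x + r *\<^sub>R b) \<bullet> y) * inverse (norm (x + r *\<^sub>R b)))) has_real_derivative
           b \<bullet> y - T * (x \<bullet> b)) (at 0)"
        by (intro has_real_derivativeI[OF has_derivative_compose[OF line[of 0] has_derivative_zonal]])
           (simp_all add: pderiv_pCons)
      then show ?thesis unfolding s_def by simp
    qed
    have di: "((\<lambda>t. inverse (norm (x + t *\<^sub>R b))) has_real_derivative - (x \<bullet> b)) (at 0)"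
      by (rule has_real_derivativeI[OF has_derivative_compose[OF line[of 0] has_derivative_inverse_norm]])
         (use x0 x in simp_all)
    have dq: "((\<lambda>t. poly (pderiv q) (s t)) has_real_derivative poly (pderiv (pderiv q)) T * (b \<bullet> y - T * (x \<bullet> b))) (at 0)"
      using DERIV_chain2[OF poly_DERIV ds] x by (simp add: s_def T_def)
    have bb: "b \<bullet> b = 1" using b by simp
    have dz: "((\<lambda>t. zonal_grad y (x + t *\<^sub>R b) b) has_real_derivative
        3 * T * (x \<bullet> b)\<^sup>2 - 2 * (b \<bullet> y) * (x \<bullet> b) - T) (at 0)"
    proof -
      have e: "zonal_grad y (x + t *\<^sub>R b) b = (b \<bullet> y) * inverse (norm (x + t *\<^sub>R b))
          - (T + t * (b \<bullet> y)) * ((x \<bullet> b + t) * inverse (norm (x + t *\<^sub>R b)) ^ 3)" for t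
        by (simp add: zonal_grad_def inner_add_left bb T_def)
      show ?thesis unfolding e
        by (rule derivative_eq_intros di refl)+ (use x in \<open>simp add: power2_eq_square algebra_simps\<close>)
    qed
    have "((\<lambda>t. poly (pderiv q) (s t) * zonal_grad y (x + t *\<^sub>R b) b) has_real_derivative
       (poly (pderiv (pderiv q)) T * (b \<bullet> y - T * (x \<bullet> b))) * (b \<bullet> y - T * (x \<bullet> b))
       + (3 * T * (x \<bullet> b)\<^sup>2 - 2 * (b \<bullet> y) * (x \<bullet> b) - T) * poly (pderiv q) T) (at 0)"
      using DERIV_mult[OF dq dz] x by (simp add: s_def T_def zonal_grad_def)
    then have "deriv (\<lambda>t. poly (pderiv q) (s t) * zonal_grad y (x + t *\<^sub>R b) b) 0
       = (poly (pderiv (pderiv q)) T * (b \<bullet> y - T * (x \<bullet> b))) * (b \<bullet> y - T * (x \<bullet> b))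
       + (3 * T * (x \<bullet> b)\<^sup>2 - 2 * (b \<bullet> y) * (x \<bullet> b) - T) * poly (pderiv q) T"
      by (rule DERIV_imp_deriv)
    with deriv_cong_ev[OF ev refl] show ?thesis
      unfolding s_def by (simp add: power2_eq_square mult_ac)
  qed
  have sxy: "(\<Sum>b\<in>Basis. (b \<bullet> y) * (x \<bullet> b)) = T"
    unfolding T_def by (subst euclidean_inner) (simp add: inner_commute mult.commute)
  have sxx: "(\<Sum>b\<in>Basis. (x \<bullet> b)\<^sup>2) = 1"
    using x by (simp add: norm_eq_1 euclidean_inner[of x x] power2_eq_square)
  have syy: "(\<Sum>b\<in>Basis. (b \<bullet> y)\<^sup>2) = 1"
    using y by (simp add: norm_eq_1 euclidean_inner[of y y] power2_eq_square inner_commute)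
  have "laplace_beltrami (\<lambda>x. poly q (x \<bullet> y)) x = (\<Sum>b\<in>Basis. deriv (\<lambda>t. deriv (\<lambda>r. g (x + r *\<^sub>R b)) t) 0)"
    unfolding laplace_beltrami_def eucl_laplacian_def hom0_ext_zonal g_def ..
  also have "\<dots> = (\<Sum>b\<in>Basis. poly (pderiv (pderiv q)) T * ((b \<bullet> y)\<^sup>2 - 2 * T * ((b \<bullet> y) * (x \<bullet> b)) + T\<^sup>2 * (x \<bullet> b)\<^sup>2)
       + poly (pderiv q) T * (3 * T * (x \<bullet> b)\<^sup>2 - 2 * ((b \<bullet> y) * (x \<bullet> b)) - T))"
    by (intro sum.cong refl) (simp add: second power2_eq_square algebra_simps)
  also have "\<dots> = poly (pderiv (pderiv q)) T * (1 - 2 * T * T + T\<^sup>2)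
       + poly (pderiv q) T * (3 * T - 2 * T - real DIM('a) * T)"
    by (simp add: sum.distrib sum_subtractf sum_distrib_left[symmetric] sxy sxx syy)
  finally show ?thesis by (simp add: T_def power2_eq_square algebra_simps)
qed

lemma sph_eigenfun_gegenbauer:
  fixes y :: "'a::euclidean_space"
  assumes y: "norm y = 1" and nu: "2 * \<nu> = real DIM('a) - 2"
  shows "sph_eigenfun (real l * (real l + 2 * \<nu>)) (\<lambda>x. poly (gegenbauer \<nu> l) (x \<bullet> y))"
  unfolding sph_eigenfun_def
proof (intro conjI ballI C2_on_zonal)
  fix x :: 'a assume "x \<in> sphere 0 1"
  then have x: "norm x = 1" by simp
  have e: "2 * \<nu> + 1 = real DIM('a) - 1" using nu by simp
  show "- laplace_beltrami (\<lambda>x. poly (gegenbauer \<nu> l) (x \<bullet> y)) x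
      = real l * (real l + 2 * \<nu>) * poly (gegenbauer \<nu> l) (x \<bullet> y)"
    using gegenbauer_ode[of "x \<bullet> y" \<nu> l] unfolding laplace_beltrami_zonal[OF x y] e by linarith
qed

section \<open>The Riesz potential representation\<close>

lemma continuous_sphere_bounded:
  fixes g :: "'a::euclidean_space \<Rightarrow> real"
  assumes "continuous_on (sphere 0 1) g"
  obtains B where "0 < B" "\<And>x. norm x = 1 \<Longrightarrow> \<bar>g x\<bar> \<le> B"
proof -
  have "compact (g ` sphere 0 1)" using assms by (intro compact_continuous_image) auto
  then have "bounded (g ` sphere 0 1)" by (rule compact_imp_bounded)
  then obtain B where "\<forall>z\<in>g ` sphere 0 1. norm z \<le> B" unfolding bounded_iff by blast
  then show ?thesis by (intro that[of "max B 1"]) (auto simp: le_max_iff_disj)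
qed

lemma integrable_sphereI:
  fixes g :: "'a::euclidean_space \<Rightarrow> real"
  assumes "continuous_on (sphere 0 1) g"
  shows "integrable sphere_measure g"
proof -
  obtain B where "\<And>x. norm x = 1 \<Longrightarrow> \<bar>g x\<bar> \<le> B" using continuous_sphere_bounded[OF assms] by blast
  then show ?thesis
    by (intro sphere_measure.integrable_const_bound[where B = B] borel_measurable_sphereI[OF assms]) auto
qed

text \<open>Both sides integrate over the ball, but \<open>sphere_integral\<close> is a gauge
  integral that includes the origin, where the normalised vector leaves the sphere. That point is
  negligible, and continuity supplies the absolute integrability under which the two integrals
  agree.\<close>

lemma sphere_integral_eq:
  fixes g :: "'a::euclidean_space \<Rightarrow> real"
  assumes g: "continuous_on (sphere 0 1) g"
  shows "sphere_integral g = real DIM('a) * (LINT x|sphere_measure. g x)"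
proof -
  let ?S = "ball 0 1 - {0::'a}"
  have gm: "g \<in> borel_measurable (restrict_space borel (sphere 0 1))"
    using borel_measurable_continuous_on_restrict[OF g] .
  have meas: "?S \<inter> space lborel \<in> sets lborel" by simp
  have "integrable (distr (restrict_space lborel ?S) (restrict_space borel (sphere 0 1)) (\<lambda>x. x /\<^sub>R norm x)) g"
    using integrable_sphereI[OF g] unfolding sphere_measure_def .
  then have "integrable (restrict_space lborel ?S) (\<lambda>x. g (x /\<^sub>R norm x))"
    by (subst (asm) integrable_distr_eq[OF measurable_normalize gm])
  then have int: "set_integrable lborel ?S (\<lambda>x. g (x /\<^sub>R norm x))"
    by (subst (asm) integrable_restrict_space[OF meas]) (simp add: set_integrable_def)
  have "(LINT x|sphere_measure. g x) = (LINT x|restrict_space lborel ?S. g (x /\<^sub>R norm x))"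
    unfolding sphere_measure_def by (rule integral_distr[OF measurable_normalize gm])
  also have "\<dots> = (LINT x:?S|lborel. g (x /\<^sub>R norm x))"
    by (subst integral_restrict_space[OF meas]) (simp add: set_lebesgue_integral_def)
  also have "\<dots> = integral ?S (\<lambda>x. g (x /\<^sub>R norm x))"
    by (rule set_borel_integral_eq_integral(2)[OF int])
  also have "\<dots> = integral (ball 0 1) (\<lambda>x. g (x /\<^sub>R norm x))"
    by (rule integral_spike_set) (auto intro: negligible_subset[of "{0}"])
  finally show ?thesis by (simp add: sphere_integral_def)
qed

text \<open>On the diagonal \<open>riesz \<alpha> x x = 0\<close>, because \<open>0 powr a = 0\<close>; the diagonal is a null set.\<close>

definition riesz :: "real \<Rightarrow> 'a::euclidean_space \<Rightarrow> 'a \<Rightarrow> real" where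
  "riesz \<alpha> x y = ((norm (x - y))\<^sup>2) powr (- \<alpha>)"

lemma riesz_nonneg: "0 \<le> riesz \<alpha> x y"
  by (simp add: riesz_def)

lemma riesz_measurable [measurable]: "(\<lambda>x. riesz \<alpha> x y) \<in> borel_measurable sphere_measure"
  unfolding riesz_def by (intro borel_measurable_sphere_restrictI) measurable

text \<open>\<open>y\<close> is a fixed pole. With \<open>n = DIM('a) - 1\<close> the last
  assumption encodes \<open>\<nu> = (n - 1) / 2\<close> and
  \<open>\<alpha> = n / 2 - s\<close>.\<close>

locale poisson_setting =
  fixes y :: "'a::euclidean_space" and \<nu> s \<alpha> :: real
  assumes y: "norm y = 1" and nu: "2 * \<nu> = real DIM('a) - 2" and \<nu>: "0 < \<nu>"
    and \<alpha>: "0 < \<alpha>" and s: "0 < s" and eq: "\<alpha> + s = \<nu> + 1 / 2"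
begin

text \<open>The value at the pole \<open>y\<close> of the degree-\<open>l\<close> harmonic component
  of \<open>F\<close>, up to a factor that depends on neither \<open>F\<close> nor
  \<open>l\<close>.\<close>

definition zcoeff :: "('a \<Rightarrow> real) \<Rightarrow> nat \<Rightarrow> real" where
  "zcoeff F l = (LINT x|sphere_measure. F x * ((real l + \<nu>) / \<nu> * poly (gegenbauer \<nu> l) (x \<bullet> y)))"

definition poisson_int :: "('a \<Rightarrow> real) \<Rightarrow> real \<Rightarrow> real" where
  "poisson_int F r = (LINT x|sphere_measure. poisson_kernel \<nu> r (x \<bullet> y) * F x)"

lemma zcoeff_bound:
  assumes F: "continuous_on (sphere 0 1) F"
  shows "\<exists>B. \<forall>l. (LINT x|sphere_measure. norm (F x * ((real l + \<nu>) / \<nu> * poly (gegenbauer \<nu> l) (x \<bullet> y))))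
     \<le> B * ((real l + \<nu>) / \<nu> * gegenbauer_bound \<nu> l)"
proof (intro exI allI)
  fix l
  have "(LINT x|sphere_measure. norm (F x * ((real l + \<nu>) / \<nu> * poly (gegenbauer \<nu> l) (x \<bullet> y))))
      \<le> (LINT x|sphere_measure. \<bar>F x\<bar> * ((real l + \<nu>) / \<nu> * gegenbauer_bound \<nu> l))"
  proof (rule integral_mono)
    show "integrable sphere_measure (\<lambda>x. norm (F x * ((real l + \<nu>) / \<nu> * poly (gegenbauer \<nu> l) (x \<bullet> y))))"
      by (intro integrable_sphereI continuous_intros F)
    show "integrable sphere_measure (\<lambda>x. \<bar>F x\<bar> * ((real l + \<nu>) / \<nu> * gegenbauer_bound \<nu> l))"
      by (intro integrable_sphereI continuous_intros F)
    fix x :: 'a assume "x \<in> space sphere_measure"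
    then have "\<bar>poly (gegenbauer \<nu> l) (x \<bullet> y)\<bar> \<le> gegenbauer_bound \<nu> l"
      using y by (intro gegenbauer_abs_le \<nu> abs_inner_unit_le) auto
    then show "norm (F x * ((real l + \<nu>) / \<nu> * poly (gegenbauer \<nu> l) (x \<bullet> y))) \<le> \<bar>F x\<bar> * ((real l + \<nu>) / \<nu> * gegenbauer_bound \<nu> l)"
      using \<nu> by (auto simp: abs_mult intro!: mult_left_mono divide_right_mono)
  qed
  then show "(LINT x|sphere_measure. norm (F x * ((real l + \<nu>) / \<nu> * poly (gegenbauer \<nu> l) (x \<bullet> y))))
      \<le> (LINT x|sphere_measure. \<bar>F x\<bar>) * ((real l + \<nu>) / \<nu> * gegenbauer_bound \<nu> l)"
    by simp
qed

lemma zcoeff_summable_norm: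
  assumes F: "continuous_on (sphere 0 1) F" and r: "0 \<le> r" "r < 1"
  shows "summable (\<lambda>l. (LINT x|sphere_measure. norm (F x * ((real l + \<nu>) / \<nu> * poly (gegenbauer \<nu> l) (x \<bullet> y)))) * r ^ l)"
proof -
  obtain B where B: "\<And>l. (LINT x|sphere_measure. norm (F x * ((real l + \<nu>) / \<nu> * poly (gegenbauer \<nu> l) (x \<bullet> y))))
     \<le> B * ((real l + \<nu>) / \<nu> * gegenbauer_bound \<nu> l)" using zcoeff_bound[OF F] by blast
  show ?thesis
  proof (rule summable_comparison_test)
    show "summable (\<lambda>l. B * ((real l + \<nu>) / \<nu> * gegenbauer_bound \<nu> l * r ^ l))"
      by (intro summable_mult summable_weighted_gegenbauer_bound \<nu> r)
    show "\<exists>N. \<forall>l\<ge>N. norm ((LINT x|sphere_measure. norm (F x * ((real l + \<nu>) / \<nu> * poly (gegenbauer \<nu> l) (x \<bullet> y)))) * r ^ l)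
       \<le> B * ((real l + \<nu>) / \<nu> * gegenbauer_bound \<nu> l * r ^ l)"
    proof (intro exI allI impI)
      fix l
      have "norm ((LINT x|sphere_measure. norm (F x * ((real l + \<nu>) / \<nu> * poly (gegenbauer \<nu> l) (x \<bullet> y)))) * r ^ l)
         = (LINT x|sphere_measure. norm (F x * ((real l + \<nu>) / \<nu> * poly (gegenbauer \<nu> l) (x \<bullet> y)))) * r ^ l"
        using r unfolding real_norm_def by (intro abs_of_nonneg mult_nonneg_nonneg integral_nonneg) auto
      also have "\<dots> \<le> B * ((real l + \<nu>) / \<nu> * gegenbauer_bound \<nu> l) * r ^ l"
        using r by (intro mult_right_mono B) auto
      finally show "norm ((LINT x|sphere_measure. norm (F x * ((real l + \<nu>) / \<nu> * poly (gegenbauer \<nu> l) (x \<bullet> y)))) * r ^ l)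
       \<le> B * ((real l + \<nu>) / \<nu> * gegenbauer_bound \<nu> l * r ^ l)" by (simp only: mult.assoc)
    qed
  qed
qed

lemma zcoeff_summable:
  assumes F: "continuous_on (sphere 0 1) F" and r: "0 \<le> r" "r < 1"
  shows "summable (\<lambda>l. norm (zcoeff F l * r ^ l))"
proof (rule summable_comparison_test[OF _ zcoeff_summable_norm[OF F r]])
  show "\<exists>N. \<forall>l\<ge>N. norm (norm (zcoeff F l * r ^ l))
     \<le> (LINT x|sphere_measure. norm (F x * ((real l + \<nu>) / \<nu> * poly (gegenbauer \<nu> l) (x \<bullet> y)))) * r ^ l"
  proof (intro exI allI impI)
    fix l
    have "norm (norm (zcoeff F l * r ^ l)) = norm (zcoeff F l) * r ^ l" using r by (simp add: abs_mult)
    also have "\<dots> \<le> (LINT x|sphere_measure. norm (F x * ((real l + \<nu>) / \<nu> * poly (gegenbauer \<nu> l) (x \<bullet> y)))) * r ^ l"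
      unfolding zcoeff_def using r by (intro mult_right_mono integral_norm_bound) auto
    finally show "norm (norm (zcoeff F l * r ^ l))
     \<le> (LINT x|sphere_measure. norm (F x * ((real l + \<nu>) / \<nu> * poly (gegenbauer \<nu> l) (x \<bullet> y)))) * r ^ l" .
  qed
qed

lemma zcoeff_sums:
  assumes F: "continuous_on (sphere 0 1) F" and r: "0 \<le> r" "r < 1"
  shows "(\<lambda>l. zcoeff F l * r ^ l) sums poisson_int F r"
proof -
  define f where "f l x = F x * ((real l + \<nu>) / \<nu> * poly (gegenbauer \<nu> l) (x \<bullet> y)) * r ^ l" for l and x :: 'a
  have fx: "(\<lambda>l. f l x) sums (poisson_kernel \<nu> r (x \<bullet> y) * F x)" if "norm x = 1" for x
    using sums_mult2[OF poisson_kernel_sums[OF \<nu> abs_inner_unit_le[OF that y] r], of "F x"]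
    unfolding f_def by (simp add: mult_ac)
  have "(\<lambda>l. LINT x|sphere_measure. f l x) sums (LINT x|sphere_measure. (\<Sum>l. f l x))"
  proof (rule sums_integral)
    show "integrable sphere_measure (f l)" for l
      unfolding f_def by (intro integrable_sphereI continuous_intros F)
    show "AE x in sphere_measure. summable (\<lambda>l. norm (f l x))"
    proof (rule AE_I2)
      fix x :: 'a assume "x \<in> space sphere_measure"
      then have x: "norm x = 1" by simp
      show "summable (\<lambda>l. norm (f l x))"
      proof (rule summable_comparison_test)
        show "summable (\<lambda>l. \<bar>F x\<bar> * ((real l + \<nu>) / \<nu> * gegenbauer_bound \<nu> l * r ^ l))"
          by (intro summable_mult summable_weighted_gegenbauer_bound \<nu> r)
        show "\<exists>N. \<forall>l\<ge>N. norm (norm (f l x)) \<le> \<bar>F x\<bar> * ((real l + \<nu>) / \<nu> * gegenbauer_bound \<nu> l * r ^ l)"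
          using gegenbauer_abs_le[OF \<nu> abs_inner_unit_le[OF x y]] \<nu> r
          unfolding f_def by (auto simp: abs_mult mult.assoc intro!: mult_left_mono mult_right_mono divide_right_mono)
      qed
    qed
    have "(\<lambda>l. LINT x|sphere_measure. norm (f l x)) = (\<lambda>l. (LINT x|sphere_measure. norm (F x * ((real l + \<nu>) / \<nu> * poly (gegenbauer \<nu> l) (x \<bullet> y)))) * r ^ l)"
      unfolding f_def norm_mult[of _ "r ^ _"] using r by simp
    then show "summable (\<lambda>l. LINT x|sphere_measure. norm (f l x))"
      using zcoeff_summable_norm[OF F r] by simp
  qed
  moreover have "(LINT x|sphere_measure. f l x) = zcoeff F l * r ^ l" for l
    unfolding f_def zcoeff_def by simp
  moreover have "(LINT x|sphere_measure. (\<Sum>l. f l x)) = poisson_int F r"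
    unfolding poisson_int_def using fx by (intro Bochner_Integration.integral_cong) (auto simp: sums_iff)
  ultimately show ?thesis by simp
qed

text \<open>As a function of the radius the Poisson integral is a power series, hence continuous
  inside the unit disc.\<close>

lemma poisson_int_tendsto:
  assumes F: "continuous_on (sphere 0 1) F" and r: "0 < r" "r < 1"
    and R: "\<And>k. 0 < R k" "\<And>k. R k < 1" "R \<longlonglongrightarrow> 1"
  shows "(\<lambda>k. poisson_int F (r * R k)) \<longlonglongrightarrow> poisson_int F r"
proof -
  define K where "K = (1 + r) / 2"
  have K: "0 \<le> K" "K < 1" "norm r < norm K" using r by (auto simp: K_def)
  have "isCont (\<lambda>x. \<Sum>l. zcoeff F l * x ^ l) r"
    using summable_norm_cancel[OF zcoeff_summable[OF F K(1,2)]] K(3) by (rule isCont_powser)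
  moreover have "(\<lambda>k. r * R k) \<longlonglongrightarrow> r" using tendsto_mult[OF tendsto_const R(3), of r] by simp
  ultimately have "(\<lambda>k. \<Sum>l. zcoeff F l * (r * R k) ^ l) \<longlonglongrightarrow> (\<Sum>l. zcoeff F l * r ^ l)"
    by (rule isCont_tendsto_compose)
  moreover have "(\<Sum>l. zcoeff F l * (r * R k) ^ l) = poisson_int F (r * R k)" for k
    using zcoeff_sums[OF F, of "r * R k"] R(1)[of k] R(2)[of k] r
    by (simp add: sums_iff) (metis less_eq_real_def mult_less_le_imp_less mult_1_left mult_pos_pos sums_iff)
  moreover have "(\<Sum>l. zcoeff F l * r ^ l) = poisson_int F r"
    using zcoeff_sums[OF F, of r] r by (simp add: sums_iff)
  ultimately show ?thesis by simp
qed

end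

text \<open>The cone over a point lies in a line, which is null in dimension at least 2.\<close>

lemma sphere_measure_singleton_null:
  fixes y :: "'a::euclidean_space"
  assumes dim: "2 \<le> DIM('a)"
  shows "AE x in sphere_measure. x \<noteq> y"
proof (cases "y \<in> sphere 0 1")
  case True
  have m: "{y} \<in> sets sphere_measure" using True by (auto simp: sets_restrict_space)
  have "dim (span {y}) < DIM('a)" using dim True by (auto simp: dim_insert)
  then have "span {y} \<in> null_sets lborel"
    by (metis negligible_lowdim negligible_iff_null_sets null_sets_completion_iff
          sets_lborel borel_closed closed_span)
  then have null: "AE x in lborel. x \<notin> span {y}" by (rule AE_not_in)
  have "emeasure sphere_measure {y} = (\<integral>\<^sup>+x. indicator {y} x \<partial>sphere_measure)"
    using m by simp
  also have "\<dots> = (\<integral>\<^sup>+x. indicator {y} (x /\<^sub>R norm x) * indicator (ball 0 1 - {0}) x \<partial>lborel)"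
    using m by (intro nn_integral_sphere_measure) simp
  also have "\<dots> = (\<integral>\<^sup>+x. 0 \<partial>(lborel :: 'a measure))"
  proof (rule nn_integral_cong_AE)
    show "AE x in lborel. indicator {y} (x /\<^sub>R norm x) * indicator (ball 0 1 - {0}) x = (0::ennreal)"
      using null
    proof eventually_elim
      case (elim x)
      have "x /\<^sub>R norm x \<noteq> y" if "x \<noteq> 0"
      proof
        assume "x /\<^sub>R norm x = y"
        then have "x = norm x *\<^sub>R y" using that by auto
        then show False using elim by (metis span_base span_scale insertI1)
      qed
      then show ?case by (auto simp: indicator_def)
    qed
  qed
  finally have "{y} \<in> null_sets sphere_measure" using m by (auto simp: null_sets_def)
  then have "AE x in sphere_measure. x \<notin> {y}" by (rule AE_not_in)
  then show ?thesis by simp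
next
  case False
  then show ?thesis by (intro AE_I2) auto
qed

section \<open>Weighted radial averages of Poisson integrals\<close>

context poisson_setting
begin

lemma poisson_int_bound:
  obtains M where "0 < M" "\<And>F B r. continuous_on (sphere 0 1) F \<Longrightarrow> (\<And>x. norm x = 1 \<Longrightarrow> \<bar>F x\<bar> \<le> B) \<Longrightarrow>
     0 \<le> r \<Longrightarrow> r < 1 \<Longrightarrow> \<bar>poisson_int F r\<bar> \<le> M * B"
proof -
  obtain M where M: "0 < M" "\<And>y::'a. \<And>r. norm y = 1 \<Longrightarrow> 0 \<le> r \<Longrightarrow> r < 1 \<Longrightarrow>
     (\<integral>\<^sup>+x. ennreal (poisson_kernel \<nu> r (x \<bullet> y)) \<partial>sphere_measure) \<le> ennreal M"
    using poisson_mass_bounded[OF nu] by blast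
  have "\<bar>poisson_int F r\<bar> \<le> M * B"
    if F: "continuous_on (sphere 0 1) F" and B: "\<And>x. norm x = 1 \<Longrightarrow> \<bar>F x\<bar> \<le> B" and r: "0 \<le> r" "r < 1" for F B r
  proof -
    have cP: "continuous_on (sphere 0 1) (\<lambda>x. poisson_kernel \<nu> r (x \<bullet> y))"
      by (rule continuous_on_poisson_kernel[OF y r])
    have nP: "0 \<le> poisson_kernel \<nu> r t" for t using r by (intro poisson_kernel_nonneg) auto
    have B0: "0 \<le> B" using B[OF y] by linarith
    have "ennreal (LINT x|sphere_measure. poisson_kernel \<nu> r (x \<bullet> y)) \<le> ennreal M"
      using M(2)[OF y r] nP integrable_sphereI[OF cP] by (subst nn_integral_eq_integral[symmetric]) auto
    then have PM: "(LINT x|sphere_measure. poisson_kernel \<nu> r (x \<bullet> y)) \<le> M"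
      using M(1) by (subst (asm) ennreal_le_iff) auto
    have "\<bar>poisson_int F r\<bar> \<le> (LINT x|sphere_measure. norm (poisson_kernel \<nu> r (x \<bullet> y) * F x))"
      unfolding poisson_int_def using integral_norm_bound by (metis real_norm_def)
    also have "\<dots> \<le> (LINT x|sphere_measure. poisson_kernel \<nu> r (x \<bullet> y) * B)"
    proof (rule integral_mono)
      show "integrable sphere_measure (\<lambda>x. norm (poisson_kernel \<nu> r (x \<bullet> y) * F x))"
        by (intro integrable_sphereI continuous_intros cP F)
      show "integrable sphere_measure (\<lambda>x. poisson_kernel \<nu> r (x \<bullet> y) * B)"
        by (intro integrable_sphereI continuous_intros cP)
      show "norm (poisson_kernel \<nu> r (x \<bullet> y) * F x) \<le> poisson_kernel \<nu> r (x \<bullet> y) * B"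
        if "x \<in> space sphere_measure" for x
        using nP B[of x] that by (auto simp: abs_mult intro!: mult_left_mono)
    qed
    also have "\<dots> = (LINT x|sphere_measure. poisson_kernel \<nu> r (x \<bullet> y)) * B" by simp
    also have "\<dots> \<le> M * B" using PM B0 by (intro mult_right_mono)
    finally show ?thesis .
  qed
  with M(1) show ?thesis using that by blast
qed

definition weight :: "real \<Rightarrow> real" where
  "weight r = r powr (\<alpha> - 1) * (1 - r) powr (2 * s - 1) * indicator {0..1} r"

lemma weight_nonneg: "0 \<le> weight r"
  by (simp add: weight_def)

text \<open>The endpoints are included because \<open>0 powr a = 0\<close>. Hence the later case
  distinctions on the open interval are exhaustive.\<close>

lemma weight_eq_0: "\<not> (0 < r \<and> r < 1) \<Longrightarrow> weight r = 0"
  by (auto simp: weight_def indicator_def)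

lemma weight_measurable [measurable]: "weight \<in> borel_measurable borel"
proof -
  have [measurable]: "{0..1} \<in> sets (borel :: real measure)" by simp
  show ?thesis unfolding weight_def by measurable
qed

lemma weight_moment: "has_bochner_integral lborel (\<lambda>r. weight r * r ^ l) (Beta (\<alpha> + real l) (2 * s))"
proof (rule has_bochner_integral_nn_integral)
  show "(\<lambda>r. weight r * r ^ l) \<in> borel_measurable lborel" by measurable
  show "AE r in lborel. 0 \<le> weight r * r ^ l"
    by (rule AE_I2) (auto simp: weight_def indicator_def)
  show "0 \<le> Beta (\<alpha> + real l) (2 * s)"
    using \<alpha> s by (simp add: Beta_def Gamma_real_pos less_imp_le)
  have "weight r * r ^ l = r powr ((\<alpha> + real l) - 1) * (1 - r) powr (2 * s - 1) * indicator {0..1} r" for r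
  proof (cases "0 < r")
    case True
    then have "r powr ((\<alpha> + real l) - 1) = r powr (\<alpha> - 1) * r ^ l"
    proof -
      have "(\<alpha> + real l) - 1 = (\<alpha> - 1) + real l" by simp
      then show ?thesis using True by (simp only: powr_add) (simp add: powr_realpow)
    qed
    then show ?thesis by (simp add: weight_def)
  next
    case False
    then show ?thesis by (cases "r = 0") (auto simp: weight_def indicator_def)
  qed
  then show "(\<integral>\<^sup>+r. ennreal (weight r * r ^ l) \<partial>lborel) = ennreal (Beta (\<alpha> + real l) (2 * s))"
    using nn_integral_Beta[of "\<alpha> + real l" "2 * s"] \<alpha> s by simp
qed

lemma weight_integrable: "integrable lborel weight"
  using weight_moment[of 0] by (simp add: has_bochner_integral_iff)

lemma weight_poisson_measurable:
  assumes F: "continuous_on (sphere 0 1) F" and R: "0 < R" "R \<le> 1"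
  shows "(\<lambda>r. weight r * poisson_int F (r * R)) \<in> borel_measurable borel"
proof -
  have "(\<lambda>r. weight r * (\<Sum>l. zcoeff F l * (r * R) ^ l)) \<in> borel_measurable borel"
    by measurable
  also have "(\<lambda>r. weight r * (\<Sum>l. zcoeff F l * (r * R) ^ l)) = (\<lambda>r. weight r * poisson_int F (r * R))"
  proof
    fix r
    show "weight r * (\<Sum>l. zcoeff F l * (r * R) ^ l) = weight r * poisson_int F (r * R)"
    proof (cases "0 < r \<and> r < 1")
      case True
      then have "0 \<le> r * R" "r * R < 1" using R by (auto intro: mult_less_le_imp_less[of r 1 R 1, simplified])
      from zcoeff_sums[OF F this] show ?thesis by (simp add: sums_iff)
    qed (simp add: weight_eq_0)
  qed
  finally show ?thesis .
qed

text \<open>The assumption \<open>rel\<close> states coefficientwise that \<open>P_s\<close> maps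
  \<open>u\<close> to \<open>F\<close>, since the Beta moments are \<open>Gamma (2 * s)\<close> over
  the multiplier. The damping factor \<open>R < 1\<close> gives the absolute convergence needed to
  integrate the expansion of \<open>F\<close> against the weight term by term.\<close>

lemma abel_identity:
  assumes F: "continuous_on (sphere 0 1) F" and u: "continuous_on (sphere 0 1) u"
    and rel: "\<And>l. zcoeff F l * Beta (\<alpha> + real l) (2 * s) = Gamma (2 * s) * zcoeff u l"
    and R: "0 < R" "R < 1"
  shows "(LINT r|lborel. weight r * poisson_int F (r * R)) = Gamma (2 * s) * poisson_int u R"
proof -
  define f where "f l r = weight r * r ^ l * (zcoeff F l * R ^ l)" for l r
  have int: "integrable lborel (f l)" and val: "(LINT r|lborel. f l r) = Gamma (2 * s) * (zcoeff u l * R ^ l)" for l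
  proof -
    from has_bochner_integral_mult_left[OF weight_moment[of l], of "zcoeff F l * R ^ l"]
    have "has_bochner_integral lborel (f l) (Beta (\<alpha> + real l) (2 * s) * (zcoeff F l * R ^ l))"
      unfolding f_def by simp
    then show "integrable lborel (f l)" "(LINT r|lborel. f l r) = Gamma (2 * s) * (zcoeff u l * R ^ l)"
      using rel[of l] by (auto simp: has_bochner_integral_iff mult_ac)
  qed
  \<comment> \<open>The integrated norms are a multiple of the terms of the Abel series of
    \<open>u\<close>, so their summability is inherited from \<open>u\<close> without any
    asymptotics of Beta.\<close>
  have norms: "(LINT r|lborel. norm (f l r)) = Gamma (2 * s) * norm (zcoeff u l * R ^ l)" for l
  proof -
    have "norm (f l r) = weight r * r ^ l * norm (zcoeff F l * R ^ l)" for r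
      by (cases "0 < r \<and> r < 1") (simp_all add: f_def abs_mult weight_nonneg weight_eq_0 power_abs)
    then have "(LINT r|lborel. norm (f l r)) = Beta (\<alpha> + real l) (2 * s) * norm (zcoeff F l * R ^ l)"
      using weight_moment[of l] by (simp add: has_bochner_integral_iff)
    also have "\<dots> = norm (zcoeff F l * Beta (\<alpha> + real l) (2 * s) * R ^ l)"
      using \<alpha> s by (simp add: Beta_def Gamma_real_pos abs_mult)
    also have "\<dots> = Gamma (2 * s) * norm (zcoeff u l * R ^ l)"
      unfolding rel using s by (simp add: abs_mult Gamma_real_pos)
    finally show ?thesis .
  qed
  have pt: "(\<lambda>l. f l r) sums (weight r * poisson_int F (r * R))" and ps: "summable (\<lambda>l. norm (f l r))" for r
  proof -
    have *: "(\<lambda>l. f l r) sums (weight r * poisson_int F (r * R)) \<and> summable (\<lambda>l. norm (f l r))"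
    proof (cases "0 < r \<and> r < 1")
      case True
      then have rR: "0 \<le> r * R" "r * R < 1" using R by (auto intro: mult_less_le_imp_less[of r 1 R 1, simplified])
      have e: "f l r = weight r * (zcoeff F l * (r * R) ^ l)" for l
        by (simp add: f_def power_mult_distrib mult_ac)
      show ?thesis unfolding e norm_mult[of "weight r"]
        by (intro conjI sums_mult zcoeff_sums summable_mult zcoeff_summable F rR)
    qed (simp add: f_def weight_eq_0)
    show "(\<lambda>l. f l r) sums (weight r * poisson_int F (r * R))" "summable (\<lambda>l. norm (f l r))"
      using * by auto
  qed
  have "(\<lambda>l. LINT r|lborel. f l r) sums (LINT r|lborel. (\<Sum>l. f l r))"
  proof (rule sums_integral[OF int])
    show "AE r in lborel. summable (\<lambda>l. norm (f l r))" using ps by simp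
    show "summable (\<lambda>l. LINT r|lborel. norm (f l r))"
      unfolding norms using R by (intro summable_mult zcoeff_summable u) auto
  qed
  then have "(\<lambda>l. Gamma (2 * s) * (zcoeff u l * R ^ l)) sums (LINT r|lborel. weight r * poisson_int F (r * R))"
    unfolding val using pt by (simp add: sums_iff)
  moreover have "(\<lambda>l. Gamma (2 * s) * (zcoeff u l * R ^ l)) sums (Gamma (2 * s) * poisson_int u R)"
    using R by (intro sums_mult zcoeff_sums u) auto
  ultimately show ?thesis by (rule sums_unique2)
qed

text \<open>Removes the damping of \<open>abel_identity\<close>. The uniform mass bound makes all
  Poisson integrals of \<open>F\<close> bounded by one constant, so a multiple of the weight
  dominates.\<close>

lemma abel_limit:
  assumes F: "continuous_on (sphere 0 1) F"
    and R: "\<And>k. 0 < R k" "\<And>k. R k < 1" "R \<longlonglongrightarrow> 1"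
  shows "(\<lambda>k. LINT r|lborel. weight r * poisson_int F (r * R k)) \<longlonglongrightarrow> (LINT r|lborel. weight r * poisson_int F r)"
    and "integrable lborel (\<lambda>r. weight r * poisson_int F r)"
proof -
  obtain M where M: "0 < M" "\<And>F B r. continuous_on (sphere 0 1) F \<Longrightarrow> (\<And>x. norm x = 1 \<Longrightarrow> \<bar>F x\<bar> \<le> B) \<Longrightarrow>
     0 \<le> r \<Longrightarrow> r < 1 \<Longrightarrow> \<bar>poisson_int F r\<bar> \<le> M * B"
    using poisson_int_bound by blast
  obtain B where B: "0 < B" "\<And>x. norm x = 1 \<Longrightarrow> \<bar>F x\<bar> \<le> B" using continuous_sphere_bounded[OF F] by blast
  have m1: "(\<lambda>r. weight r * poisson_int F r) \<in> borel_measurable lborel"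
    using weight_poisson_measurable[OF F, of 1] by simp
  have m2: "(\<lambda>r. weight r * poisson_int F (r * R k)) \<in> borel_measurable lborel" for k
    using weight_poisson_measurable[OF F, of "R k"] R(1,2)[of k] by simp
  have lim: "AE r in lborel. (\<lambda>k. weight r * poisson_int F (r * R k)) \<longlonglongrightarrow> weight r * poisson_int F r"
  proof (rule AE_I2)
    fix r :: real
    show "(\<lambda>k. weight r * poisson_int F (r * R k)) \<longlonglongrightarrow> weight r * poisson_int F r"
    proof (cases "0 < r \<and> r < 1")
      case True
      then show ?thesis by (intro tendsto_mult_left poisson_int_tendsto F R) auto
    qed (simp add: weight_eq_0)
  qed
  have bd: "AE r in lborel. norm (weight r * poisson_int F (r * R k)) \<le> weight r * (M * B)" for k
  proof (rule AE_I2)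
    fix r :: real
    show "norm (weight r * poisson_int F (r * R k)) \<le> weight r * (M * B)"
    proof (cases "0 < r \<and> r < 1")
      case True
      then have "0 \<le> r * R k" "r * R k < 1" using R(1,2)[of k] by (auto intro: mult_less_le_imp_less[of r 1 "R k" 1, simplified])
      from M(2)[OF F B(2) this] show ?thesis
        using weight_nonneg by (auto simp: abs_mult intro!: mult_left_mono)
    qed (simp add: weight_eq_0)
  qed
  have w: "integrable lborel (\<lambda>r. weight r * (M * B))" using weight_integrable by simp
  show "(\<lambda>k. LINT r|lborel. weight r * poisson_int F (r * R k)) \<longlonglongrightarrow> (LINT r|lborel. weight r * poisson_int F r)"
    by (rule integral_dominated_convergence[OF m1 m2 w lim bd])
  show "integrable lborel (\<lambda>r. weight r * poisson_int F r)"
    by (rule integrable_dominated_convergence[OF m1 m2 w lim bd])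
qed

end

lemma norm_diff_sq_unit:
  fixes x y :: "'a::euclidean_space"
  assumes "norm x = 1" "norm y = 1"
  shows "(norm (x - y))\<^sup>2 = 2 - 2 * (x \<bullet> y)"
  using norm_diff_scaleR_unit[OF assms, of 1] by simp

lemma increasing_radii:
  obtains R :: "nat \<Rightarrow> real" where "\<And>k. 0 < R k" "\<And>k. R k < 1" "R \<longlonglongrightarrow> 1"
proof -
  define R where "R k = 1 - 1 / (real k + 2)" for k :: nat
  have "(\<lambda>k. 1 / real (k + 2)) \<longlonglongrightarrow> 0"
    by (rule LIMSEQ_ignore_initial_segment[OF lim_1_over_n])
  then have "(\<lambda>k. 1 / (real k + 2)) \<longlonglongrightarrow> 0" by (simp add: add.commute)
  then have "R \<longlonglongrightarrow> 1 - 0"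
    unfolding R_def by (intro tendsto_intros)
  then show ?thesis by (intro that[of R]) (auto simp: R_def field_simps)
qed

context poisson_setting
begin

text \<open>The approximate identity property, stated relative to the actual mass of the kernel at
  radius \<open>R k\<close> because that mass is not normalised.\<close>

lemma poisson_int_approx:
  assumes u: "continuous_on (sphere 0 1) u"
    and R: "\<And>k. 0 < R k" "\<And>k. R k < 1" "R \<longlonglongrightarrow> 1"
  shows "(\<lambda>k. poisson_int u (R k) - poisson_int (\<lambda>_. 1) (R k) * u y) \<longlonglongrightarrow> 0"
proof (rule LIMSEQ_I)
  fix e :: real assume e: "0 < e"
  obtain M where M: "0 < M" "\<And>F B r. continuous_on (sphere 0 1) F \<Longrightarrow> (\<And>x. norm x = 1 \<Longrightarrow> \<bar>F x\<bar> \<le> B) \<Longrightarrow>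
     0 \<le> r \<Longrightarrow> r < 1 \<Longrightarrow> \<bar>poisson_int F r\<bar> \<le> M * B"
    using poisson_int_bound by blast
  obtain B where B: "0 < B" "\<And>x. norm x = 1 \<Longrightarrow> \<bar>u x\<bar> \<le> B" using continuous_sphere_bounded[OF u] by blast
  define \<epsilon> where "\<epsilon> = e / (2 * M)"
  have \<epsilon>: "\<epsilon> > 0" using e M by (simp add: \<epsilon>_def)
  obtain \<delta> where \<delta>: "\<delta> > 0" "\<And>x. norm x = 1 \<Longrightarrow> norm (x - y) < \<delta> \<Longrightarrow> \<bar>u x - u y\<bar> < \<epsilon>"
    using u \<epsilon> y unfolding continuous_on_iff by (fastforce simp: dist_norm)
  \<comment> \<open>Bounds the contribution of points at distance at least \<open>\<delta>\<close>
    from \<open>y\<close>: there \<open>norm (x - r *\<^sub>R y)\<close> is at least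
    \<open>\<delta> / 2\<close>, and only the vanishing factor \<open>1 - r^2\<close> depends on the
    radius.\<close>
  define C where "C = ((\<delta> / 2)\<^sup>2) powr (- (\<nu> + 1)) * (2 * B) * measure (sphere_measure :: 'a measure) (sphere 0 1)"
  have est: "\<bar>poisson_int u r - poisson_int (\<lambda>_. 1) r * u y\<bar> \<le> M * \<epsilon> + (1 - r\<^sup>2) * C" if r: "0 \<le> r" "r < 1" for r
  proof -
    define P where "P x = poisson_kernel \<nu> r (x \<bullet> y)" for x
    have cP: "continuous_on (sphere 0 1) P"
      unfolding P_def by (rule continuous_on_poisson_kernel[OF y r])
    have nP: "0 \<le> P x" for x unfolding P_def using r by (intro poisson_kernel_nonneg) auto
    define D where "D = (1 - r\<^sup>2) * ((\<delta> / 2)\<^sup>2) powr (- (\<nu> + 1)) * (2 * B)"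
    have D: "D \<ge> 0" unfolding D_def using r B by (auto intro!: mult_nonneg_nonneg simp: power_le_one)
    have pt: "norm (P x * (u x - u y)) \<le> P x * \<epsilon> + D" if x: "norm x = 1" for x
    proof (cases "norm (x - y) < \<delta>")
      case True
      have "norm (P x * (u x - u y)) = P x * \<bar>u x - u y\<bar>" using nP by (simp add: abs_mult)
      also have "\<dots> \<le> P x * \<epsilon>" using \<delta>(2)[OF x True] nP by (intro mult_left_mono) auto
      finally show ?thesis using D by simp
    next
      case False
      have 1: "1 - r \<le> norm (x - r *\<^sub>R y)"
        using norm_triangle_ineq2[of x "r *\<^sub>R y"] x y r by simp
      have "norm (x - y) \<le> norm (x - r *\<^sub>R y) + norm (r *\<^sub>R y - y)"
        using norm_triangle_ineq[of "x - r *\<^sub>R y" "r *\<^sub>R y - y"] by simp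
      also have "norm (r *\<^sub>R y - y) = norm ((r - 1) *\<^sub>R y)" by (simp add: scaleR_diff_left)
      also have "\<dots> = 1 - r" using y r by simp
      finally have "\<delta> / 2 \<le> norm (x - r *\<^sub>R y)" using 1 False by simp
      then have "(\<delta> / 2)\<^sup>2 \<le> 1 - 2 * r * (x \<bullet> y) + r\<^sup>2"
        unfolding norm_diff_scaleR_unit[OF x y, symmetric] using \<delta>(1) by (intro power_mono) auto
      then have "(1 - 2 * r * (x \<bullet> y) + r\<^sup>2) powr (- (\<nu> + 1)) \<le> ((\<delta> / 2)\<^sup>2) powr (- (\<nu> + 1))"
        using \<delta>(1) \<nu> by (intro powr_mono2') auto
      then have "P x \<le> (1 - r\<^sup>2) * ((\<delta> / 2)\<^sup>2) powr (- (\<nu> + 1))"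
        unfolding P_def poisson_kernel_def using r by (intro mult_left_mono) (auto simp: power_le_one)
      moreover have "\<bar>u x - u y\<bar> \<le> 2 * B" using B(2)[OF x] B(2)[OF y] by linarith
      ultimately have "P x * \<bar>u x - u y\<bar> \<le> D"
        unfolding D_def using nP[of x] by (intro mult_mono) (auto intro: order.trans)
      moreover have "P x * \<epsilon> \<ge> 0" using nP[of x] \<epsilon> by simp
      ultimately show ?thesis using nP by (simp add: abs_mult)
    qed
    have "poisson_int u r - poisson_int (\<lambda>_. 1) r * u y
        = (LINT x|sphere_measure. P x * u x) - (LINT x|sphere_measure. P x * u y)"
      unfolding poisson_int_def P_def by simp
    also have "\<dots> = (LINT x|sphere_measure. P x * u x - P x * u y)"
      by (intro Bochner_Integration.integral_diff[symmetric] integrable_sphereI continuous_intros cP u)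
    also have "\<dots> = (LINT x|sphere_measure. P x * (u x - u y))" by (simp add: right_diff_distrib)
    finally have "\<bar>poisson_int u r - poisson_int (\<lambda>_. 1) r * u y\<bar> \<le> (LINT x|sphere_measure. norm (P x * (u x - u y)))"
      using integral_norm_bound by (metis real_norm_def)
    also have "\<dots> \<le> (LINT x|sphere_measure. P x * \<epsilon> + D)"
    proof (rule integral_mono)
      show "integrable sphere_measure (\<lambda>x. norm (P x * (u x - u y)))"
        by (intro integrable_sphereI continuous_intros cP u)
      show "integrable sphere_measure (\<lambda>x. P x * \<epsilon> + D)"
        by (intro integrable_sphereI continuous_intros cP)
    qed (use pt in auto)
    also have "\<dots> = (LINT x|sphere_measure. P x * \<epsilon>) + (LINT x|(sphere_measure :: 'a measure). D)"
      by (intro Bochner_Integration.integral_add integrable_sphereI continuous_intros cP)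
    also have "(LINT x|sphere_measure. P x * \<epsilon>) = poisson_int (\<lambda>_. \<epsilon>) r" by (simp add: poisson_int_def P_def)
    also have "\<dots> \<le> M * \<epsilon>" using M(2)[of "\<lambda>_. \<epsilon>" \<epsilon> r] r \<epsilon> by auto
    also have "(LINT x|(sphere_measure :: 'a measure). D) = (1 - r\<^sup>2) * C"
      by (simp add: C_def D_def mult_ac)
    finally show ?thesis by simp
  qed
  have "(\<lambda>k. (1 - (R k)\<^sup>2) * C) \<longlonglongrightarrow> (1 - 1\<^sup>2) * C" by (intro tendsto_intros R)
  then have "(\<lambda>k. (1 - (R k)\<^sup>2) * C) \<longlonglongrightarrow> 0" by simp
  then have "\<forall>\<^sub>F k in sequentially. (1 - (R k)\<^sup>2) * C < e / 2"
    using e by (intro order_tendstoD(2)) auto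
  then obtain K where K: "\<And>k. k \<ge> K \<Longrightarrow> (1 - (R k)\<^sup>2) * C < e / 2"
    unfolding eventually_sequentially by blast
  have "norm (poisson_int u (R k) - poisson_int (\<lambda>_. 1) (R k) * u y - 0) < e" if "k \<ge> K" for k
  proof -
    have "M * \<epsilon> = e / 2" using M(1) by (simp add: \<epsilon>_def)
    then show ?thesis using est[of "R k"] K[OF that] R(1,2)[of k] by simp
  qed
  then show "\<exists>no. \<forall>k\<ge>no. norm (poisson_int u (R k) - poisson_int (\<lambda>_. 1) (R k) * u y - 0) < e" by blast
qed

text \<open>Tonelli exchanges radius and sphere, and the inner integral is
  \<open>nn_integral_poisson_kernel_radial\<close> away from \<open>x = y\<close>. Since
  \<open>F\<close> is nonnegative, finiteness of the radial side also yields integrability of the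
  singular kernel.\<close>

lemma radial_riesz:
  assumes F: "continuous_on (sphere 0 1) F" and Fn: "\<And>x. norm x = 1 \<Longrightarrow> 0 \<le> F x"
  shows "integrable sphere_measure (\<lambda>x. riesz \<alpha> x y * F x)"
    and "(LINT r|lborel. weight r * poisson_int F r) = Beta \<alpha> (s + 1 / 2) * (LINT x|sphere_measure. riesz \<alpha> x y * F x)"
proof -
  obtain R :: "nat \<Rightarrow> real" where R: "\<And>k. 0 < R k" "\<And>k. R k < 1" "R \<longlonglongrightarrow> 1"
    using increasing_radii by blast
  define J where "J = (LINT r|lborel. weight r * poisson_int F r)"
  have intJ: "integrable lborel (\<lambda>r. weight r * poisson_int F r)" by (rule abel_limit(2)[OF F R])
  have dim: "2 \<le> DIM('a)" using nu \<nu> by linarith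
  have Fm [measurable]: "F \<in> borel_measurable sphere_measure" by (rule borel_measurable_sphereI[OF F])
  have im [measurable]: "(\<lambda>x. x \<bullet> y) \<in> borel_measurable sphere_measure"
    by (intro borel_measurable_sphereI continuous_intros)
  have pos: "0 \<le> weight r * (poisson_kernel \<nu> r (x \<bullet> y) * F x)" if "norm x = 1" for r x
    using poisson_kernel_nonneg[of r \<nu> "x \<bullet> y"] Fn[OF that] weight_nonneg[of r]
    by (cases "0 < r \<and> r < 1") (auto simp: weight_eq_0)
  have Jn: "0 \<le> weight r * poisson_int F r" for r
    using poisson_kernel_nonneg[of r \<nu>] Fn weight_nonneg[of r]
    by (cases "0 < r \<and> r < 1") (auto simp: weight_eq_0 poisson_int_def intro!: mult_nonneg_nonneg integral_nonneg_AE AE_I2)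
  interpret PS: pair_sigma_finite "lborel :: real measure" "sphere_measure :: 'a measure" ..
  have Bpos: "Beta \<alpha> (s + 1 / 2) > 0" using \<alpha> s by (simp add: Beta_def Gamma_real_pos)
  have "ennreal J = (\<integral>\<^sup>+r. ennreal (weight r * poisson_int F r) \<partial>lborel)"
    unfolding J_def by (rule nn_integral_eq_integral[symmetric, OF intJ]) (use Jn in auto)
  also have "\<dots> = (\<integral>\<^sup>+r. (\<integral>\<^sup>+x. ennreal (weight r * (poisson_kernel \<nu> r (x \<bullet> y) * F x)) \<partial>sphere_measure) \<partial>lborel)"
  proof (rule nn_integral_cong)
    fix r :: real
    show "ennreal (weight r * poisson_int F r) = (\<integral>\<^sup>+x. ennreal (weight r * (poisson_kernel \<nu> r (x \<bullet> y) * F x)) \<partial>sphere_measure)"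
    proof (cases "0 < r \<and> r < 1")
      case True
      have "integrable sphere_measure (\<lambda>x. weight r * (poisson_kernel \<nu> r (x \<bullet> y) * F x))"
        using True by (intro integrable_sphereI continuous_intros F continuous_on_poisson_kernel[OF y]) auto
      then have "(\<integral>\<^sup>+x. ennreal (weight r * (poisson_kernel \<nu> r (x \<bullet> y) * F x)) \<partial>sphere_measure)
         = ennreal (LINT x|sphere_measure. weight r * (poisson_kernel \<nu> r (x \<bullet> y) * F x))"
        using pos by (intro nn_integral_eq_integral AE_I2) auto
      then show ?thesis by (simp add: poisson_int_def)
    qed (simp add: weight_eq_0)
  qed
  also have "\<dots> = (\<integral>\<^sup>+x. (\<integral>\<^sup>+r. ennreal (weight r * (poisson_kernel \<nu> r (x \<bullet> y) * F x)) \<partial>lborel) \<partial>sphere_measure)"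
    unfolding poisson_kernel_def by (rule PS.Fubini'[symmetric]) measurable
  also have "\<dots> = (\<integral>\<^sup>+x. ennreal (Beta \<alpha> (s + 1 / 2)) * ennreal (riesz \<alpha> x y * F x) \<partial>sphere_measure)"
  proof (rule nn_integral_cong_AE)
    show "AE x in sphere_measure. (\<integral>\<^sup>+r. ennreal (weight r * (poisson_kernel \<nu> r (x \<bullet> y) * F x)) \<partial>lborel)
       = ennreal (Beta \<alpha> (s + 1 / 2)) * ennreal (riesz \<alpha> x y * F x)"
      using sphere_measure_singleton_null[OF dim, of y] AE_space
    proof eventually_elim
      case (elim x)
      then have x: "norm x = 1" by simp
      have t: "x \<bullet> y < 1"
      proof -
        have "0 < (norm (x - y))\<^sup>2" using elim by simp
        then show ?thesis unfolding norm_diff_sq_unit[OF x y] by simp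
      qed
      have [measurable]: "{0..1} \<in> sets (borel :: real measure)" by simp
      have pm [measurable]: "(\<lambda>r. poisson_kernel \<nu> r (x \<bullet> y)) \<in> borel_measurable borel"
        unfolding poisson_kernel_def by measurable
      have "(\<integral>\<^sup>+r. ennreal (weight r * (poisson_kernel \<nu> r (x \<bullet> y) * F x)) \<partial>lborel)
        = (\<integral>\<^sup>+r. ennreal (F x) * (ennreal (r powr (\<alpha> - 1) * (1 - r) powr (2 * s - 1) * poisson_kernel \<nu> r (x \<bullet> y)) * indicator {0..1} r) \<partial>lborel)"
        using Fn[OF x] by (intro nn_integral_cong) (auto simp: weight_def indicator_def mult_ac simp flip: ennreal_mult')
      also have "\<dots> = ennreal (F x) * ennreal (Beta \<alpha> (s + 1 / 2) * (2 - 2 * (x \<bullet> y)) powr (- \<alpha>))"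
        by (subst nn_integral_cmult)
           (measurable, simp only: nn_integral_poisson_kernel_radial[OF abs_inner_unit_le[OF x y] t \<alpha> s eq])
      also have "(2 - 2 * (x \<bullet> y)) powr (- \<alpha>) = riesz \<alpha> x y"
        unfolding riesz_def norm_diff_sq_unit[OF x y] ..
      also have "ennreal (F x) * ennreal (Beta \<alpha> (s + 1 / 2) * riesz \<alpha> x y) = ennreal (Beta \<alpha> (s + 1 / 2)) * ennreal (riesz \<alpha> x y * F x)"
        using Fn[OF x] Bpos by (simp add: ennreal_mult riesz_nonneg mult_ac)
      finally show ?case .
    qed
  qed
  also have "\<dots> = ennreal (Beta \<alpha> (s + 1 / 2)) * (\<integral>\<^sup>+x. ennreal (riesz \<alpha> x y * F x) \<partial>sphere_measure)"
    by (rule nn_integral_cmult) measurable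
  finally have E: "ennreal J = ennreal (Beta \<alpha> (s + 1 / 2)) * (\<integral>\<^sup>+x. ennreal (riesz \<alpha> x y * F x) \<partial>sphere_measure)" .
  have J0: "0 \<le> J" unfolding J_def using Jn by (intro integral_nonneg_AE AE_I2) auto
  have "has_bochner_integral sphere_measure (\<lambda>x. riesz \<alpha> x y * F x) (J / Beta \<alpha> (s + 1 / 2))"
  proof (rule has_bochner_integral_nn_integral)
    show "(\<lambda>x. riesz \<alpha> x y * F x) \<in> borel_measurable sphere_measure" by measurable
    show "AE x in sphere_measure. 0 \<le> riesz \<alpha> x y * F x"
      using Fn riesz_nonneg by (intro AE_I2 mult_nonneg_nonneg) auto
    show "0 \<le> J / Beta \<alpha> (s + 1 / 2)" using J0 Bpos by simp
    have "ennreal (1 / Beta \<alpha> (s + 1 / 2)) * ennreal (Beta \<alpha> (s + 1 / 2)) = 1"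
      using Bpos by (simp flip: ennreal_mult)
    then have "(\<integral>\<^sup>+x. ennreal (riesz \<alpha> x y * F x) \<partial>sphere_measure) = ennreal (1 / Beta \<alpha> (s + 1 / 2)) * ennreal J"
      unfolding E by (simp add: mult.assoc[symmetric])
    also have "\<dots> = ennreal (J / Beta \<alpha> (s + 1 / 2))"
      using Bpos J0 by (simp flip: ennreal_mult)
    finally show "(\<integral>\<^sup>+x. ennreal (riesz \<alpha> x y * F x) \<partial>sphere_measure) = ennreal (J / Beta \<alpha> (s + 1 / 2))" .
  qed
  then show "integrable sphere_measure (\<lambda>x. riesz \<alpha> x y * F x)"
    "(LINT r|lborel. weight r * poisson_int F r) = Beta \<alpha> (s + 1 / 2) * (LINT x|sphere_measure. riesz \<alpha> x y * F x)"
    using Bpos by (auto simp: has_bochner_integral_iff J_def)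
qed

lemma poisson_mass_tendsto:
  assumes F: "continuous_on (sphere 0 1) F" and Fn: "\<And>x. norm x = 1 \<Longrightarrow> 0 \<le> F x"
    and u: "continuous_on (sphere 0 1) u" and uy: "0 < u y"
    and rel: "\<And>l. zcoeff F l * Beta (\<alpha> + real l) (2 * s) = Gamma (2 * s) * zcoeff u l"
    and R: "\<And>k. 0 < R k" "\<And>k. R k < 1" "R \<longlonglongrightarrow> 1"
  shows "(\<lambda>k. poisson_int (\<lambda>_. 1) (R k)) \<longlonglongrightarrow>
     Beta \<alpha> (s + 1 / 2) / Gamma (2 * s) * (LINT x|sphere_measure. riesz \<alpha> x y * F x) / u y"
proof -
  have G: "Gamma (2 * s) > 0" using s by (simp add: Gamma_real_pos)
  define L where "L = Beta \<alpha> (s + 1 / 2) * (LINT x|sphere_measure. riesz \<alpha> x y * F x)"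
  have "(LINT r|lborel. weight r * poisson_int F r) = L"
    unfolding L_def by (rule radial_riesz(2)[OF F]) (use Fn in auto)
  then have "(\<lambda>k. Gamma (2 * s) * poisson_int u (R k)) \<longlonglongrightarrow> L"
    using abel_limit(1)[OF F R] unfolding abel_identity[OF F u rel R(1,2)] by simp
  then have "(\<lambda>k. Gamma (2 * s) * poisson_int u (R k) / Gamma (2 * s)) \<longlonglongrightarrow> L / Gamma (2 * s)"
    using G by (intro tendsto_divide tendsto_const) auto
  then have "(\<lambda>k. poisson_int u (R k)) \<longlonglongrightarrow> L / Gamma (2 * s)" using G by simp
  from tendsto_diff[OF this poisson_int_approx[OF u R]]
  have "(\<lambda>k. poisson_int (\<lambda>_. 1) (R k) * u y) \<longlonglongrightarrow> L / Gamma (2 * s)" by simp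
  then have "(\<lambda>k. poisson_int (\<lambda>_. 1) (R k) * u y / u y) \<longlonglongrightarrow> L / Gamma (2 * s) / u y"
    using uy by (intro tendsto_divide tendsto_const) auto
  then show ?thesis using uy by (simp add: L_def)
qed

end

section \<open>Positivity, rotation invariance and the integral representation\<close>

lemma emeasure_sphere_open_pos:
  fixes U :: "'a::euclidean_space set"
  assumes U: "open U" and z: "z \<in> U" "norm z = 1"
  shows "emeasure sphere_measure (sphere 0 1 \<inter> U) > 0"
proof -
  have meas: "sphere 0 1 \<inter> U \<in> sets sphere_measure" using U by (auto simp: sets_restrict_space)
  define A where "A = (ball 0 1 - {0::'a}) \<inter> (\<lambda>x. x /\<^sub>R norm x) -` U"
  have Ao: "open A" unfolding A_def
    by (rule continuous_open_preimage) (auto intro!: continuous_intros U)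
  have "(1/2) *\<^sub>R z \<in> A" using z by (auto simp: A_def)
  then have "\<not> negligible A" using Ao open_not_negligible by blast
  then have "emeasure lborel A \<noteq> 0"
    using Ao by (auto simp: negligible_iff_null_sets null_sets_def)
  moreover have "emeasure sphere_measure (sphere 0 1 \<inter> U) = emeasure lborel A"
  proof -
    have "emeasure sphere_measure (sphere 0 1 \<inter> U) = (\<integral>\<^sup>+x. indicator (sphere 0 1 \<inter> U) x \<partial>sphere_measure)"
      using meas by simp
    also have "\<dots> = (\<integral>\<^sup>+x. indicator A x \<partial>lborel)"
      using meas
      by (subst nn_integral_sphere_measure, simp, intro nn_integral_cong) (auto simp: A_def indicator_def)
    finally show ?thesis using Ao by simp
  qed
  ultimately show ?thesis by (simp add: zero_less_iff_neq_zero)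
qed

lemma lint_riesz_pos:
  fixes y :: "'a::euclidean_space"
  assumes y: "norm y = 1" and dim: "2 \<le> DIM('a)"
    and int: "integrable sphere_measure (\<lambda>x. riesz \<alpha> x y * F x)" and F: "\<And>x. norm x = 1 \<Longrightarrow> 0 < F x"
  shows "0 < (LINT x|sphere_measure. riesz \<alpha> x y * F x)"
proof (rule ccontr)
  have nn: "AE x in sphere_measure. 0 \<le> riesz \<alpha> x y * F x"
    using F riesz_nonneg by (intro AE_I2 mult_nonneg_nonneg) (auto intro: less_imp_le)
  assume "\<not> 0 < (LINT x|sphere_measure. riesz \<alpha> x y * F x)"
  moreover have "0 \<le> (LINT x|sphere_measure. riesz \<alpha> x y * F x)"
    by (rule integral_nonneg_AE[OF nn])
  ultimately have "(LINT x|sphere_measure. riesz \<alpha> x y * F x) = 0" by simp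
  then have "AE x in sphere_measure. riesz \<alpha> x y * F x = 0"
    using integral_nonneg_eq_0_iff_AE[OF int nn] by simp
  then have "AE x in (sphere_measure :: 'a measure). False"
    using sphere_measure_singleton_null[OF dim, of y] AE_space
  proof eventually_elim
    case (elim x)
    then show ?case using F[of x] by (auto simp: riesz_def)
  qed
  then have "emeasure (sphere_measure :: 'a measure) (sphere 0 1) = 0"
    by (subst (asm) AE_iff_measurable[OF _ refl]) (auto simp: sets_restrict_space sphere_def)
  then show False using emeasure_sphere_open_pos[of UNIV y] y by simp
qed

text \<open>For \<open>b = 0\<close> the conformal reflection is the Euclidean one with factor 1.
  Taking \<open>v\<close> as the normalised difference \<open>y - z\<close> exchanges the two
  poles.\<close>

lemma poisson_mass_rotation:
  fixes y z :: "'a::euclidean_space"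
  assumes y: "norm y = 1" and z: "norm z = 1" and dim: "2 \<le> DIM('a)" and r: "0 \<le> r" "r < 1"
  shows "(LINT x|sphere_measure. poisson_kernel \<nu> r (x \<bullet> y)) = (LINT x|sphere_measure. poisson_kernel \<nu> r (x \<bullet> z))"
proof (cases "y = z")
  case False
  define v where "v = (y - z) /\<^sub>R norm (y - z)"
  have vv: "v \<bullet> v = 1 + 0\<^sup>2" using False by (simp add: v_def dot_square_norm power2_eq_square)
  have nz: "norm (y - z) > 0" using False by simp
  have refl: "conf_refl 0 v x \<bullet> z = x \<bullet> y" for x
  proof -
    have d: "(norm (y - z))\<^sup>2 = 2 - 2 * (y \<bullet> z)" by (rule norm_diff_sq_unit[OF y z])
    have vz: "2 * (v \<bullet> z) = - norm (y - z)"
    proof -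
      have "2 * ((y - z) \<bullet> z) = - (norm (y - z))\<^sup>2"
        unfolding d using z by (simp add: inner_diff_left norm_eq_1)
      then have "2 * ((y - z) \<bullet> z) / norm (y - z) = - norm (y - z)"
        using nz by (simp add: power2_eq_square)
      then show ?thesis by (simp add: v_def divide_inverse mult_ac)
    qed
    have "conf_refl 0 v x \<bullet> z = x \<bullet> z - (x \<bullet> v) * (2 * (v \<bullet> z))"
      by (simp add: conf_refl_def conf_factor_def inner_diff_left)
    also have "\<dots> = x \<bullet> z + (x \<bullet> v) * norm (y - z)" unfolding vz by simp
    also have "(x \<bullet> v) * norm (y - z) = x \<bullet> (y - z)" using nz by (simp add: v_def)
    finally show ?thesis by (simp add: inner_diff_right)
  qed
  define g where "g x = poisson_kernel \<nu> r (x \<bullet> z)" for x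
  have cont: "continuous_on (sphere 0 1) (\<lambda>x. poisson_kernel \<nu> r (x \<bullet> w))" if "norm w = 1" for w :: 'a
    by (rule continuous_on_poisson_kernel[OF that r])
  have nn: "0 \<le> poisson_kernel \<nu> r t" for t using r by (intro poisson_kernel_nonneg) auto
  have eqi: "(\<integral>\<^sup>+x. ennreal (poisson_kernel \<nu> r (x \<bullet> w)) \<partial>sphere_measure) = ennreal (LINT x|sphere_measure. poisson_kernel \<nu> r (x \<bullet> w))"
    if "norm w = 1" for w :: 'a
    by (intro nn_integral_eq_integral integrable_sphereI cont that AE_I2 nn)
  have "(\<integral>\<^sup>+x. ennreal (g (conf_refl 0 v x) / conf_factor 0 v x ^ (DIM('a) - 1)) \<partial>sphere_measure)
     = (\<integral>\<^sup>+x. ennreal (g x) \<partial>sphere_measure)"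
    by (rule nn_integral_conf_refl[OF vv _ _ dim])
       (auto simp: g_def nn intro!: borel_measurable_sphereI cont z)
  then have "ennreal (LINT x|sphere_measure. poisson_kernel \<nu> r (x \<bullet> y)) = ennreal (LINT x|sphere_measure. poisson_kernel \<nu> r (x \<bullet> z))"
    unfolding g_def refl by (simp add: conf_factor_def eqi y z)
  then show ?thesis using nn by (subst (asm) ennreal_inj) (auto intro!: integral_nonneg_AE AE_I2)
qed simp

text \<open>The mass of the Poisson kernel is never computed: it converges because the Abel means of \<open>u\<close>
  converge and \<open>u y > 0\<close>, and its limit does not depend on \<open>y\<close> by rotation invariance.\<close>

proposition riesz_representation:
  fixes u F :: "'i \<Rightarrow> 'a::euclidean_space \<Rightarrow> real" and s :: real
  defines "n \<equiv> real DIM('a) - 1"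
  defines "\<nu> \<equiv> (n - 1) / 2"
  assumes n: "1 < n" and s01: "0 < s" "s < n / 2"
    and u: "\<And>i. continuous_on (sphere 0 1) (u i)" and up: "\<And>i x. norm x = 1 \<Longrightarrow> 0 < u i x"
    and F: "\<And>i. continuous_on (sphere 0 1) (F i)" and Fp: "\<And>i x. norm x = 1 \<Longrightarrow> 0 < F i x"
    and rel: "\<And>i l y. norm y = 1 \<Longrightarrow>
      Gamma (real l + n / 2 + s) / Gamma (real l + n / 2 - s) * (LINT x|sphere_measure. u i x * poly (gegenbauer \<nu> l) (x \<bullet> y))
        = (LINT x|sphere_measure. F i x * poly (gegenbauer \<nu> l) (x \<bullet> y))"
  obtains \<kappa> where "0 < \<kappa>"
    "\<And>i y. norm y = 1 \<Longrightarrow> u i y = \<kappa> * (LINT x|sphere_measure. riesz (n / 2 - s) x y * F i x)"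
proof -
  define \<alpha> where "\<alpha> = n / 2 - s"
  have \<alpha>: "0 < \<alpha>" using s01 by (simp add: \<alpha>_def)
  have dim: "2 \<le> DIM('a)" using n by (simp add: n_def)
  have setting: "poisson_setting y \<nu> s \<alpha>" if "norm y = 1" for y :: 'a
    by unfold_locales (use that n s01 in \<open>auto simp: \<nu>_def n_def \<alpha>_def field_simps\<close>)
  obtain R :: "nat \<Rightarrow> real" where R: "\<And>k. 0 < R k" "\<And>k. R k < 1" "R \<longlonglongrightarrow> 1"
    using increasing_radii by blast
  obtain e :: 'a where e: "norm e = 1" using vector_choose_size[of 1] by auto
  define m where "m k = (LINT x|sphere_measure. poisson_kernel \<nu> (R k) (x \<bullet> e))" for k
  define c where "c = Beta \<alpha> (s + 1 / 2) / Gamma (2 * s)"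
  have c: "c > 0" using \<alpha> s01 by (simp add: c_def Beta_def Gamma_real_pos)
  have lim: "m \<longlonglongrightarrow> c * (LINT x|sphere_measure. riesz \<alpha> x y * F i x) / u i y" if y: "norm y = 1" for i y
  proof -
    interpret poisson_setting y \<nu> s \<alpha> by (rule setting[OF y])
    have rel': "zcoeff (F i) l * Beta (\<alpha> + real l) (2 * s) = Gamma (2 * s) * zcoeff (u i) l" for l
    proof -
      have z: "zcoeff G l = (real l + \<nu>) / \<nu> * (LINT x|sphere_measure. G x * poly (gegenbauer \<nu> l) (x \<bullet> y))" for G
        unfolding zcoeff_def by (simp add: mult_ac flip: integral_mult_right_zero)
      have g: "Gamma (real l + n / 2 + s) > 0" "Gamma (real l + n / 2 - s) > 0"
        using s01 by (auto intro!: Gamma_real_pos)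
      have b: "Beta (\<alpha> + real l) (2 * s) = Gamma (real l + n / 2 - s) * Gamma (2 * s) / Gamma (real l + n / 2 + s)"
        by (simp add: Beta_def \<alpha>_def algebra_simps)
      have "q * (g1 / g2 * U) * (g2 * G / g1) = G * (q * U)" if "0 < g1" "0 < g2" for q g1 g2 U G :: real
        using that by simp
      from this[OF g] show ?thesis unfolding z rel[OF y, symmetric] b .
    qed
    have "(\<lambda>k. poisson_int (\<lambda>_. 1) (R k)) \<longlonglongrightarrow> c * (LINT x|sphere_measure. riesz \<alpha> x y * F i x) / u i y"
      unfolding c_def by (rule poisson_mass_tendsto[OF F _ u up[OF y] rel' R]) (use Fp in \<open>auto intro: less_imp_le\<close>)
    moreover have "poisson_int (\<lambda>_. 1) (R k) = m k" for k
      unfolding poisson_int_def m_def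
      using poisson_mass_rotation[OF y e dim, of "R k" \<nu>] R(1,2)[of k] by simp
    ultimately show ?thesis by simp
  qed
  have pos: "0 < (LINT x|sphere_measure. riesz \<alpha> x y * F i x)" if y: "norm y = 1" for i y
  proof -
    interpret poisson_setting y \<nu> s \<alpha> by (rule setting[OF y])
    have "integrable sphere_measure (\<lambda>x. riesz \<alpha> x y * F i x)"
      by (rule radial_riesz(1)[OF F]) (use Fp in \<open>auto intro: less_imp_le\<close>)
    from lint_riesz_pos[OF y dim this] Fp show ?thesis by auto
  qed
  define \<mu> where "\<mu> = lim m"
  have \<mu>: "\<mu> = c * (LINT x|sphere_measure. riesz \<alpha> x y * F i x) / u i y" if y: "norm y = 1" for i y
    unfolding \<mu>_def using lim[OF y] by (rule limI)
  have "\<mu> > 0" using \<mu>[OF e, of undefined] c pos[OF e, of undefined] up[OF e, of undefined] by simp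
  show ?thesis
  proof (rule that[of "c / \<mu>"])
    show "c / \<mu> > 0" using c \<open>\<mu> > 0\<close> by simp
    fix i and y :: 'a assume y: "norm y = 1"
    show "u i y = c / \<mu> * (LINT x|sphere_measure. riesz (n / 2 - s) x y * F i x)"
    proof -
      have "U = c / \<mu> * I" if "\<mu> = c * I / U" "U > 0" for I U
        using that \<open>\<mu> > 0\<close> by (simp add: divide_simps mult.commute)
      from this[OF \<mu>[OF y] up[OF y]] show ?thesis unfolding \<alpha>_def .
    qed
  qed
qed

text \<open>\<open>radial_riesz\<close> with \<open>F = 1\<close> and the uniform mass bound. Here
  \<open>s\<close> is defined from \<open>\<alpha>\<close>, so the lemma covers every exponent below
  half the dimension of the sphere, in particular the enlarged one in
  \<open>small_set_riesz\<close>.\<close>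

lemma riesz_integral_bounded:
  fixes \<alpha> :: real
  assumes \<alpha>: "0 < \<alpha>" "\<alpha> < (real DIM('a) - 1) / 2" and dim: "3 \<le> DIM('a)"
  obtains C where "0 < C" "\<And>y::'a::euclidean_space. norm y = 1 \<Longrightarrow> integrable sphere_measure (\<lambda>x. riesz \<alpha> x y)"
    "\<And>y::'a::euclidean_space. norm y = 1 \<Longrightarrow> (LINT x|sphere_measure. riesz \<alpha> x y) \<le> C"
proof -
  define s where "s = (real DIM('a) - 1) / 2 - \<alpha>"
  define \<nu> where "\<nu> = (real DIM('a) - 2) / 2"
  have setting: "poisson_setting y \<nu> s \<alpha>" if "norm y = 1" for y :: 'a
    by unfold_locales (use that \<alpha> dim in \<open>auto simp: \<nu>_def s_def field_simps\<close>)
  have s: "s > 0" using \<alpha> by (simp add: s_def)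
  have Bpos: "Beta \<alpha> (s + 1 / 2) > 0" using \<alpha> s by (simp add: Beta_def Gamma_real_pos)
  have B2: "Beta \<alpha> (2 * s) > 0" using \<alpha> s by (simp add: Beta_def Gamma_real_pos)
  obtain M where M: "0 < M" "\<And>y::'a. \<And>r. norm y = 1 \<Longrightarrow> 0 \<le> r \<Longrightarrow> r < 1 \<Longrightarrow>
     (\<integral>\<^sup>+x. ennreal (poisson_kernel \<nu> r (x \<bullet> y)) \<partial>sphere_measure) \<le> ennreal M"
    using poisson_mass_bounded[of \<nu>] by (auto simp: \<nu>_def)
  define C where "C = Beta \<alpha> (2 * s) * M / Beta \<alpha> (s + 1 / 2)"
  have "integrable sphere_measure (\<lambda>x. riesz \<alpha> x y) \<and> (LINT x|sphere_measure. riesz \<alpha> x y) \<le> C"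
    if y: "norm y = 1" for y :: 'a
  proof -
    interpret poisson_setting y \<nu> s \<alpha> by (rule setting[OF y])
    have one: "continuous_on (sphere 0 1) (\<lambda>_::'a. 1::real)" by simp
    have i: "integrable sphere_measure (\<lambda>x. riesz \<alpha> x y)"
      using radial_riesz(1)[OF one] by simp
    obtain R :: "nat \<Rightarrow> real" where R: "\<And>k. 0 < R k" "\<And>k. R k < 1" "R \<longlonglongrightarrow> 1"
      using increasing_radii by blast
    have w: "(LINT r|lborel. weight r) = Beta \<alpha> (2 * s)"
      using weight_moment[of 0] by (simp add: has_bochner_integral_iff)
    have "Beta \<alpha> (s + 1 / 2) * (LINT x|sphere_measure. riesz \<alpha> x y) = (LINT r|lborel. weight r * poisson_int (\<lambda>_. 1) r)"
      using radial_riesz(2)[OF one] by simp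
    also have "\<dots> \<le> (LINT r|lborel. weight r * M)"
    proof (rule integral_mono)
      show "integrable lborel (\<lambda>r. weight r * poisson_int (\<lambda>_. 1) r)" by (rule abel_limit(2)[OF one R])
      show "integrable lborel (\<lambda>r. weight r * M)" using weight_integrable by simp
      fix r :: real
      show "weight r * poisson_int (\<lambda>_. 1) r \<le> weight r * M"
      proof (cases "0 < r \<and> r < 1")
        case True
        then have r: "0 \<le> r" "r < 1" by auto
        have "ennreal (LINT x|sphere_measure. poisson_kernel \<nu> r (x \<bullet> y)) \<le> ennreal M"
          using M(2)[OF y r] poisson_kernel_nonneg[of r \<nu>] r integrable_sphereI[OF continuous_on_poisson_kernel[OF y r]]
          by (subst nn_integral_eq_integral[symmetric]) auto
        then have "poisson_int (\<lambda>_. 1) r \<le> M"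
          unfolding poisson_int_def using M(1) by (subst (asm) ennreal_le_iff) auto
        then show ?thesis using weight_nonneg by (intro mult_left_mono)
      qed (simp add: weight_eq_0)
    qed
    also have "\<dots> = Beta \<alpha> (2 * s) * M" using w by simp
    finally have "(LINT x|sphere_measure. riesz \<alpha> x y) \<le> C"
      unfolding C_def using Bpos by (simp add: pos_le_divide_eq mult.commute)
    with i show ?thesis by blast
  qed
  moreover have "C > 0" unfolding C_def using M(1) Bpos B2 by simp
  ultimately show ?thesis using that by blast
qed

section \<open>Moving spheres\<close>

lemma lint_conf_refl:
  fixes v :: "'a::euclidean_space" and g :: "'a \<Rightarrow> real"
  assumes vv: "v \<bullet> v = 1 + b\<^sup>2" and g: "integrable sphere_measure g" and dim: "2 \<le> DIM('a)"
  shows "integrable sphere_measure (\<lambda>x. g (conf_refl b v x) / conf_factor b v x ^ (DIM('a) - 1))" (is "integrable _ (?T g)")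
    and "(LINT x|sphere_measure. g (conf_refl b v x) / conf_factor b v x ^ (DIM('a) - 1)) = (LINT x|sphere_measure. g x)"
proof -
  have A: "0 < conf_factor b v x" if "x \<in> sphere 0 1" for x using that by (intro conf_factor_pos[OF vv]) simp
  have m: "?T h \<in> borel_measurable sphere_measure" if "h \<in> borel_measurable sphere_measure" for h :: "'a \<Rightarrow> real"
  proof -
    have [measurable]: "(\<lambda>x. h (conf_refl b v x)) \<in> borel_measurable sphere_measure"
      by (rule measurable_compose[OF conf_refl_measurable[OF vv] that])
    have [measurable]: "conf_factor b v \<in> borel_measurable sphere_measure"
      by (rule borel_measurable_sphereI[OF continuous_on_conf_factor])
    show ?thesis by measurable
  qed
  have nonneg: "has_bochner_integral sphere_measure (?T h) (LINT x|sphere_measure. h x)"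
    if h: "integrable sphere_measure h" and hn: "\<And>x. 0 \<le> h x" for h :: "'a \<Rightarrow> real"
  proof (rule has_bochner_integral_nn_integral)
    have hm: "h \<in> borel_measurable sphere_measure" using h by simp
    then show "?T h \<in> borel_measurable sphere_measure" by (rule m)
    show "AE x in sphere_measure. 0 \<le> ?T h x"
      using A by (intro AE_I2 divide_nonneg_nonneg hn) (auto intro!: less_imp_le)
    show "0 \<le> (LINT x|sphere_measure. h x)" using hn by (intro integral_nonneg_AE AE_I2)
    show "(\<integral>\<^sup>+x. ennreal (?T h x) \<partial>sphere_measure) = ennreal (LINT x|sphere_measure. h x)"
      unfolding nn_integral_conf_refl[OF vv hm hn dim]
      by (rule nn_integral_eq_integral[OF h]) (use hn in auto)
  qed
  have p: "integrable sphere_measure (\<lambda>x. max 0 (g x))" "integrable sphere_measure (\<lambda>x. max 0 (- g x))"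
    using g by auto
  have "has_bochner_integral sphere_measure (\<lambda>x. ?T (\<lambda>x. max 0 (g x)) x - ?T (\<lambda>x. max 0 (- g x)) x)
      ((LINT x|sphere_measure. max 0 (g x)) - (LINT x|sphere_measure. max 0 (- g x)))"
    by (intro has_bochner_integral_diff nonneg p) auto
  also have "(\<lambda>x. ?T (\<lambda>x. max 0 (g x)) x - ?T (\<lambda>x. max 0 (- g x)) x) = ?T g"
    by (auto simp: fun_eq_iff max_def simp flip: diff_divide_distrib)
  also have "(LINT x|sphere_measure. max 0 (g x)) - (LINT x|sphere_measure. max 0 (- g x)) = (LINT x|sphere_measure. max 0 (g x) - max 0 (- g x))"
    by (rule Bochner_Integration.integral_diff[symmetric, OF p])
  also have "(\<lambda>x. max 0 (g x) - max 0 (- g x)) = g" by (auto simp: max_def)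
  finally show "integrable sphere_measure (?T g)" "(LINT x|sphere_measure. ?T g x) = (LINT x|sphere_measure. g x)"
    by (auto simp: has_bochner_integral_iff)
qed

lemma riesz_conf_refl:
  fixes v x y :: "'a::euclidean_space"
  assumes vv: "v \<bullet> v = 1 + b\<^sup>2" and x: "norm x = 1" and y: "norm y = 1"
  shows "riesz \<alpha> (conf_refl b v y) (conf_refl b v x) = conf_factor b v x powr \<alpha> * conf_factor b v y powr \<alpha> * riesz \<alpha> y x"
proof -
  define a where "a = conf_factor b v x"
  define c where "c = conf_factor b v y"
  have ac: "a > 0" "c > 0" unfolding a_def c_def by (auto intro!: conf_factor_pos[OF vv] x y)
  have "(norm (y - x))\<^sup>2 = (a * c) * (norm (conf_refl b v y - conf_refl b v x))\<^sup>2"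
    using dist_conf_refl[OF vv y x] by (simp add: a_def c_def mult_ac)
  then have e: "(norm (conf_refl b v y - conf_refl b v x))\<^sup>2 = (norm (y - x))\<^sup>2 / (a * c)"
    using ac by simp
  show ?thesis
    unfolding riesz_def a_def[symmetric] c_def[symmetric] e using ac
    by (simp add: powr_divide powr_mult powr_minus_divide)
qed

text \<open>Uniform integrability comes from \<open>t powr (- \<alpha>) \<le> \<eta> * t powr (- \<beta>) + K\<close> for a slightly larger exponent \<open>\<beta>\<close>.\<close>

lemma small_set_riesz:
  fixes \<alpha> :: real
  assumes \<alpha>: "0 < \<alpha>" "\<alpha> < (real DIM('a) - 1) / 2" and dim: "3 \<le> DIM('a)" and e: "0 < e"
  obtains \<delta> where "0 < \<delta>" "\<And>(E::'a::euclidean_space set) x. E \<in> sets sphere_measure \<Longrightarrow> measure sphere_measure E < \<delta> \<Longrightarrow> norm x = 1 \<Longrightarrow>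
     (LINT y|sphere_measure. indicator E y * riesz \<alpha> y x) < e"
proof -
  obtain \<beta> where \<beta>: "\<alpha> < \<beta>" "\<beta> < (real DIM('a) - 1) / 2" using dense[OF \<alpha>(2)] by blast
  have Ca: "integrable sphere_measure (\<lambda>x. riesz \<alpha> x y)" if "norm y = 1" for y :: 'a
    using riesz_integral_bounded[OF \<alpha> dim] that by blast
  obtain C where C: "0 < C" "\<And>y::'a. norm y = 1 \<Longrightarrow> integrable sphere_measure (\<lambda>x. riesz \<beta> x y)"
    "\<And>y::'a. norm y = 1 \<Longrightarrow> (LINT x|sphere_measure. riesz \<beta> x y) \<le> C"
    using riesz_integral_bounded[OF order.strict_trans[OF \<alpha>(1) \<beta>(1)] \<beta>(2) dim] by blast
  define \<eta> where "\<eta> = e / (3 * C)"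
  have \<eta>: "\<eta> > 0" using e C by (simp add: \<eta>_def)
  \<comment> \<open>The threshold at which \<open>t powr (\<beta> - \<alpha>)\<close> equals
    \<open>\<eta>\<close>. Below it the kernel is at most \<open>\<eta>\<close> times the one with
    exponent \<open>\<beta>\<close>, above it at most \<open>K\<close>. Each of the two resulting
    contributions is at most \<open>e / 3\<close>.\<close>
  define \<tau> where "\<tau> = \<eta> powr (1 / (\<beta> - \<alpha>))"
  have \<tau>: "\<tau> > 0" using \<eta> by (simp add: \<tau>_def)
  define K where "K = \<tau> powr (- \<alpha>)"
  have K: "K > 0" using \<tau> by (simp add: K_def)
  have pt: "riesz \<alpha> y x \<le> \<eta> * riesz \<beta> y x + K" for x y :: 'a
  proof -
    define t where "t = (norm (y - x))\<^sup>2"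
    have t0: "t \<ge> 0" by (simp add: t_def)
    show ?thesis
    proof (cases "t = 0 \<or> \<tau> < t")
      case True
      then have "t powr (- \<alpha>) \<le> K"
        using K powr_mono2'[of "- \<alpha>" \<tau> t] \<tau> \<alpha> by (auto simp: K_def)
      moreover have "0 \<le> \<eta> * riesz \<beta> y x" using \<eta> by (simp add: riesz_nonneg)
      ultimately show ?thesis unfolding riesz_def t_def[symmetric] by linarith
    next
      case False
      then have t: "0 < t" "t \<le> \<tau>" using t0 by auto
      have "t powr (- \<alpha>) = t powr (\<beta> - \<alpha>) * t powr (- \<beta>)" by (simp flip: powr_add)
      also have "\<dots> \<le> \<tau> powr (\<beta> - \<alpha>) * t powr (- \<beta>)"
        using t \<beta> by (intro mult_right_mono powr_mono2) auto
      also have "\<tau> powr (\<beta> - \<alpha>) = \<eta>" using \<eta> \<beta> by (simp add: \<tau>_def powr_powr)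
      finally show ?thesis unfolding riesz_def t_def[symmetric] using K by linarith
    qed
  qed
  show ?thesis
  proof (rule that[of "e / (3 * K)"])
    show "e / (3 * K) > 0" using e K by simp
    fix E :: "'a set" and x :: 'a
    assume E: "E \<in> sets sphere_measure" and small: "measure sphere_measure E < e / (3 * K)" and x: "norm x = 1"
    have iE: "integrable sphere_measure (indicator E :: 'a \<Rightarrow> real)"
      using E by (intro integrable_real_indicator) (auto simp: less_top[symmetric])
    have "(LINT y|sphere_measure. indicator E y * riesz \<alpha> y x) \<le> (LINT y|sphere_measure. \<eta> * riesz \<beta> y x + K * indicator E y)"
    proof (rule integral_mono)
      show "integrable sphere_measure (\<lambda>y. indicator E y * riesz \<alpha> y x)"
        using integrable_real_mult_indicator[OF E Ca[OF x]] by (simp add: mult.commute)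
      show "integrable sphere_measure (\<lambda>y. \<eta> * riesz \<beta> y x + K * indicator E y)"
        using C(2)[OF x] iE by simp
      show "indicator E y * riesz \<alpha> y x \<le> \<eta> * riesz \<beta> y x + K * indicator E y" for y
        using pt[of y x] \<eta> riesz_nonneg[of \<beta> y x] by (auto simp: indicator_def)
    qed
    also have "\<dots> = \<eta> * (LINT y|sphere_measure. riesz \<beta> y x) + K * measure sphere_measure E"
    proof -
      have "E \<inter> sphere 0 1 = E" using sets.sets_into_space[OF E] by auto
      then show ?thesis using C(2)[OF x] iE E by (subst Bochner_Integration.integral_add) auto
    qed
    also have "\<dots> \<le> \<eta> * C + K * (e / (3 * K))"
      using C(3)[OF x] \<eta> K small by (intro add_mono mult_left_mono) auto
    also have "\<dots> < e" using C(1) K e by (simp add: \<eta>_def)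
    finally show "(LINT y|sphere_measure. indicator E y * riesz \<alpha> y x) < e" .
  qed
qed

text \<open>For \<open>c < 1\<close> the cone over the slice lies in the frontier of the convex cone
  \<open>K\<close>, and frontiers of convex sets are negligible. For \<open>c = 1\<close> the slice
  is the single point \<open>\<omega>\<close>.\<close>

lemma sphere_slice_null:
  fixes \<omega> :: "'a::euclidean_space"
  assumes \<omega>: "norm \<omega> = 1" and c: "0 < c" "c \<le> 1" and dim: "2 \<le> DIM('a)"
  shows "measure sphere_measure {x \<in> sphere 0 1. x \<bullet> \<omega> = c} = 0"
proof (cases "c = 1")
  case True
  have "{x \<in> sphere 0 1. x \<bullet> \<omega> = c} \<subseteq> {\<omega>}"
  proof
    fix x assume "x \<in> {x \<in> sphere 0 1. x \<bullet> \<omega> = c}"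
    then have "(norm (x - \<omega>))\<^sup>2 = 0" using True by (subst norm_diff_sq_unit[OF _ \<omega>]) auto
    then show "x \<in> {\<omega>}" by simp
  qed
  moreover have "AE x in sphere_measure. x \<notin> {\<omega>}" using sphere_measure_singleton_null[OF dim, of \<omega>] by simp
  ultimately have "AE x in sphere_measure. x \<notin> {x \<in> sphere 0 1. x \<bullet> \<omega> = c}" by (rule_tac AE_mp) (auto intro!: AE_I2)
  moreover have "{x \<in> sphere 0 1. x \<bullet> \<omega> = c} \<in> sets sphere_measure"
    by (auto simp: sets_restrict_space intro!: image_eqI[of _ _ "{x. x \<bullet> \<omega> = c}"])
  ultimately have "emeasure sphere_measure {x \<in> sphere 0 1. x \<bullet> \<omega> = c} = 0"
    by (subst (asm) AE_iff_measurable[OF _ refl]) (auto simp: Int_def conj_commute cong: conj_cong)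
  then show ?thesis by (simp add: measure_def)
next
  case False
  then have c1: "c < 1" using c by simp
  let ?S = "{x \<in> sphere 0 1. x \<bullet> \<omega> = c}"
  have S: "?S \<in> sets sphere_measure"
    by (auto simp: sets_restrict_space intro!: image_eqI[of _ _ "{x. x \<bullet> \<omega> = c}"])
  define K where "K = {x::'a. c * norm x - x \<bullet> \<omega> \<le> 0}"
  have conv: "convex K"
  proof (rule convexI)
    fix x y :: 'a and a b :: real
    assume xy: "x \<in> K" "y \<in> K" and ab: "0 \<le> a" "0 \<le> b" "a + b = 1"
    have "c * norm (a *\<^sub>R x + b *\<^sub>R y) \<le> c * (a * norm x + b * norm y)"
      using norm_triangle_ineq[of "a *\<^sub>R x" "b *\<^sub>R y"] ab c by (intro mult_left_mono) auto
    also have "\<dots> = a * (c * norm x) + b * (c * norm y)" by (simp add: algebra_simps)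
    also have "\<dots> \<le> a * (x \<bullet> \<omega>) + b * (y \<bullet> \<omega>)"
      using xy ab by (intro add_mono mult_left_mono) (auto simp: K_def)
    finally show "a *\<^sub>R x + b *\<^sub>R y \<in> K" by (simp add: K_def inner_add_left)
  qed
  have sub: "{x. x \<bullet> \<omega> = c * norm x} \<subseteq> frontier K"
  proof
    fix x assume "x \<in> {x. x \<bullet> \<omega> = c * norm x}"
    then have xe: "x \<bullet> \<omega> = c * norm x" by simp
    then have "x \<in> closure K" using closure_subset[of K] by (auto simp: K_def)
    moreover have "x \<notin> interior K"
    proof
      assume "x \<in> interior K"
      then obtain e where e: "e > 0" "ball x e \<subseteq> K" unfolding mem_interior by blast
      have "x - (e / 2) *\<^sub>R \<omega> \<in> ball x e" using e \<omega> by (simp add: dist_norm)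
      then have "x - (e / 2) *\<^sub>R \<omega> \<in> K" using e by blast
      then have "c * norm (x - (e / 2) *\<^sub>R \<omega>) \<le> x \<bullet> \<omega> - e / 2"
        using \<omega> by (simp add: K_def inner_diff_left norm_eq_1)
      moreover have "c * (norm x - e / 2) \<le> c * norm (x - (e / 2) *\<^sub>R \<omega>)"
        using norm_triangle_ineq2[of x "(e / 2) *\<^sub>R \<omega>"] \<omega> e c by (intro mult_left_mono) auto
      ultimately have "e / 2 \<le> c * (e / 2)" using xe by (simp add: algebra_simps)
      then show False using c1 e by simp
    qed
    ultimately show "x \<in> frontier K" by (simp add: frontier_def)
  qed
  have "negligible {x. x \<bullet> \<omega> = c * norm x}"
    by (rule negligible_subset[OF negligible_convex_frontier[OF conv] sub])
  moreover have "closed {x. x \<bullet> \<omega> = c * norm x}"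
    by (intro closed_Collect_eq continuous_intros)
  ultimately have "{x. x \<bullet> \<omega> = c * norm x} \<in> null_sets lborel"
    by (metis borel_closed negligible_iff_null_sets null_sets_completion_iff sets_lborel)
  then have null: "AE x in lborel. x \<notin> {x. x \<bullet> \<omega> = c * norm x}" by (rule AE_not_in)
  have "emeasure sphere_measure ?S = (\<integral>\<^sup>+x. indicator ?S x \<partial>sphere_measure)" using S by simp
  also have "\<dots> = (\<integral>\<^sup>+x. indicator ?S (x /\<^sub>R norm x) * indicator (ball 0 1 - {0}) x \<partial>lborel)"
    using S by (intro nn_integral_sphere_measure) simp
  also have "\<dots> = (\<integral>\<^sup>+x. 0 \<partial>(lborel :: 'a measure))"
  proof (rule nn_integral_cong_AE)
    show "AE x in lborel. indicator ?S (x /\<^sub>R norm x) * indicator (ball 0 1 - {0}) x = (0::ennreal)"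
      using null by eventually_elim (auto simp: indicator_def field_simps)
  qed
  finally show ?thesis by (simp add: measure_def)
qed

lemma sphere_strip_small:
  fixes \<omega> :: "'a::euclidean_space"
  assumes \<omega>: "norm \<omega> = 1" and c: "0 < c" "c \<le> 1" and dim: "2 \<le> DIM('a)" and \<delta>: "0 < \<delta>"
  obtains \<eta> where "0 < \<eta>" "measure sphere_measure {x \<in> sphere 0 1. \<bar>x \<bullet> \<omega> - c\<bar> < \<eta>} < \<delta>"
proof -
  define S where "S k = {x \<in> sphere (0::'a) 1. \<bar>x \<bullet> \<omega> - c\<bar> < 1 / (real k + 1)}" for k
  have Sm: "S k \<in> sets sphere_measure" for k
  proof -
    have "{x. \<bar>x \<bullet> \<omega> - c\<bar> < 1 / (real k + 1)} \<in> sets borel" by measurable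
    then show ?thesis by (auto simp: S_def sets_restrict_space)
  qed
  have dec: "decseq S"
  proof (rule decseq_SucI, rule subsetI)
    fix k x assume "x \<in> S (Suc k)"
    moreover have "1 / (real (Suc k) + 1) \<le> 1 / (real k + 1)" by (intro divide_left_mono) auto
    ultimately show "x \<in> S k" by (auto simp: S_def)
  qed
  have "(\<lambda>k. measure sphere_measure (S k)) \<longlonglongrightarrow> measure sphere_measure (\<Inter>k. S k)"
    by (rule sphere_measure.finite_Lim_measure_decseq) (use Sm dec in auto)
  also have "(\<Inter>k. S k) = {x \<in> sphere 0 1. x \<bullet> \<omega> = c}"
  proof (intro set_eqI iffI)
    fix x assume x: "x \<in> (\<Inter>k. S k)"
    then have "norm x = 1" by (auto simp: S_def)
    moreover have "x \<bullet> \<omega> = c"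
    proof (rule ccontr)
      assume "x \<bullet> \<omega> \<noteq> c"
      then have "\<bar>x \<bullet> \<omega> - c\<bar> > 0" by simp
      then obtain k where "inverse (real (Suc k)) < \<bar>x \<bullet> \<omega> - c\<bar>" using reals_Archimedean by blast
      moreover have "x \<in> S k" using x by blast
      ultimately show False by (simp add: S_def inverse_eq_divide add.commute)
    qed
    ultimately show "x \<in> {x \<in> sphere 0 1. x \<bullet> \<omega> = c}" by simp
  qed (auto simp: S_def)
  also have "measure sphere_measure {x \<in> sphere 0 1. x \<bullet> \<omega> = c} = 0"
    by (rule sphere_slice_null[OF \<omega> c dim])
  finally have "(\<lambda>k. measure sphere_measure (S k)) \<longlonglongrightarrow> 0" .
  then have "\<forall>\<^sub>F k in sequentially. measure sphere_measure (S k) < \<delta>"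
    using \<delta> by (rule order_tendstoD(2))
  then obtain k where "measure sphere_measure (S k) < \<delta>" unfolding eventually_sequentially by blast
  then show ?thesis by (intro that[of "1 / (real k + 1)"]) (auto simp: S_def)
qed

text \<open>\<open>\<Phi> i t\<close> stands for \<open>f_i t + d t_i\<close>, and \<open>\<alpha> = (n - 2 s) / 2\<close>, so that \<open>p = (n + 2 s) / (n - 2 s)\<close>.\<close>

locale riesz_system =
  fixes u :: "'i::finite \<Rightarrow> 'a::euclidean_space \<Rightarrow> real" and \<Phi> :: "'i \<Rightarrow> ('i \<Rightarrow> real) \<Rightarrow> real"
    and n \<alpha> \<kappa> p :: real
  assumes n: "n = real DIM('a) - 1" and dim: "3 \<le> DIM('a)"
    and \<alpha>: "0 < \<alpha>" "\<alpha> < n / 2" and p: "\<alpha> * p = n - \<alpha>" and \<kappa>: "0 < \<kappa>"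
    and u_cont: "\<And>i. continuous_on (sphere 0 1) (u i)" and u_pos: "\<And>i x. norm x = 1 \<Longrightarrow> 0 < u i x"
    and F_cont: "\<And>i. continuous_on (sphere 0 1) (\<lambda>x. \<Phi> i (\<lambda>j. u j x))"
    and \<Phi>_pos: "\<And>i t. (\<And>j. 0 < t j) \<Longrightarrow> 0 < \<Phi> i t"
    and \<Phi>_mono: "\<And>i t t'. (\<And>j. 0 < t j) \<Longrightarrow> (\<And>j. t j \<le> t' j) \<Longrightarrow> \<Phi> i t \<le> \<Phi> i t'"
    and \<Phi>_sub: "\<And>i t r. 0 < r \<Longrightarrow> r < 1 \<Longrightarrow> (\<And>j. 0 < t j) \<Longrightarrow> r powr p * \<Phi> i t < \<Phi> i (\<lambda>j. r * t j)"
    and rep: "\<And>i x. norm x = 1 \<Longrightarrow> u i x = \<kappa> * (LINT y|sphere_measure. riesz \<alpha> y x * \<Phi> i (\<lambda>j. u j y))"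
begin

definition F :: "'i \<Rightarrow> 'a \<Rightarrow> real" where
  "F i x = \<Phi> i (\<lambda>j. u j x)"

text \<open>The Kelvin transform of \<open>u i\<close> under the reflection. The exponent
  \<open>\<alpha>\<close> is the one with which the conformal factors enter
  \<open>riesz_conf_refl\<close>.\<close>

definition u_refl :: "real \<Rightarrow> 'a \<Rightarrow> 'i \<Rightarrow> 'a \<Rightarrow> real" where
  "u_refl b v i x = conf_factor b v x powr (- \<alpha>) * u i (conf_refl b v x)"

text \<open>The source paired with \<open>u_refl\<close> in the integral equation. It is not
  \<open>\<Phi> i\<close> of the reflected solution; comparing the two, in \<open>F_refl_ge\<close>,
  is where the hypothesis on rays acts.\<close>

definition F_refl :: "real \<Rightarrow> 'a \<Rightarrow> 'i \<Rightarrow> 'a \<Rightarrow> real" where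
  "F_refl b v i x = conf_factor b v x powr (- (n - \<alpha>)) * F i (conf_refl b v x)"

text \<open>The kernel that remains when the complement of the cap is folded onto the cap.\<close>

definition refl_kernel :: "real \<Rightarrow> 'a \<Rightarrow> 'a \<Rightarrow> 'a \<Rightarrow> real" where
  "refl_kernel b v x y = riesz \<alpha> y x - conf_factor b v y powr (- \<alpha>) * riesz \<alpha> (conf_refl b v y) x"

lemma p_gt_1: "1 < p"
proof -
  have "\<alpha> * 1 < \<alpha> * p" unfolding p using \<alpha> by simp
  then show ?thesis using \<alpha>(1) mult_less_cancel_left_pos by blast
qed

lemma F_continuous: "continuous_on (sphere 0 1) (F i)"
  using F_cont unfolding F_def .

lemma F_pos: "norm x = 1 \<Longrightarrow> 0 < F i x"
  unfolding F_def by (intro \<Phi>_pos u_pos)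

lemma riesz_integrable:
  assumes "norm (x::'a) = 1"
  shows "integrable sphere_measure (\<lambda>y. riesz \<alpha> y x)"
  using riesz_integral_bounded[OF \<alpha>[unfolded n] dim] assms by blast

lemma riesz_mult_integrable:
  assumes x: "norm (x::'a) = 1" and g: "continuous_on (sphere 0 1) g"
  shows "integrable sphere_measure (\<lambda>y. riesz \<alpha> y x * g y)"
proof -
  obtain B where B: "0 < B" "\<And>x. norm x = 1 \<Longrightarrow> \<bar>g x\<bar> \<le> B" using continuous_sphere_bounded[OF g] by blast
  show ?thesis
  proof (rule Bochner_Integration.integrable_bound)
    show "integrable sphere_measure (\<lambda>y. riesz \<alpha> y x * B)" using riesz_integrable[OF x] by simp
    show "(\<lambda>y. riesz \<alpha> y x * g y) \<in> borel_measurable sphere_measure"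
      using borel_measurable_sphereI[OF g] by measurable
    show "AE y in sphere_measure. norm (riesz \<alpha> y x * g y) \<le> norm (riesz \<alpha> y x * B)"
      using B by (intro AE_I2) (auto simp: abs_mult intro!: mult_left_mono)
  qed
qed

context
  fixes b :: real and v :: 'a
  assumes vv: "v \<bullet> v = 1 + b\<^sup>2"
begin

lemma conf_factor_gt_0: "norm x = 1 \<Longrightarrow> 0 < conf_factor b v x"
  by (rule conf_factor_pos[OF vv])

lemma conf_factor_powr_n:
  assumes "norm x = 1"
  shows "conf_factor b v x powr (- n) = inverse (conf_factor b v x ^ (DIM('a) - 1))"
proof -
  have e: "n = real (DIM('a) - 1)" using n dim by simp
  show ?thesis unfolding e using conf_factor_gt_0[OF assms] by (simp only: powr_minus powr_realpow)
qed

lemma continuous_on_refl_comp: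
  assumes "continuous_on (sphere 0 1) g"
  shows "continuous_on (sphere 0 1) (\<lambda>x. g (conf_refl b v x))"
  by (rule continuous_on_compose2[OF assms continuous_on_conf_refl[OF vv]])
     (auto simp: norm_conf_refl[OF vv])

lemma continuous_on_conf_powr: "continuous_on (sphere 0 1) (\<lambda>x. conf_factor b v x powr e)"
proof (intro continuous_on_powr continuous_on_conf_factor continuous_on_const ballI)
  fix x :: 'a assume "x \<in> sphere 0 1"
  then show "conf_factor b v x \<noteq> 0" using conf_factor_gt_0[of x] by auto
qed

lemma F_refl_continuous: "continuous_on (sphere 0 1) (F_refl b v i)"
  unfolding F_refl_def by (rule continuous_on_mult[OF continuous_on_conf_powr continuous_on_refl_comp[OF F_continuous]])

lemma u_refl_pos: "norm x = 1 \<Longrightarrow> 0 < u_refl b v i x"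
  unfolding u_refl_def using conf_factor_gt_0[of x] u_pos[OF norm_conf_refl[OF vv]] by simp

text \<open>In the substitution the kernel contributes the power \<open>\<alpha>\<close> of the
  factors at \<open>x\<close> and at \<open>y\<close>, and the measure the power \<open>- n\<close>
  at \<open>y\<close>. Together they give the exponent \<open>- (n - \<alpha>)\<close> of
  \<open>F_refl\<close>.\<close>

lemma u_refl_rep:
  assumes x: "norm x = 1"
  shows "u_refl b v i x = \<kappa> * (LINT y|sphere_measure. riesz \<alpha> y x * F_refl b v i y)"
proof -
  let ?A = "conf_factor b v" and ?\<sigma> = "conf_refl b v"
  have sx: "norm (?\<sigma> x) = 1" by (rule norm_conf_refl[OF vv x])
  have "(LINT y|sphere_measure. riesz \<alpha> y (?\<sigma> x) * F i y)
     = (LINT y|sphere_measure. riesz \<alpha> (?\<sigma> y) (?\<sigma> x) * F i (?\<sigma> y) / ?A y ^ (DIM('a) - 1))"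
    using lint_conf_refl(2)[OF vv riesz_mult_integrable[OF sx F_continuous]] dim by simp
  also have "\<dots> = (LINT y|sphere_measure. ?A x powr \<alpha> * (riesz \<alpha> y x * F_refl b v i y))"
  proof (rule Bochner_Integration.integral_cong[OF refl])
    fix y :: 'a assume "y \<in> space sphere_measure"
    then have y: "norm y = 1" by simp
    have "?A y powr (- (n - \<alpha>)) = ?A y powr \<alpha> * ?A y powr (- n)" by (simp flip: powr_add)
    also have "?A y powr (- n) = inverse (?A y ^ (DIM('a) - 1))"
      by (rule conf_factor_powr_n[OF y])
    finally show "riesz \<alpha> (?\<sigma> y) (?\<sigma> x) * F i (?\<sigma> y) / ?A y ^ (DIM('a) - 1) = ?A x powr \<alpha> * (riesz \<alpha> y x * F_refl b v i y)"
      unfolding riesz_conf_refl[OF vv x y] F_refl_def by (simp add: divide_inverse mult_ac)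
  qed
  finally have "u i (?\<sigma> x) = \<kappa> * (?A x powr \<alpha> * (LINT y|sphere_measure. riesz \<alpha> y x * F_refl b v i y))"
    using rep[OF sx, of i] by (simp add: F_def)
  moreover have "?A x powr (- \<alpha>) * ?A x powr \<alpha> = 1" using conf_factor_gt_0[OF x] by (simp flip: powr_add)
  moreover have "c * (\<kappa> * (d * I)) = \<kappa> * ((c * d) * I)" for c d I :: real by (simp only: mult_ac)
  ultimately show ?thesis unfolding u_refl_def by (simp only: mult_1)
qed

text \<open>The difference \<open>G\<close> of the sources is antisymmetric up to a weight: at the
  reflected point it is minus the power \<open>n - \<alpha>\<close> of the factor times
  \<open>G y\<close>. Folding the complement onto the cap therefore reverses the sign and subtracts
  the reflected kernel. On the mirror \<open>G\<close> vanishes, so the boundary contributes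
  nothing.\<close>

lemma refl_kernel_integral:
  assumes x: "norm x = 1"
  shows "integrable sphere_measure (\<lambda>y. indicator {y. b < y \<bullet> v} y * (refl_kernel b v x y * (F_refl b v i y - F i y)))"
    and "u_refl b v i x - u i x = \<kappa> * (LINT y|sphere_measure. indicator {y. b < y \<bullet> v} y * (refl_kernel b v x y * (F_refl b v i y - F i y)))"
proof -
  let ?A = "conf_factor b v" and ?\<sigma> = "conf_refl b v"
  define G where "G y = F_refl b v i y - F i y" for y
  have Gc: "continuous_on (sphere 0 1) G"
    unfolding G_def by (intro continuous_intros F_refl_continuous F_continuous)
  have Gs: "G (?\<sigma> y) = - (?A y powr (n - \<alpha>) * G y)" if y: "norm y = 1" for y
  proof -
    have "?A y powr (n - \<alpha>) * ?A y powr (- (n - \<alpha>)) = 1" using conf_factor_gt_0[OF y] by (simp flip: powr_add)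
    moreover have "(1 / ?A y) powr (- (n - \<alpha>)) = ?A y powr (n - \<alpha>)"
    proof -
      have "(1 / a) powr (- e) = a powr e" if "a > 0" for a e :: real
        using that by (simp add: powr_divide powr_minus)
      then show ?thesis using conf_factor_gt_0[OF y] .
    qed
    ultimately show ?thesis
      unfolding G_def F_refl_def conf_refl_conf_refl[OF vv y] conf_factor_refl[OF vv y]
      by (simp add: algebra_simps)
  qed
  have iG: "integrable sphere_measure (\<lambda>y. riesz \<alpha> y x * G y)" by (rule riesz_mult_integrable[OF x Gc])
  have S1: "{y \<in> sphere 0 1. b < y \<bullet> v} \<in> sets sphere_measure"
  proof -
    have "{y. b < y \<bullet> v} \<in> sets borel" by measurable
    then show ?thesis by (auto simp: sets_restrict_space)
  qed
  have S2: "{y \<in> sphere 0 1. y \<bullet> v < b} \<in> sets sphere_measure"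
  proof -
    have "{y. y \<bullet> v < b} \<in> sets borel" by measurable
    then show ?thesis by (auto simp: sets_restrict_space)
  qed
  define P where "P y = indicator {y \<in> sphere 0 1. b < y \<bullet> v} y * (riesz \<alpha> y x * G y)" for y
  define Q where "Q y = indicator {y \<in> sphere 0 1. y \<bullet> v < b} y * (riesz \<alpha> y x * G y)" for y
  have iP: "integrable sphere_measure P" and iQ: "integrable sphere_measure Q"
    unfolding P_def Q_def using integrable_real_mult_indicator[OF S1 iG] integrable_real_mult_indicator[OF S2 iG]
    by (simp_all add: mult.commute)
  have TQ: "Q (?\<sigma> y) / ?A y ^ (DIM('a) - 1)
     = - (indicator {y. b < y \<bullet> v} y * (?A y powr (- \<alpha>) * riesz \<alpha> (?\<sigma> y) x * G y))" if y: "norm y = 1" for y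
  proof -
    have sy: "norm (?\<sigma> y) = 1" by (rule norm_conf_refl[OF vv y])
    have "?\<sigma> y \<bullet> v < b \<longleftrightarrow> b < y \<bullet> v"
    proof -
      have "?\<sigma> y \<bullet> v < b \<longleftrightarrow> ?A y * (?\<sigma> y \<bullet> v - b) < 0"
        using conf_factor_gt_0[OF y] by (simp add: mult_less_0_iff)
      then show ?thesis unfolding conf_refl_height[OF vv y] by simp
    qed
    then have i: "indicator {y \<in> sphere 0 1. y \<bullet> v < b} (?\<sigma> y) = (indicator {y. b < y \<bullet> v} y :: real)"
      using sy by (simp add: indicator_def)
    have "?A y powr (- \<alpha>) = ?A y powr (n - \<alpha>) * ?A y powr (- n)" by (simp flip: powr_add)
    also have "?A y powr (- n) = inverse (?A y ^ (DIM('a) - 1))"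
      by (rule conf_factor_powr_n[OF y])
    finally show ?thesis unfolding Q_def i Gs[OF y] by (simp add: divide_inverse mult_ac)
  qed
  have iT: "integrable sphere_measure (\<lambda>y. Q (?\<sigma> y) / ?A y ^ (DIM('a) - 1))"
    and vT: "(LINT y|sphere_measure. Q (?\<sigma> y) / ?A y ^ (DIM('a) - 1)) = (LINT y|sphere_measure. Q y)"
    using lint_conf_refl[OF vv iQ] dim by auto
  have sum: "P y + Q (?\<sigma> y) / ?A y ^ (DIM('a) - 1)
      = indicator {y. b < y \<bullet> v} y * (refl_kernel b v x y * (F_refl b v i y - F i y))" if "norm y = 1" for y
    using that unfolding TQ[OF that] P_def refl_kernel_def G_def by (simp add: indicator_def algebra_simps)
  have "integrable sphere_measure (\<lambda>y. P y + Q (?\<sigma> y) / ?A y ^ (DIM('a) - 1))" using iP iT by simp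
  then show "integrable sphere_measure (\<lambda>y. indicator {y. b < y \<bullet> v} y * (refl_kernel b v x y * (F_refl b v i y - F i y)))"
    by (subst (asm) Bochner_Integration.integrable_cong[OF refl sum]) auto
  have PQ: "riesz \<alpha> y x * G y = P y + Q y" if y: "norm y = 1" for y
  proof (cases "y \<bullet> v = b")
    case True
    then have "?A y = 1" "?\<sigma> y = y"
      by (auto simp: conf_factor_def conf_refl_def inner_commute power2_eq_square)
    then have "G y = 0" by (simp add: G_def F_refl_def)
    then show ?thesis by (simp add: P_def Q_def)
  next
    case False
    then show ?thesis using y by (auto simp: P_def Q_def indicator_def)
  qed
  have "u_refl b v i x - u i x = \<kappa> * ((LINT y|sphere_measure. riesz \<alpha> y x * F_refl b v i y) - (LINT y|sphere_measure. riesz \<alpha> y x * F i y))"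
    unfolding u_refl_rep[OF x] rep[OF x, of i] F_def by (simp add: right_diff_distrib)
  also have "(LINT y|sphere_measure. riesz \<alpha> y x * F_refl b v i y) - (LINT y|sphere_measure. riesz \<alpha> y x * F i y)
      = (LINT y|sphere_measure. riesz \<alpha> y x * G y)"
    unfolding G_def right_diff_distrib
    by (intro Bochner_Integration.integral_diff[symmetric] riesz_mult_integrable[OF x] F_refl_continuous F_continuous)
  also have "\<dots> = (LINT y|sphere_measure. P y + Q y)"
    by (intro Bochner_Integration.integral_cong refl PQ) auto
  also have "\<dots> = (LINT y|sphere_measure. P y) + (LINT y|sphere_measure. Q (?\<sigma> y) / ?A y ^ (DIM('a) - 1))"
    unfolding vT by (rule Bochner_Integration.integral_add[OF iP iQ])
  also have "\<dots> = (LINT y|sphere_measure. P y + Q (?\<sigma> y) / ?A y ^ (DIM('a) - 1))"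
    by (rule Bochner_Integration.integral_add[symmetric, OF iP iT])
  also have "\<dots> = (LINT y|sphere_measure. indicator {y. b < y \<bullet> v} y * (refl_kernel b v x y * (F_refl b v i y - F i y)))"
    by (intro Bochner_Integration.integral_cong refl sum) auto
  finally show "u_refl b v i x - u i x = \<kappa> * (LINT y|sphere_measure. indicator {y. b < y \<bullet> v} y * (refl_kernel b v x y * (F_refl b v i y - F i y)))" .
qed

text \<open>By \<open>conf_refl_inner\<close>, \<open>y\<close> is nearer to \<open>x\<close> than
  its rescaled mirror image, since both heights are positive, and the Riesz power is decreasing in
  the distance. The diagonal is excluded because \<open>riesz\<close> is 0 there.\<close>

lemma refl_kernel_bounds:
  assumes x: "norm x = 1" "b < x \<bullet> v" and y: "norm y = 1" "b < y \<bullet> v" and ne: "y \<noteq> x"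
  shows "0 < refl_kernel b v x y" "refl_kernel b v x y \<le> riesz \<alpha> y x"
proof -
  let ?A = "conf_factor b v" and ?\<sigma> = "conf_refl b v"
  have A: "0 < ?A y" by (rule conf_factor_gt_0[OF y(1)])
  have "?A y * (norm (x - ?\<sigma> y))\<^sup>2 = (norm (x - y))\<^sup>2 + 4 * (x \<bullet> v - b) * (y \<bullet> v - b)"
    by (rule conf_refl_inner[OF vv x(1) y(1)])
  moreover have "0 < 4 * (x \<bullet> v - b) * (y \<bullet> v - b)" using x y by simp
  ultimately have lt: "(norm (y - x))\<^sup>2 < ?A y * (norm (?\<sigma> y - x))\<^sup>2" by (simp add: norm_minus_commute)
  have pos: "0 < (norm (y - x))\<^sup>2" using ne by simp
  have "?A y powr (- \<alpha>) * riesz \<alpha> (?\<sigma> y) x = (?A y * (norm (?\<sigma> y - x))\<^sup>2) powr (- \<alpha>)"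
    unfolding riesz_def using A by (simp add: powr_mult)
  also have "\<dots> < ((norm (y - x))\<^sup>2) powr (- \<alpha>)"
    using lt pos \<alpha> by (intro powr_less_mono2_neg) auto
  finally show "0 < refl_kernel b v x y" unfolding refl_kernel_def riesz_def by simp
  show "refl_kernel b v x y \<le> riesz \<alpha> y x"
    unfolding refl_kernel_def using A by (simp add: riesz_nonneg)
qed

text \<open>For \<open>b > 0\<close> the conformal factor \<open>A\<close> is below 1 inside the
  cap. \<open>\<Phi>_sub\<close> is applied with \<open>r = A powr \<alpha>\<close>, for which
  \<open>r powr p = A powr (n - \<alpha>)\<close>. For \<open>b = 0\<close> the factor is 1 and both
  sides coincide.\<close>

lemma F_refl_ge:
  assumes b: "0 \<le> b" and y: "norm y = 1" "b < y \<bullet> v"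
  shows "\<Phi> i (\<lambda>j. u_refl b v j y) \<le> F_refl b v i y"
    and "0 < b \<Longrightarrow> \<Phi> i (\<lambda>j. u_refl b v j y) < F_refl b v i y"
proof -
  let ?A = "conf_factor b v" and ?\<sigma> = "conf_refl b v"
  have A: "0 < ?A y" by (rule conf_factor_gt_0[OF y(1)])
  have Ae: "?A y = 1 - 2 * b * (y \<bullet> v - b)"
    by (simp add: conf_factor_def inner_commute power2_eq_square algebra_simps)
  have strict: "\<Phi> i (\<lambda>j. u_refl b v j y) < F_refl b v i y" if "0 < b"
  proof -
    have "?A y < 1" unfolding Ae using that y by simp
    define r where "r = ?A y powr \<alpha>"
    have r: "0 < r" "r < 1"
      using A powr_less_mono2[of \<alpha> "?A y" 1] \<open>?A y < 1\<close> \<alpha> by (auto simp: r_def)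
    have "r * u_refl b v j y = u j (?\<sigma> y)" for j
      using A unfolding u_refl_def r_def by (simp add: mult.assoc[symmetric] flip: powr_add)
    then have "r powr p * \<Phi> i (\<lambda>j. u_refl b v j y) < F i (?\<sigma> y)"
      using \<Phi>_sub[OF r, of "\<lambda>j. u_refl b v j y" i] u_refl_pos[OF y(1)] by (simp add: F_def)
    moreover have rp: "r powr p = ?A y powr (n - \<alpha>)" unfolding r_def by (simp add: powr_powr p)
    ultimately have "?A y powr (- (n - \<alpha>)) * (?A y powr (n - \<alpha>) * \<Phi> i (\<lambda>j. u_refl b v j y)) < ?A y powr (- (n - \<alpha>)) * F i (?\<sigma> y)"
      using A by (intro mult_strict_left_mono) auto
    moreover have "?A y powr (- (n - \<alpha>)) * ?A y powr (n - \<alpha>) = 1" using A by (simp flip: powr_add)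
    ultimately show ?thesis unfolding F_refl_def by (simp add: mult.assoc[symmetric])
  qed
  then show "0 < b \<Longrightarrow> \<Phi> i (\<lambda>j. u_refl b v j y) < F_refl b v i y" .
  show "\<Phi> i (\<lambda>j. u_refl b v j y) \<le> F_refl b v i y"
  proof (cases "b = 0")
    case True
    then have "?A y = 1" by (simp add: conf_factor_def)
    then show ?thesis by (simp add: F_refl_def u_refl_def F_def)
  next
    case False
    then show ?thesis using strict b by simp
  qed
qed

end

end

text \<open>From \<open>exp z \<ge> 1 + z\<close> and \<open>ln z \<le> z - 1\<close>. It makes the
  loss \<open>1 - r powr p\<close> linear in \<open>1 - r\<close> once \<open>r\<close> stays away
  from 0, as a Lipschitz estimate would.\<close>

lemma one_minus_powr_le:
  fixes r p :: real
  assumes "0 < r" "0 \<le> p"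
  shows "1 - r powr p \<le> p * (1 / r - 1)"
proof -
  have "ln (1 / r) \<le> 1 / r - 1" using assms by (intro ln_le_minus_one) simp
  then have "- ln r \<le> 1 / r - 1" using assms by (simp add: ln_div)
  then have "p * - ln r \<le> p * (1 / r - 1)" using assms by (intro mult_left_mono)
  moreover have "1 + p * ln r \<le> r powr p"
    using exp_ge_add_one_self[of "p * ln r"] assms by (simp add: powr_def)
  ultimately show ?thesis by simp
qed

context riesz_system
begin

lemma u_lower: obtains m where "0 < m" "\<And>i x. norm x = 1 \<Longrightarrow> m \<le> u i x"
proof -
  obtain e :: 'a where e: "norm e = 1" using vector_choose_size[of 1] by auto
  have "\<exists>m>0. \<forall>x. norm x = 1 \<longrightarrow> m \<le> u i x" for i
  proof -
    have "sphere (0::'a) 1 \<noteq> {}" using e by auto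
    from continuous_attains_inf[OF compact_sphere this u_cont[of i]]
    obtain z where "norm z = 1" "\<forall>x\<in>sphere 0 1. u i z \<le> u i x" by auto
    then show ?thesis using u_pos[of z i] by (intro exI[of _ "u i z"]) auto
  qed
  then obtain m where m: "\<And>i. 0 < m i" "\<And>i x. norm x = 1 \<Longrightarrow> m i \<le> u i x" by metis
  have "Min (range m) > 0" using m(1) by (subst Min_gr_iff) auto
  moreover have "Min (range m) \<le> u i x" if "norm x = 1" for i x
  proof -
    have "Min (range m) \<le> m i" by (rule Min_le) auto
    then show ?thesis using m(2)[OF that, of i] by linarith
  qed
  ultimately show ?thesis using that by blast
qed

lemma family_upper:
  assumes "\<And>i. continuous_on (sphere 0 1) (g i)"
  obtains B where "0 < B" "\<And>(i::'i) (x::'a). norm x = 1 \<Longrightarrow> g i x \<le> (B::real)"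
proof -
  have "\<exists>B>0. \<forall>x. norm x = 1 \<longrightarrow> g i x \<le> B" for i
  proof -
    obtain B where "0 < B" "\<And>x. norm x = 1 \<Longrightarrow> \<bar>g i x\<bar> \<le> B"
      using continuous_sphere_bounded[OF assms[of i]] by blast
    then show ?thesis by (intro exI[of _ B]) (auto simp: abs_le_iff)
  qed
  then obtain B where B: "\<And>i. 0 < B i" "\<And>i x. norm x = 1 \<Longrightarrow> g i x \<le> B i" by metis
  have le: "B i \<le> Max (range B)" for i by (rule Max_ge) auto
  show ?thesis
  proof (rule that[of "Max (range B)"])
    show "0 < Max (range B)" using B(1)[of undefined] le[of undefined] by linarith
    show "g i x \<le> Max (range B)" if "norm x = 1" for i x using B(2)[OF that, of i] le[of i] by linarith
  qed
qed

text \<open>If \<open>M\<close> is the largest violation of \<open>u \<le> u_refl\<close>, then \<open>u_refl \<ge> (1 - M/m) u\<close> and the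
  subhomogeneity of \<open>\<Phi>\<close> bounds \<open>F - F_refl\<close> by a multiple of \<open>M\<close> on \<open>E\<close>; integrating yields \<open>M \<le> M/2\<close>.\<close>

lemma narrow_region:
  obtains e where "0 < e"
    "\<And>b v E i x. v \<bullet> v = 1 + b\<^sup>2 \<Longrightarrow> 0 \<le> b \<Longrightarrow> E \<in> sets sphere_measure \<Longrightarrow>
       (\<And>y j. norm y = 1 \<Longrightarrow> b < y \<bullet> v \<Longrightarrow> y \<notin> E \<Longrightarrow> u j y \<le> u_refl b v j y) \<Longrightarrow>
       (\<And>z. norm z = 1 \<Longrightarrow> (LINT y|sphere_measure. indicator E y * riesz \<alpha> y z) < e) \<Longrightarrow>
       norm x = 1 \<Longrightarrow> b < x \<bullet> v \<Longrightarrow> u i x \<le> u_refl b v i x"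
proof -
  obtain m where m: "0 < m" "\<And>i x. norm x = 1 \<Longrightarrow> m \<le> u i x" using u_lower by blast
  obtain U where U: "0 < U" "\<And>i x. norm x = 1 \<Longrightarrow> u i x \<le> U" using family_upper[of u, OF u_cont] by blast
  obtain Fm where Fm: "0 < Fm" "\<And>i x. norm x = 1 \<Longrightarrow> F i x \<le> Fm" using family_upper[of F, OF F_continuous] by blast
  \<comment> \<open>On \<open>E\<close> the source drops by at most
    \<open>Fm * 2 * p * (M / m) = c * M\<close>. The value of \<open>e\<close> below then makes the
    integrated loss equal to \<open>M / 2\<close>.\<close>
  define c where "c = 2 * p * Fm / m"
  have c: "c > 0" using p_gt_1 Fm m by (simp add: c_def)
  define e where "e = 1 / (2 * \<kappa> * c)"
  have e: "e > 0" using \<kappa> c by (simp add: e_def)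
  show ?thesis
  proof (rule that[OF e])
    fix b v E i0 x0
    assume vv: "v \<bullet> v = 1 + b\<^sup>2" and b: "0 \<le> b" and E: "E \<in> sets sphere_measure"
      and out: "\<And>y j. norm y = 1 \<Longrightarrow> b < y \<bullet> v \<Longrightarrow> y \<notin> E \<Longrightarrow> u j y \<le> u_refl b v j y"
      and small: "\<And>z. norm z = 1 \<Longrightarrow> (LINT y|sphere_measure. indicator E y * riesz \<alpha> y z) < e"
      and x0: "norm x0 = 1" "b < x0 \<bullet> v"
    show "u i0 x0 \<le> u_refl b v i0 x0"
    proof (rule ccontr)
      assume bad: "\<not> u i0 x0 \<le> u_refl b v i0 x0"
      \<comment> \<open>The supremum runs over all components at once, because
        \<open>\<Phi> i\<close> depends on all of them and one ratio \<open>r\<close> has to serve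
        every \<open>j\<close>. It need not be attained, as the cap is open.\<close>
      define S where "S = {u i x - u_refl b v i x | i x. norm x = 1 \<and> b < x \<bullet> v}"
      define M where "M = Sup S"
      have S0: "u i0 x0 - u_refl b v i0 x0 \<in> S" unfolding S_def using x0 by blast
      have bdd: "bdd_above S"
      proof (rule bdd_aboveI)
        fix t assume "t \<in> S"
        then obtain i x where "t = u i x - u_refl b v i x" "norm x = 1" unfolding S_def by blast
        then show "t \<le> U" using U(2)[of x i] u_refl_pos[OF vv, of x i] by linarith
      qed
      have M: "0 < M" using cSup_upper[OF S0 bdd] bad unfolding M_def by linarith
      have ub: "u j y - u_refl b v j y \<le> M" if "norm y = 1" "b < y \<bullet> v" for j y
        unfolding M_def using that by (intro cSup_upper bdd) (auto simp: S_def)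
      have pt: "F i y - F_refl b v i y \<le> c * M * indicator E y" if y: "norm y = 1" "b < y \<bullet> v" for i y
      proof (cases "y \<in> E")
        case False
        have "F i y \<le> \<Phi> i (\<lambda>j. u_refl b v j y)"
          unfolding F_def by (intro \<Phi>_mono u_pos y out False)
        also have "\<dots> \<le> F_refl b v i y" by (rule F_refl_ge(1)[OF vv b y])
        finally show ?thesis using False by simp
      next
        case True
        have Fr: "0 < F_refl b v i y"
        proof -
          have "0 < \<Phi> i (\<lambda>j. u_refl b v j y)" by (intro \<Phi>_pos u_refl_pos[OF vv y(1)])
          then show ?thesis using F_refl_ge(1)[OF vv b y, of i] by linarith
        qed
        have "F i y - F_refl b v i y \<le> c * M"
        proof (cases "M \<ge> m / 2")
          \<comment> \<open>A large violation: \<open>1 - M / m\<close> may then be too small or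
            negative, but \<open>Fm \<le> c * M\<close> already holds because
            \<open>p > 1\<close>.\<close>
          case True
          have "Fm * 1 \<le> Fm * p" using Fm p_gt_1 by (intro mult_left_mono) auto
          also have "\<dots> = c * (m / 2)" using m by (simp add: c_def)
          also have "\<dots> \<le> c * M" using True c by (intro mult_left_mono) auto
          finally show ?thesis using Fm(2)[OF y(1), of i] Fr by linarith
        next
          case False
          define r where "r = 1 - M / m"
          have r: "1 / 2 < r" "r < 1" using False M m by (auto simp: r_def field_simps)
          have ru: "r * u j y \<le> u_refl b v j y" for j
          proof -
            have "M * 1 \<le> M * (u j y / m)" using M m(1) m(2)[OF y(1), of j] by (intro mult_left_mono) auto
            moreover have "r * u j y = u j y - M * (u j y / m)" by (simp add: r_def algebra_simps)
            ultimately show ?thesis using ub[OF y, of j] by linarith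
          qed
          have "r powr p * F i y \<le> \<Phi> i (\<lambda>j. r * u j y)"
            unfolding F_def using r u_pos[OF y(1)] by (intro less_imp_le \<Phi>_sub) auto
          also have "\<dots> \<le> \<Phi> i (\<lambda>j. u_refl b v j y)"
            using r u_pos[OF y(1)] ru by (intro \<Phi>_mono) auto
          also have "\<dots> \<le> F_refl b v i y" by (rule F_refl_ge(1)[OF vv b y])
          finally have "F i y - F_refl b v i y \<le> F i y * (1 - r powr p)" by (simp add: algebra_simps)
          also have "\<dots> \<le> Fm * (2 * p * (M / m))"
          proof (rule mult_mono)
            have "1 - r powr p \<le> p * (1 / r - 1)" using r p_gt_1 by (intro one_minus_powr_le) auto
            also have "1 / r - 1 \<le> 2 * (1 - r)"
            proof -
              have "1 / r - 1 = (1 - r) * (1 / r)" using r by (simp add: field_simps)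
              also have "\<dots> \<le> (1 - r) * 2" using r by (intro mult_left_mono) (auto simp: field_simps)
              finally show ?thesis by simp
            qed
            then have "p * (1 / r - 1) \<le> p * (2 * (1 - r))" using p_gt_1 by (intro mult_left_mono) auto
            finally show "1 - r powr p \<le> 2 * p * (M / m)" by (simp add: r_def mult_ac)
            show "0 \<le> 1 - r powr p" using r p_gt_1 powr_le1[of p r] by simp
          qed (use Fm(2)[OF y(1)] Fm(1) in auto)
          also have "\<dots> = c * M" by (simp add: c_def)
          finally show ?thesis .
        qed
        then show ?thesis using True by simp
      qed
      have half: "u i x - u_refl b v i x \<le> M / 2" if x: "norm x = 1" "b < x \<bullet> v" for i x
      proof -
        let ?f = "\<lambda>y. indicator {y. b < y \<bullet> v} y * (refl_kernel b v x y * (F_refl b v i y - F i y))"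
        let ?g = "\<lambda>y. indicator E y * riesz \<alpha> y x"
        have ig: "integrable sphere_measure ?g"
          using integrable_real_mult_indicator[OF E riesz_integrable[OF x(1)]] by (simp add: mult.commute)
        have "u i x - u_refl b v i x = \<kappa> * (LINT y|sphere_measure. - ?f y)"
          using refl_kernel_integral(2)[OF vv x(1), of i] by simp
        also have "\<dots> \<le> \<kappa> * (LINT y|sphere_measure. c * M * ?g y)"
        proof (intro mult_left_mono integral_mono_AE)
          show "integrable sphere_measure (\<lambda>y. - ?f y)"
            using refl_kernel_integral(1)[OF vv x(1), of i] by simp
          show "integrable sphere_measure (\<lambda>y. c * M * ?g y)" using ig by simp
          have "AE y in sphere_measure. y \<noteq> x" using dim by (intro sphere_measure_singleton_null) simp
          then show "AE y in sphere_measure. - ?f y \<le> c * M * ?g y"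
            using AE_space
          proof eventually_elim
            case (elim y)
            then have y: "norm y = 1" by simp
            show ?case
            proof (cases "b < y \<bullet> v")
              case True
              have Q: "0 \<le> refl_kernel b v x y" "refl_kernel b v x y \<le> riesz \<alpha> y x"
                using refl_kernel_bounds[OF vv x y True elim(1)] by auto
              have "- ?f y = refl_kernel b v x y * (F i y - F_refl b v i y)"
                using True by (simp add: algebra_simps)
              also have "\<dots> \<le> refl_kernel b v x y * (c * M * indicator E y)"
                by (intro mult_left_mono pt[OF y True] Q)
              also have "\<dots> \<le> riesz \<alpha> y x * (c * M * indicator E y)"
                using c M by (intro mult_right_mono Q) auto
              finally show ?thesis by (simp only: mult_ac)
            next
              case False
              then show ?thesis using c M by (simp add: riesz_nonneg)
            qed
          qed
        qed (use \<kappa> in auto)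
        also have "\<dots> = \<kappa> * c * M * (LINT y|sphere_measure. ?g y)" by simp
        also have "\<dots> \<le> \<kappa> * c * M * e" using small[OF x(1)] \<kappa> c M by (intro mult_left_mono) auto
        also have "\<dots> = M / 2" using \<kappa> c by (simp add: e_def)
        finally show ?thesis .
      qed
      have "M \<le> M / 2"
        unfolding M_def[of] using S0 half by (intro cSup_least) (auto simp: S_def M_def)
      then show False using M by simp
    qed
  qed
qed

text \<open>For \<open>b > 0\<close> the sources are already strictly ordered by
  \<open>F_refl_ge\<close>, and the kernel is positive, so the integrand is positive on a nonempty
  open cap up to one point. Strictness thus arises even if \<open>u\<close> and
  \<open>u_refl\<close> were assumed equal, and no such alternative has to be excluded.\<close>

lemma refl_strict:
  assumes vv: "v \<bullet> v = 1 + b\<^sup>2" and b: "0 < b"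
    and good: "\<And>y j. norm y = 1 \<Longrightarrow> b < y \<bullet> v \<Longrightarrow> u j y \<le> u_refl b v j y"
    and x: "norm x = 1" "b < x \<bullet> v"
  shows "u i x < u_refl b v i x"
proof -
  let ?f = "\<lambda>y. indicator {y. b < y \<bullet> v} y * (refl_kernel b v x y * (F_refl b v i y - F i y))"
  have pos: "0 < ?f y" if y: "norm y = 1" "b < y \<bullet> v" "y \<noteq> x" for y
  proof -
    have "F i y \<le> \<Phi> i (\<lambda>j. u_refl b v j y)"
      unfolding F_def by (intro \<Phi>_mono u_pos y(1,2) good)
    also have "\<dots> < F_refl b v i y" using F_refl_ge(2)[OF vv _ y(1,2) b] b by simp
    finally show ?thesis using refl_kernel_bounds(1)[OF vv x y] y by simp
  qed
  have ne: "AE y in sphere_measure. y \<noteq> x" using dim by (intro sphere_measure_singleton_null) simp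
  have int: "integrable sphere_measure ?f" by (rule refl_kernel_integral(1)[OF vv x(1)])
  have nn: "AE y in sphere_measure. 0 \<le> ?f y"
    using ne AE_space
  proof eventually_elim
    case (elim y)
    then show ?case using pos[of y] by (cases "b < y \<bullet> v") auto
  qed
  have "(LINT y|sphere_measure. ?f y) \<noteq> 0"
  proof
    assume "(LINT y|sphere_measure. ?f y) = 0"
    then have "AE y in sphere_measure. ?f y = 0" using integral_nonneg_eq_0_iff_AE[OF int nn] by simp
    then have "AE y in sphere_measure. y \<notin> sphere 0 1 \<inter> {y. b < y \<bullet> v}"
      using ne AE_space
    proof eventually_elim
      case (elim y)
      then show ?case using pos[of y] by auto
    qed
    moreover have o: "open {y. b < y \<bullet> v}" by (intro open_Collect_less continuous_intros)
    then have "sphere 0 1 \<inter> {y. b < y \<bullet> v} \<in> sets sphere_measure" by (auto simp: sets_restrict_space)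
    ultimately have "emeasure sphere_measure (sphere 0 1 \<inter> {y. b < y \<bullet> v}) = 0"
      by (subst (asm) AE_iff_measurable[where N = "sphere 0 1 \<inter> {y. b < y \<bullet> v}"]) auto
    then show False using emeasure_sphere_open_pos[OF o, of x] x by simp
  qed
  moreover have "0 \<le> (LINT y|sphere_measure. ?f y)" by (rule integral_nonneg_AE[OF nn])
  ultimately have "0 < \<kappa> * (LINT y|sphere_measure. ?f y)" using \<kappa> by simp
  then show ?thesis using refl_kernel_integral(2)[OF vv x(1), of i] by linarith
qed

text \<open>The reflection exchanging \<open>{x. c < x \<bullet> \<omega>}\<close> with its complement, for \<open>0 \<le> c < 1\<close>.\<close>

definition cap_refl :: "'a \<Rightarrow> real \<Rightarrow> 'i \<Rightarrow> 'a \<Rightarrow> real" where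
  "cap_refl \<omega> c = u_refl (c / sqrt (1 - c\<^sup>2)) (\<omega> /\<^sub>R sqrt (1 - c\<^sup>2))"

text \<open>Dividing the Minkowski vector \<open>(c, \<omega>)\<close> by its length
  \<open>sqrt (1 - c^2)\<close> gives the spacelike unit vector required by the reflections.\<close>

lemma cap_param:
  assumes \<omega>: "norm \<omega> = 1" and c: "0 \<le> c" "c < 1"
  shows "(\<omega> /\<^sub>R sqrt (1 - c\<^sup>2)) \<bullet> (\<omega> /\<^sub>R sqrt (1 - c\<^sup>2)) = 1 + (c / sqrt (1 - c\<^sup>2))\<^sup>2"
    and "c / sqrt (1 - c\<^sup>2) < y \<bullet> (\<omega> /\<^sub>R sqrt (1 - c\<^sup>2)) \<longleftrightarrow> c < y \<bullet> \<omega>"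
    and "0 \<le> c / sqrt (1 - c\<^sup>2)" and "0 < c \<Longrightarrow> 0 < c / sqrt (1 - c\<^sup>2)"
proof -
  have "c\<^sup>2 < 1" using c by (simp add: power_less_one_iff abs_square_less_1)
  then have s: "0 < sqrt (1 - c\<^sup>2)" "(sqrt (1 - c\<^sup>2))\<^sup>2 = 1 - c\<^sup>2" "1 - c\<^sup>2 > 0" by auto
  have "(\<omega> /\<^sub>R sqrt (1 - c\<^sup>2)) \<bullet> (\<omega> /\<^sub>R sqrt (1 - c\<^sup>2)) = 1 / (sqrt (1 - c\<^sup>2))\<^sup>2"
  proof -
    have "(\<omega> /\<^sub>R d) \<bullet> (\<omega> /\<^sub>R d) = 1 / d\<^sup>2" for d
      using \<omega> by (simp add: norm_eq_1 power2_eq_square divide_inverse)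
    then show ?thesis .
  qed
  also have "\<dots> = 1 + (c / sqrt (1 - c\<^sup>2))\<^sup>2"
    unfolding power_divide s(2) using s(3) by (simp add: field_simps)
  finally show "(\<omega> /\<^sub>R sqrt (1 - c\<^sup>2)) \<bullet> (\<omega> /\<^sub>R sqrt (1 - c\<^sup>2)) = 1 + (c / sqrt (1 - c\<^sup>2))\<^sup>2" .
  have "y \<bullet> (\<omega> /\<^sub>R sqrt (1 - c\<^sup>2)) = (y \<bullet> \<omega>) / sqrt (1 - c\<^sup>2)" by (simp add: divide_inverse mult.commute)
  then show "c / sqrt (1 - c\<^sup>2) < y \<bullet> (\<omega> /\<^sub>R sqrt (1 - c\<^sup>2)) \<longleftrightarrow> c < y \<bullet> \<omega>"
    using s(1) by (simp only: divide_less_cancel) auto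
  show "0 \<le> c / sqrt (1 - c\<^sup>2)" "0 < c \<Longrightarrow> 0 < c / sqrt (1 - c\<^sup>2)" using c s(1) by auto
qed

text \<open>Joint continuity serves twice in \<open>hemisphere_le\<close>: for the limit at the
  infimum of \<open>c\<close>, and for a margin that is uniform on a compact set when
  \<open>c\<close> is lowered further.\<close>

lemma cap_refl_continuous:
  assumes \<omega>: "norm \<omega> = 1"
  shows "continuous_on ({0..<1} \<times> sphere 0 1) (\<lambda>z. cap_refl \<omega> (fst z) i (snd z))"
proof -
  let ?D = "{0..<1::real} \<times> sphere (0::'a) 1"
  have s: "sqrt (1 - (fst z)\<^sup>2) \<noteq> 0" if "z \<in> ?D" for z
  proof -
    have "(fst z)\<^sup>2 < 1" using that by (auto simp: power_less_one_iff abs_square_less_1)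
    then show ?thesis by simp
  qed
  define A where "A z = conf_factor (fst z / sqrt (1 - (fst z)\<^sup>2)) (\<omega> /\<^sub>R sqrt (1 - (fst z)\<^sup>2)) (snd z)" for z
  have Ac: "continuous_on ?D A"
    unfolding A_def conf_factor_def by (intro continuous_intros) (use s in auto)
  have A: "A z \<noteq> 0" if "z \<in> ?D" for z
  proof -
    have "0 < A z" unfolding A_def
      by (rule conf_factor_pos[OF cap_param(1)[OF \<omega>]]) (use that in auto)
    then show ?thesis by simp
  qed
  define \<sigma> where "\<sigma> z = conf_refl (fst z / sqrt (1 - (fst z)\<^sup>2)) (\<omega> /\<^sub>R sqrt (1 - (fst z)\<^sup>2)) (snd z)" for z
  have \<sigma>c: "continuous_on ?D \<sigma>"
    unfolding \<sigma>_def conf_refl_def A_def[symmetric] by (intro continuous_intros Ac) (use s A in auto)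
  have \<sigma>: "\<sigma> z \<in> sphere 0 1" if "z \<in> ?D" for z
    unfolding \<sigma>_def using that by (auto intro!: norm_conf_refl[OF cap_param(1)[OF \<omega>]])
  have "continuous_on ?D (\<lambda>z. A z powr (- \<alpha>) * u i (\<sigma> z))"
  proof (intro continuous_on_mult continuous_on_powr Ac continuous_on_const ballI)
    show "continuous_on ?D (\<lambda>z. u i (\<sigma> z))"
      by (rule continuous_on_compose2[OF u_cont \<sigma>c]) (use \<sigma> in auto)
  qed (use A in auto)
  then show ?thesis unfolding cap_refl_def u_refl_def A_def \<sigma>_def .
qed

end

context riesz_system
begin

text \<open>A continuity argument in \<open>c\<close>: the comparison holds near 1, survives the
  passage to the infimum, and can be continued below any positive value. At \<open>c = 0\<close> the
  reflection is the Euclidean one in the hyperplane orthogonal to \<open>\<omega>\<close>.\<close>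

lemma hemisphere_le:
  assumes \<omega>: "norm \<omega> = 1" and z: "norm z = 1" "0 < z \<bullet> \<omega>"
  shows "u i z \<le> u i (z - (2 * (z \<bullet> \<omega>)) *\<^sub>R \<omega>)"
proof -
  define good where "good c \<longleftrightarrow> (\<forall>x i. norm x = 1 \<longrightarrow> c < x \<bullet> \<omega> \<longrightarrow> u i x \<le> cap_refl \<omega> c i x)" for c
  have dim2: "2 \<le> DIM('a)" using dim by simp
  obtain e where e: "0 < e" and narrow: "\<And>b v E i x. v \<bullet> v = 1 + b\<^sup>2 \<Longrightarrow> 0 \<le> b \<Longrightarrow> E \<in> sets sphere_measure \<Longrightarrow>
       (\<And>y j. norm y = 1 \<Longrightarrow> b < y \<bullet> v \<Longrightarrow> y \<notin> E \<Longrightarrow> u j y \<le> u_refl b v j y) \<Longrightarrow>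
       (\<And>z. norm z = 1 \<Longrightarrow> (LINT y|sphere_measure. indicator E y * riesz \<alpha> y z) < e) \<Longrightarrow>
       norm x = 1 \<Longrightarrow> b < x \<bullet> v \<Longrightarrow> u i x \<le> u_refl b v i x"
    using narrow_region by blast
  obtain \<delta> where \<delta>: "0 < \<delta>" and small: "\<And>(E::'a set) x. E \<in> sets sphere_measure \<Longrightarrow> measure sphere_measure E < \<delta> \<Longrightarrow> norm x = 1 \<Longrightarrow>
     (LINT y|sphere_measure. indicator E y * riesz \<alpha> y x) < e"
    using small_set_riesz[OF \<alpha>[unfolded n] dim e] by blast
  define strip where "strip c \<eta> = {x \<in> sphere (0::'a) 1. \<bar>x \<bullet> \<omega> - c\<bar> < \<eta>}" for c \<eta>
  have strip: "strip c \<eta> \<in> sets sphere_measure" for c \<eta>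
  proof -
    have "{x. \<bar>x \<bullet> \<omega> - c\<bar> < \<eta>} \<in> sets borel" by measurable
    then show ?thesis by (auto simp: strip_def sets_restrict_space)
  qed
  \<comment> \<open>The threshold \<open>\<delta>\<close> is the same for all caps, because the
    constant in \<open>narrow_region\<close> does not depend on the reflection. Thus the comparison
    has to be checked only outside a thin strip, whose centre \<open>c0\<close> may differ from
    \<open>c\<close>.\<close>
  have goodI: "good c" if c: "0 \<le> c" "c < 1" and \<eta>: "measure sphere_measure (strip c0 \<eta>) < \<delta>"
    and out: "\<And>y j. norm y = 1 \<Longrightarrow> c < y \<bullet> \<omega> \<Longrightarrow> y \<notin> strip c0 \<eta> \<Longrightarrow> u j y \<le> cap_refl \<omega> c j y" for c c0 \<eta>
    unfolding good_def
  proof (intro allI impI)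
    fix x i assume x: "norm x = 1" "c < x \<bullet> \<omega>"
    show "u i x \<le> cap_refl \<omega> c i x"
      unfolding cap_refl_def
    proof (rule narrow[OF cap_param(1)[OF \<omega> c] cap_param(3)[OF \<omega> c] strip[of c0 \<eta>]])
      show "u j y \<le> u_refl (c / sqrt (1 - c\<^sup>2)) (\<omega> /\<^sub>R sqrt (1 - c\<^sup>2)) j y"
        if "norm y = 1" "c / sqrt (1 - c\<^sup>2) < y \<bullet> (\<omega> /\<^sub>R sqrt (1 - c\<^sup>2))" "y \<notin> strip c0 \<eta>" for y j
        using out[of y j] that unfolding cap_param(2)[OF \<omega> c] cap_refl_def by simp
    qed (use x in \<open>auto simp only: cap_param(2)[OF \<omega> c] intro: small[OF strip \<eta>]\<close>)
  qed
  define G where "G = {c \<in> {0..<1}. \<forall>c'\<in>{c..<1}. good c'}"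
  define cs where "cs = Inf G"
  \<comment> \<open>For \<open>c\<close> near 1 the whole cap lies in a thin strip around height 1,
    so nothing remains to be checked outside it.\<close>
  have Gne: "G \<noteq> {}"
  proof -
    obtain \<eta> where \<eta>: "0 < \<eta>" "measure sphere_measure (strip 1 \<eta>) < \<delta>"
      using sphere_strip_small[OF \<omega> zero_less_one order_refl dim2 \<delta>] unfolding strip_def by blast
    define c0 where "c0 = max 0 (1 - \<eta> / 2)"
    have "good c" if "c \<in> {c0..<1}" for c
    proof (rule goodI[OF _ _ \<eta>(2)])
      show "0 \<le> c" "c < 1" using that by (auto simp: c0_def)
      fix y j assume y: "norm y = 1" "c < y \<bullet> \<omega>" "y \<notin> strip 1 \<eta>"
      have "y \<bullet> \<omega> \<le> 1" using abs_inner_unit_le[OF y(1) \<omega>] by simp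
      then have "y \<in> strip 1 \<eta>" using y that \<eta>(1) by (auto simp: strip_def c0_def)
      then show "u j y \<le> cap_refl \<omega> c j y" using y by simp
    qed
    then have "c0 \<in> G" unfolding G_def using \<eta>(1) by (auto simp: c0_def)
    then show ?thesis by blast
  qed
  have Gb: "bdd_below G" by (rule bdd_belowI[of _ 0]) (auto simp: G_def)
  have cs0: "0 \<le> cs" unfolding cs_def using Gne by (intro cInf_greatest) (auto simp: G_def)
  have cs1: "cs < 1"
  proof -
    obtain g where "g \<in> G" using Gne by blast
    then show ?thesis using cInf_lower[OF _ Gb, of g] unfolding cs_def G_def by auto
  qed
  have above: "good c" if c: "cs < c" "c < 1" for c
  proof -
    obtain g where "g \<in> G" "g < c" using cInf_lessD[OF Gne c(1)[unfolded cs_def]] by blast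
    then show ?thesis using c by (auto simp: G_def)
  qed
  have cont1: "continuous_on {0..<1} (\<lambda>c. cap_refl \<omega> c i x)" if "norm x = 1" for i x
  proof -
    have "continuous_on {0..<1} (\<lambda>c::real. (c, x))" by (intro continuous_intros)
    moreover have "(\<lambda>c::real. (c, x)) ` {0..<1} \<subseteq> {0..<1} \<times> sphere 0 1" using that by auto
    ultimately show ?thesis using continuous_on_compose2[OF cap_refl_continuous[OF \<omega>, of i]] by fastforce
  qed
  \<comment> \<open>A point strictly above height \<open>cs\<close> stays above every
    \<open>c\<close> slightly larger than \<open>cs\<close>, so the inequalities pass to the
    limit.\<close>
  have good_cs: "good cs"
    unfolding good_def
  proof (intro allI impI)
    fix x i assume x: "norm x = 1" "cs < x \<bullet> \<omega>"
    have x1: "x \<bullet> \<omega> \<le> 1" using abs_inner_unit_le[OF x(1) \<omega>] by simp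
    let ?S = "{cs<..<x \<bullet> \<omega>}"
    have "((\<lambda>c. cap_refl \<omega> c i x) \<longlongrightarrow> cap_refl \<omega> cs i x) (at cs within {0..<1})"
      using cont1[OF x(1), of i] cs0 cs1 by (auto simp: continuous_on_def)
    then have "((\<lambda>c. cap_refl \<omega> c i x) \<longlongrightarrow> cap_refl \<omega> cs i x) (at cs within ?S)"
      by (rule tendsto_within_subset) (use cs0 x1 in auto)
    moreover have "\<forall>\<^sub>F c in at cs within ?S. u i x \<le> cap_refl \<omega> c i x"
      unfolding eventually_at_filter
    proof (intro always_eventually allI impI)
      fix c assume "c \<in> ?S"
      then show "u i x \<le> cap_refl \<omega> c i x" using above[of c] x x1 unfolding good_def by auto
    qed
    moreover have "at cs within ?S \<noteq> bot"
      using islimpt_greaterThanLessThan1[OF x(2)] by (simp add: trivial_limit_within)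
    ultimately show "u i x \<le> cap_refl \<omega> cs i x" by (rule tendsto_lowerbound)
  qed
  have "cs = 0"
  proof (rule ccontr)
    assume "cs \<noteq> 0"
    then have csp: "0 < cs" using cs0 by simp
    have strict: "u i x < cap_refl \<omega> cs i x" if x: "norm x = 1" "cs < x \<bullet> \<omega>" for i x
      unfolding cap_refl_def
    proof (rule refl_strict[OF cap_param(1)[OF \<omega> cs0 cs1] cap_param(4)[OF \<omega> cs0 cs1 csp]])
      show "u j y \<le> u_refl (cs / sqrt (1 - cs\<^sup>2)) (\<omega> /\<^sub>R sqrt (1 - cs\<^sup>2)) j y"
        if "norm y = 1" "cs / sqrt (1 - cs\<^sup>2) < y \<bullet> (\<omega> /\<^sub>R sqrt (1 - cs\<^sup>2))" for y j
        using good_cs that unfolding good_def cap_param(2)[OF \<omega> cs0 cs1] cap_refl_def by simp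
    qed (use x in \<open>simp_all only: cap_param(2)[OF \<omega> cs0 cs1]\<close>)
    obtain \<eta> where \<eta>: "0 < \<eta>" "measure sphere_measure (strip cs \<eta>) < \<delta>"
      using sphere_strip_small[OF \<omega> csp less_imp_le[OF cs1] dim2 \<delta>] unfolding strip_def by blast
    \<comment> \<open>On this compact part of the cap the strict inequality at \<open>cs\<close> has
      a positive margin and persists for nearby \<open>c\<close>. The remaining points lie in the
      thin strip around \<open>cs\<close>, which \<open>goodI\<close> absorbs.\<close>
    define K where "K = sphere (0::'a) 1 \<inter> {x. cs + \<eta> \<le> x \<bullet> \<omega>}"
    have K: "compact K" unfolding K_def
      by (intro compact_Int_closed compact_sphere closed_Collect_le continuous_intros)
    have "\<exists>d>0. \<forall>c x. 0 \<le> c \<longrightarrow> c \<le> cs \<longrightarrow> cs - d < c \<longrightarrow> x \<in> K \<longrightarrow> u i x \<le> cap_refl \<omega> c i x" for i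
    proof (cases "K = {}")
      case True
      then show ?thesis by (intro exI[of _ 1]) auto
    next
      case False
      define h where "h z = cap_refl \<omega> (fst z) i (snd z) - u i (snd z)" for z
      have sub: "{0..cs} \<times> K \<subseteq> {0..<1} \<times> sphere 0 1" using cs1 by (auto simp: K_def)
      have "continuous_on ({0..<1} \<times> sphere 0 1) (\<lambda>z. u i (snd z))"
        by (rule continuous_on_compose2[OF u_cont, of _ snd]) (auto intro!: continuous_intros)
      then have hc: "continuous_on ({0..cs} \<times> K) h"
        unfolding h_def by (intro continuous_on_diff continuous_on_subset[OF cap_refl_continuous[OF \<omega>] sub] continuous_on_subset[OF _ sub])
      have huc: "uniformly_continuous_on ({0..cs} \<times> K) h"
        by (rule compact_uniformly_continuous[OF hc]) (intro compact_Times K compact_Icc)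
      have "continuous_on K (\<lambda>x. h (cs, x))"
        by (rule continuous_on_compose2[OF hc]) (use cs0 in \<open>auto intro!: continuous_intros\<close>)
      from continuous_attains_inf[OF K False this] obtain x0 where x0: "x0 \<in> K" "\<forall>x\<in>K. h (cs, x0) \<le> h (cs, x)" by blast
      have hpos: "0 < h (cs, x0)"
        using strict[of x0 i] x0(1) \<eta>(1) by (simp add: h_def K_def)
      obtain d where d: "0 < d" "\<And>z z'. z \<in> {0..cs} \<times> K \<Longrightarrow> z' \<in> {0..cs} \<times> K \<Longrightarrow> dist z' z < d \<Longrightarrow> dist (h z') (h z) < h (cs, x0)"
        using huc hpos unfolding uniformly_continuous_on_def by metis
      show ?thesis
      proof (intro exI[of _ d] conjI allI impI d(1))
        fix c x assume c: "0 \<le> c" "c \<le> cs" "cs - d < c" and x: "x \<in> K"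
        have "dist (c, x) (cs, x) < d" using c by (simp add: dist_Pair_Pair dist_real_def)
        from d(2)[OF _ _ this] c x cs0 have "dist (h (c, x)) (h (cs, x)) < h (cs, x0)" by auto
        moreover have "h (cs, x0) \<le> h (cs, x)" using x0(2) x by blast
        ultimately have "0 < h (c, x)" by (simp add: dist_real_def abs_if split: if_splits)
        then show "u i x \<le> cap_refl \<omega> c i x" by (simp add: h_def)
      qed
    qed
    then obtain d where d: "\<And>i. 0 < d i"
      "\<And>i c x. 0 \<le> c \<Longrightarrow> c \<le> cs \<Longrightarrow> cs - d i < c \<Longrightarrow> x \<in> K \<Longrightarrow> u i x \<le> cap_refl \<omega> c i x" by metis
    define d0 where "d0 = Min (range d)"
    have d0: "0 < d0" unfolding d0_def using d(1) by (subst Min_gr_iff) auto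
    have d0le: "d0 \<le> d i" for i unfolding d0_def by (rule Min_le) auto
    \<comment> \<open>The three terms keep \<open>c1\<close> nonnegative, within the range of
      persistence \<open>d0\<close>, and above \<open>cs - \<eta>\<close>. By the last bound, a
      point above height \<open>c\<close> and outside the strip lies above
      \<open>cs + \<eta>\<close>, hence in \<open>K\<close>.\<close>
    define c1 where "c1 = max (cs / 2) (max (cs - d0 / 2) (cs - \<eta> / 2))"
    have c1: "0 \<le> c1" "c1 < cs" "cs - d0 < c1" "cs - \<eta> < c1"
      using csp d0 \<eta>(1) by (auto simp: c1_def less_max_iff_disj le_max_iff_disj)
    have below: "good c" if c: "c1 \<le> c" "c < cs" for c
    proof (rule goodI[OF _ _ \<eta>(2)])
      show "0 \<le> c" "c < 1" using c c1 cs1 by auto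
      fix y j assume y: "norm y = 1" "c < y \<bullet> \<omega>" "y \<notin> strip cs \<eta>"
      then have "\<eta> \<le> \<bar>y \<bullet> \<omega> - cs\<bar>" by (simp add: strip_def)
      then have "y \<in> K" using y c c1 by (auto simp: K_def abs_if split: if_splits)
      then show "u j y \<le> cap_refl \<omega> c j y"
        using c c1 d0le[of j] by (intro d(2)) auto
    qed
    have "c1 \<in> G"
      unfolding G_def
    proof (intro CollectI conjI ballI)
      show "c1 \<in> {0..<1}" using c1 cs1 by auto
      fix c assume "c \<in> {c1..<1}"
      then show "good c" using below[of c] above[of c] good_cs by (cases c cs rule: linorder_cases) auto
    qed
    then have "cs \<le> c1" unfolding cs_def by (rule cInf_lower[OF _ Gb])
    then show False using c1 by simp
  qed
  then have "u i z \<le> cap_refl \<omega> 0 i z" using good_cs z unfolding good_def by blast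
  then show ?thesis by (simp add: cap_refl_def u_refl_def conf_factor_def conf_refl_def)
qed

text \<open>The hyperplane reflection that exchanges \<open>x\<close> and \<open>y\<close> is used
  with both orientations of its normal, which yields the two inequalities.\<close>

proposition solution_constant:
  assumes x: "norm x = 1" and y: "norm y = 1"
  shows "u i x = u i y"
proof -
  have le: "u i x \<le> u i y" if x: "norm x = 1" and y: "norm y = 1" for x y
  proof (cases "x = y")
    case False
    then have nz: "norm (x - y) > 0" by simp
    define \<omega> where "\<omega> = (x - y) /\<^sub>R norm (x - y)"
    have \<omega>: "norm \<omega> = 1" using nz by (simp add: \<omega>_def)
    have xy: "2 * (x \<bullet> (x - y)) = (norm (x - y))\<^sup>2"
      unfolding norm_diff_sq_unit[OF x y] using x by (simp add: inner_diff_right norm_eq_1)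
    have xw: "2 * (x \<bullet> \<omega>) = norm (x - y)"
    proof -
      have "2 * (x \<bullet> \<omega>) = 2 * (x \<bullet> (x - y)) / norm (x - y)" by (simp add: \<omega>_def divide_inverse mult_ac)
      then show ?thesis unfolding xy using nz by (simp add: power2_eq_square)
    qed
    have "x - (2 * (x \<bullet> \<omega>)) *\<^sub>R \<omega> = y" unfolding xw using nz by (simp add: \<omega>_def)
    moreover have "0 < x \<bullet> \<omega>" using xw nz by linarith
    ultimately show ?thesis using hemisphere_le[OF \<omega> x, of i] by simp
  qed simp
  show ?thesis using le[OF x y] le[OF y x] by simp
qed

end

section \<open>From weak solutions to the integral system\<close>

text \<open>Restates the hypotheses on \<open>h\<close> for the source \<open>g\<close>, its first
  argument being the component the equation belongs to. Multiplying the ray inequality by the power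
  \<open>p\<close> of \<open>r * a\<close> turns it into strict subhomogeneity of degree
  \<open>p\<close>.\<close>

lemma ray_decreasing_source:
  fixes g :: "real \<Rightarrow> real \<Rightarrow> real" and p :: real
  defines "h \<equiv> \<lambda>a b. a powr (- p) * g a b"
  assumes mono2: "\<And>t a b. 0 < t \<Longrightarrow> 0 < a \<Longrightarrow> a \<le> b \<Longrightarrow> h t a \<le> h t b"
    and mono1: "\<And>t a b. 0 < t \<Longrightarrow> 0 < a \<Longrightarrow> a \<le> b \<Longrightarrow> h a t * a powr p \<le> h b t * b powr p"
    and dec: "\<And>a b t t'. 0 < a \<Longrightarrow> 0 < b \<Longrightarrow> 0 < t \<Longrightarrow> t < t' \<Longrightarrow> h (a * t') (b * t') < h (a * t) (b * t)"
    and p: "0 < p"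
  shows "\<And>a b a' b'. 0 < a \<Longrightarrow> 0 < b \<Longrightarrow> a \<le> a' \<Longrightarrow> b \<le> b' \<Longrightarrow> g a b \<le> g a' b'"
    and "\<And>a b r. 0 < a \<Longrightarrow> 0 < b \<Longrightarrow> 0 < r \<Longrightarrow> r < 1 \<Longrightarrow> r powr p * g a b < g (r * a) (r * b)"
    and "\<And>a b. 0 < a \<Longrightarrow> 0 < b \<Longrightarrow> 0 < g a b"
proof -
  have hg: "h a b * a powr p = g a b" if "0 < a" for a b
    using that by (simp add: h_def powr_minus field_simps)
  show mono: "g a b \<le> g a' b'" if "0 < a" "0 < b" "a \<le> a'" "b \<le> b'" for a b a' b'
  proof -
    have "h a b * a powr p \<le> h a b' * a powr p" using mono2[of a b b'] that by (intro mult_right_mono) auto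
    also have "\<dots> \<le> h a' b' * a' powr p" using mono1[of b' a a'] that by auto
    finally show ?thesis using hg that by auto
  qed
  show sub: "r powr p * g a b < g (r * a) (r * b)" if ab: "0 < a" "0 < b" and r: "0 < r" "r < 1" for a b r
  proof -
    have "h a b < h (r * a) (r * b)" using dec[of a b r 1] ab r by (simp add: mult.commute)
    then have "h a b * (r * a) powr p < h (r * a) (r * b) * (r * a) powr p"
      using ab r by (intro mult_strict_right_mono) auto
    moreover have "h a b * (r * a) powr p = r powr p * (h a b * a powr p)"
      using ab r by (simp add: powr_mult mult_ac)
    ultimately show ?thesis using hg ab r by auto
  qed
  show "0 < g a b" if ab: "0 < a" "0 < b" for a b
  proof -
    \<comment> \<open>Positivity of the source is not assumed: subhomogeneity at ratio 1/2 and
      monotonicity bound a fraction of \<open>g a b\<close> strictly by \<open>g a b\<close>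
      itself.\<close>
    have "(1 / 2) powr p * g a b < g (1 / 2 * a) (1 / 2 * b)" by (rule sub[OF ab]) auto
    also have "\<dots> \<le> g a b" using ab by (intro mono) auto
    finally have "0 < (1 - (1 / 2) powr p) * g a b" by (simp add: algebra_simps)
    moreover have "(1 / 2) powr p < (1::real)" using powr_less_mono2[of p "1 / 2" 1] p by simp
    ultimately show ?thesis by (simp add: zero_less_mult_iff)
  qed
qed

text \<open>For the eigenvalue \<open>l * (l + n - 1)\<close> the radicand in \<open>Ps_mult\<close>
  is the perfect square of \<open>l + (n - 1) / 2\<close>, so the multiplier becomes the Gamma
  quotient that the Beta moments invert.\<close>

lemma weak_solution_gegenbauer:
  fixes u f :: "'a::euclidean_space \<Rightarrow> real" and s :: real
  defines "n \<equiv> real DIM('a) - 1"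
  assumes sol: "weak_solution n s u f" and u: "continuous_on (sphere 0 1) u" and f: "continuous_on (sphere 0 1) f"
    and n: "1 \<le> n" and y: "norm y = 1"
  shows "Gamma (real l + n / 2 + s) / Gamma (real l + n / 2 - s) * (LINT x|sphere_measure. u x * poly (gegenbauer ((n - 1) / 2) l) (x \<bullet> y))
    = (LINT x|sphere_measure. (f x + d_const n s * u x) * poly (gegenbauer ((n - 1) / 2) l) (x \<bullet> y))"
proof -
  define \<nu> where "\<nu> = (n - 1) / 2"
  define Y where "Y x = poly (gegenbauer \<nu> l) (x \<bullet> y)" for x
  define lam where "lam = real l * (real l + 2 * \<nu>)"
  define m where "m = Ps_mult n s lam"
  have Y: "continuous_on (sphere 0 1) Y" unfolding Y_def by (intro continuous_intros)
  have "sqrt (lam + ((n - 1) / 2)\<^sup>2) = sqrt ((real l + \<nu>)\<^sup>2)"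
    by (simp add: lam_def \<nu>_def[symmetric] power2_eq_square algebra_simps)
  also have "\<dots> = real l + \<nu>" using n by (simp add: \<nu>_def)
  finally have m: "m = Gamma (real l + n / 2 + s) / Gamma (real l + n / 2 - s)"
    unfolding m_def Ps_mult_def Let_def by (simp add: \<nu>_def field_simps)
  have "sph_eigenfun lam Y"
    unfolding lam_def Y_def by (rule sph_eigenfun_gegenbauer[OF y]) (simp add: \<nu>_def n_def)
  then have "sphere_integral (\<lambda>x. u x * ((m - d_const n s) * Y x)) = sphere_integral (\<lambda>x. f x * Y x)"
    using sol unfolding weak_solution_def m_def by blast
  then have "(LINT x|sphere_measure. u x * ((m - d_const n s) * Y x)) = (LINT x|sphere_measure. f x * Y x)"
    by (subst (asm) (1 2) sphere_integral_eq) (auto intro!: continuous_intros u f Y)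
  moreover have "(LINT x|sphere_measure. u x * ((m - d_const n s) * Y x)) = (m - d_const n s) * (LINT x|sphere_measure. u x * Y x)"
    by (simp only: mult.left_commute[of "u _"] integral_mult_right_zero)
  ultimately have E: "(LINT x|sphere_measure. f x * Y x) = (m - d_const n s) * (LINT x|sphere_measure. u x * Y x)" by simp
  have "(LINT x|sphere_measure. (f x + d_const n s * u x) * Y x) = (LINT x|sphere_measure. f x * Y x + d_const n s * (u x * Y x))"
    by (simp add: algebra_simps)
  also have "\<dots> = (LINT x|sphere_measure. f x * Y x) + (LINT x|sphere_measure. d_const n s * (u x * Y x))"
    by (intro Bochner_Integration.integral_add integrable_sphereI continuous_intros u f Y)
  also have "\<dots> = m * (LINT x|sphere_measure. u x * Y x)" unfolding E by (simp add: left_diff_distrib)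
  finally show ?thesis unfolding m Y_def \<nu>_def by simp
qed

theorem theorem1p6:
  fixes f1 f2 :: "real \<Rightarrow> real \<Rightarrow> real"
    and u1 u2 :: "'a::euclidean_space \<Rightarrow> real"
    and s :: real
  defines "n \<equiv> real DIM('a) - 1"
  defines "d \<equiv> d_const n s"
  defines "p \<equiv> (n + 2 * s) / (n - 2 * s)"
  defines "h1 \<equiv> (\<lambda>t1 t2. t1 powr (- p) * (f1 t1 t2 + d * t1))"
  defines "h2 \<equiv> (\<lambda>t1 t2. t2 powr (- p) * (f2 t1 t2 + d * t2))"
  assumes n3: "n \<ge> 3"
    and s_pos: "0 < s" and s_lt: "s < n / 2"
    and f1_cont: "continuous_on ({0<..} \<times> {0<..}) (\<lambda>(a, b). f1 a b)"
    and f2_cont: "continuous_on ({0<..} \<times> {0<..}) (\<lambda>(a, b). f2 a b)"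
    and h1_mono2: "\<And>t1 a b. 0 < t1 \<Longrightarrow> 0 < a \<Longrightarrow> a \<le> b \<Longrightarrow> h1 t1 a \<le> h1 t1 b"
    and h2_mono1: "\<And>t2 a b. 0 < t2 \<Longrightarrow> 0 < a \<Longrightarrow> a \<le> b \<Longrightarrow> h2 a t2 \<le> h2 b t2"
    and h1_mono1: "\<And>t2 a b. 0 < t2 \<Longrightarrow> 0 < a \<Longrightarrow> a \<le> b \<Longrightarrow>
                     h1 a t2 * a powr p \<le> h1 b t2 * b powr p"
    and h2_mono2: "\<And>t1 a b. 0 < t1 \<Longrightarrow> 0 < a \<Longrightarrow> a \<le> b \<Longrightarrow>
                     h2 t1 a * a powr p \<le> h2 t1 b * b powr p"
    and h1_dec: "\<And>a1 a2 t t'. 0 < a1 \<Longrightarrow> 0 < a2 \<Longrightarrow> 0 < t \<Longrightarrow> t < t' \<Longrightarrow>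
                     h1 (a1 * t') (a2 * t') < h1 (a1 * t) (a2 * t)"
    and h2_dec: "\<And>a1 a2 t t'. 0 < a1 \<Longrightarrow> 0 < a2 \<Longrightarrow> 0 < t \<Longrightarrow> t < t' \<Longrightarrow>
                     h2 (a1 * t') (a2 * t') < h2 (a1 * t) (a2 * t)"
    and u1_cont: "continuous_on (sphere 0 1) u1"
    and u2_cont: "continuous_on (sphere 0 1) u2"
    and u1_pos: "\<And>x. x \<in> sphere 0 1 \<Longrightarrow> 0 < u1 x"
    and u2_pos: "\<And>x. x \<in> sphere 0 1 \<Longrightarrow> 0 < u2 x"
    and sol1: "weak_solution n s u1 (\<lambda>x. f1 (u1 x) (u2 x))"
    and sol2: "weak_solution n s u2 (\<lambda>x. f2 (u1 x) (u2 x))"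
  shows "\<exists>c1 c2. \<forall>x\<in>sphere 0 1. u1 x = c1 \<and> u2 x = c2"
proof -
  define u :: "bool \<Rightarrow> 'a \<Rightarrow> real" where "u i = (if i then u1 else u2)" for i
  define g1 where "g1 a b = f1 a b + d * a" for a b
  \<comment> \<open>The arguments are exchanged so that each equation has its own component first;
    \<open>ray_decreasing_source\<close> then applies to both, and \<open>bool\<close> indexes the
    two equations.\<close>
  define g2 where "g2 a b = f2 b a + d * a" for a b
  define \<Phi> :: "bool \<Rightarrow> (bool \<Rightarrow> real) \<Rightarrow> real"
    where "\<Phi> i t = (if i then g1 (t True) (t False) else g2 (t False) (t True))" for i t
  define \<alpha> where "\<alpha> = n / 2 - s"
  have \<alpha>: "0 < \<alpha>" "\<alpha> < n / 2" using s_pos s_lt by (auto simp: \<alpha>_def)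
  have p: "\<alpha> * p = n - \<alpha>" using s_lt by (simp add: \<alpha>_def p_def field_simps)
  have p0: "0 < p" using s_pos s_lt by (simp add: p_def)
  have k1: "t powr - p * g1 t a \<le> t powr - p * g1 t b" if "0 < t" "0 < a" "a \<le> b" for t a b
    using h1_mono2[OF that] unfolding h1_def g1_def .
  have l1: "a powr - p * g1 a t * a powr p \<le> b powr - p * g1 b t * b powr p" if "0 < t" "0 < a" "a \<le> b" for t a b
    using h1_mono1[OF that] unfolding h1_def g1_def .
  have d1: "(a * t') powr - p * g1 (a * t') (b * t') < (a * t) powr - p * g1 (a * t) (b * t)"
    if "0 < a" "0 < b" "0 < t" "t < t'" for a b t t'
    using h1_dec[of a b t t'] that unfolding h1_def g1_def by simp
  have g1_mono: "g1 a b \<le> g1 a' b'" if "0 < a" "0 < b" "a \<le> a'" "b \<le> b'" for a b a' b'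
    by (rule ray_decreasing_source(1)[where p = p and g = g1]; (rule p0 | rule that | rule k1 l1 d1; assumption))
  have g1_sub: "r powr p * g1 a b < g1 (r * a) (r * b)" if "0 < a" "0 < b" "0 < r" "r < 1" for a b r
    by (rule ray_decreasing_source(2)[where p = p and g = g1]; (rule p0 | rule that | rule k1 l1 d1; assumption))
  have g1_pos: "0 < g1 a b" if "0 < a" "0 < b" for a b
    by (rule ray_decreasing_source(3)[where p = p and g = g1]; (rule p0 | rule that | rule k1 l1 d1; assumption))
  have k2: "t powr - p * g2 t a \<le> t powr - p * g2 t b" if "0 < t" "0 < a" "a \<le> b" for t a b
    using h2_mono1[OF that] unfolding h2_def g2_def .
  have l2: "a powr - p * g2 a t * a powr p \<le> b powr - p * g2 b t * b powr p" if "0 < t" "0 < a" "a \<le> b" for t a b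
    using h2_mono2[OF that] unfolding h2_def g2_def .
  have d2: "(a * t') powr - p * g2 (a * t') (b * t') < (a * t) powr - p * g2 (a * t) (b * t)"
    if "0 < a" "0 < b" "0 < t" "t < t'" for a b t t'
    using h2_dec[of b a t t'] that unfolding h2_def g2_def by simp
  have g2_mono: "g2 a b \<le> g2 a' b'" if "0 < a" "0 < b" "a \<le> a'" "b \<le> b'" for a b a' b'
    by (rule ray_decreasing_source(1)[where p = p and g = g2]; (rule p0 | rule that | rule k2 l2 d2; assumption))
  have g2_sub: "r powr p * g2 a b < g2 (r * a) (r * b)" if "0 < a" "0 < b" "0 < r" "r < 1" for a b r
    by (rule ray_decreasing_source(2)[where p = p and g = g2]; (rule p0 | rule that | rule k2 l2 d2; assumption))
  have g2_pos: "0 < g2 a b" if "0 < a" "0 < b" for a b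
    by (rule ray_decreasing_source(3)[where p = p and g = g2]; (rule p0 | rule that | rule k2 l2 d2; assumption))
  have u_cont: "continuous_on (sphere 0 1) (u i)" for i using u1_cont u2_cont by (simp add: u_def)
  have u_pos: "0 < u i x" if "norm x = 1" for i x using u1_pos u2_pos that by (simp add: u_def)
  have f_cont: "continuous_on (sphere 0 1) (\<lambda>x. f1 (u1 x) (u2 x))" "continuous_on (sphere 0 1) (\<lambda>x. f2 (u1 x) (u2 x))"
  proof -
    have "continuous_on (sphere 0 1) (\<lambda>x. (u1 x, u2 x))" by (intro continuous_intros u1_cont u2_cont)
    moreover have "(\<lambda>x. (u1 x, u2 x)) ` sphere 0 1 \<subseteq> {0<..} \<times> {0<..}" using u1_pos u2_pos by auto
    ultimately show "continuous_on (sphere 0 1) (\<lambda>x. f1 (u1 x) (u2 x))" "continuous_on (sphere 0 1) (\<lambda>x. f2 (u1 x) (u2 x))"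
      using continuous_on_compose2[OF f1_cont] continuous_on_compose2[OF f2_cont] by fastforce+
  qed
  have F: "\<Phi> i (\<lambda>j. u j x) = (if i then f1 (u1 x) (u2 x) + d * u1 x else f2 (u1 x) (u2 x) + d * u2 x)" for i x
    by (simp add: \<Phi>_def u_def g1_def g2_def)
  have F_cont: "continuous_on (sphere 0 1) (\<lambda>x. \<Phi> i (\<lambda>j. u j x))" for i
    unfolding F by (cases i) (auto intro!: continuous_intros f_cont u1_cont u2_cont)
  have F_pos: "0 < \<Phi> i t" if "\<And>j. 0 < t j" for i t
    using g1_pos g2_pos that by (simp add: \<Phi>_def)
  have rel: "Gamma (real l + n / 2 + s) / Gamma (real l + n / 2 - s) * (LINT x|sphere_measure. u i x * poly (gegenbauer ((n - 1) / 2) l) (x \<bullet> y))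
      = (LINT x|sphere_measure. \<Phi> i (\<lambda>j. u j x) * poly (gegenbauer ((n - 1) / 2) l) (x \<bullet> y))" if "norm y = 1" for i l y
  proof -
    have "1 \<le> real DIM('a) - 1" using n3 by (simp add: n_def)
    from weak_solution_gegenbauer[OF sol1[unfolded n_def] u1_cont f_cont(1) this that, of l]
      weak_solution_gegenbauer[OF sol2[unfolded n_def] u2_cont f_cont(2) this that, of l]
    show ?thesis unfolding F n_def[symmetric] d_def[symmetric] by (cases i) (simp_all add: u_def)
  qed
  obtain \<kappa> where \<kappa>: "0 < \<kappa>"
    "\<And>i y. norm y = 1 \<Longrightarrow> u i y = \<kappa> * (LINT x|sphere_measure. riesz \<alpha> x y * \<Phi> i (\<lambda>j. u j x))"
  proof (rule riesz_representation[where u = u and F = "\<lambda>i x. \<Phi> i (\<lambda>j. u j x)" and s = s])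
    show "1 < real DIM('a) - 1" using n3 by (simp add: n_def)
    show "s < (real DIM('a) - 1) / 2" using s_lt by (simp add: n_def)
  qed (use s_pos u_cont u_pos F_cont F_pos rel in \<open>auto simp: n_def \<alpha>_def\<close>)
  interpret riesz_system u \<Phi> n \<alpha> \<kappa> p
  proof
    show "n = real DIM('a) - 1" by (rule n_def[THEN meta_eq_to_obj_eq])
    show "3 \<le> DIM('a)" using n3 by (simp add: n_def)
    show "\<Phi> i t \<le> \<Phi> i t'" if "\<And>j. 0 < t j" "\<And>j. t j \<le> t' j" for i t t'
      using that by (auto simp: \<Phi>_def intro!: g1_mono g2_mono)
    show "r powr p * \<Phi> i t < \<Phi> i (\<lambda>j. r * t j)" if "0 < r" "r < 1" "\<And>j. 0 < t j" for i t r
      using that by (auto simp: \<Phi>_def intro!: g1_sub g2_sub)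
  qed (use \<alpha> p \<kappa> u_cont u_pos F_cont F_pos in auto)
  obtain e :: 'a where e: "norm e = 1" using vector_choose_size[of 1] by auto
  have "u1 x = u1 e \<and> u2 x = u2 e" if "x \<in> sphere 0 1" for x
    using solution_constant[of x e True] solution_constant[of x e False] that e by (simp add: u_def)
  then show ?thesis by blast
qed

end
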